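(* Let $\Sigma$ be a hypersurface of a Riemannian manifold $\overline{M}$ of dimension $m+1\geq 3$, let $q\in\Sigma$, let $N(q)$ be a unit normal vector to $\Sigma$ at $q$, and let $\{v_1,\dots,v_m\}$ be an arbitrary orthonormal basis of $T_q\Sigma$. Fix an integer $s$ with $0<s\leq m-1$. For each subset $\alpha\subset\{v_1,\dots,v_m\}$ of cardinality $s$, let $M_\alpha$ be an $(s+1)$-dimensional submanifold of $\overline{M}$ through $q$, totally geodesic at $q$, with $T_qM_\alpha={\rm span}(\alpha\cup\{N(q)\})$. Then the mean curvature of $\Sigma$ at $q$ is the arithmetic mean, over all subsets $\alpha$ of cardinality $s$, of the mean curvatures at $q$ of the hypersurfaces $S_{M_\alpha}=M_\alpha\cap\Sigma$ of $M_\alpha$.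
   Context: For a $k$-dimensional submanifold $S$ of a Riemannian manifold with second fundamental form ${\rm II}_S$ (normal part of the ambient covariant derivative), the mean curvature vector at $p$ is ${\rm H}(p)=\frac1k\,{\rm trace}\,{\rm II}_S(p)$. For a hypersurface with a chosen (local) unit normal field, the mean curvature is the proportionality factor of ${\rm H}$ with respect to that unit normal. Here $S_{M_\alpha}$ is (near $q$) a hypersurface of $M_\alpha$ whose normal line at $q$ is spanned by $N(q)$, and its mean curvature at $q$ is taken with respect to $N(q)$, as is that of $\Sigma$. A submanifold $M$ is totally geodesic at $q\in M$ if every geodesic of $M$ with initial vector in $T_qM$ is a geodesic of $\overline{M}$ for all parameters in some neighborhood of $0$. *)

theory Defs
  imports "HOL-Analysis.Analysis" "HOL-Library.Function_Algebras"
begin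

instantiation "fun" :: (type, real_vector) real_vector
begin

definition scaleR_fun :: "real \<Rightarrow> ('a \<Rightarrow> 'b) \<Rightarrow> 'a \<Rightarrow> 'b" where
  "scaleR_fun r f = (\<lambda>x. r *\<^sub>R f x)"

instance
  by standard (auto simp: scaleR_fun_def fun_eq_iff algebra_simps)

end

section \<open>Smooth functions\<close>

text \<open>Both notions are meant for an open set \<open>S\<close>; \<open>smooth_on S f\<close> is \<open>C\<^sup>\<infinity>\<close>.\<close>

primrec Ck_on ::
  "nat \<Rightarrow> 'a::real_normed_vector set \<Rightarrow> ('a \<Rightarrow> 'b::real_normed_vector) \<Rightarrow> bool" where
  "Ck_on 0 S f \<longleftrightarrow> continuous_on S f"
| "Ck_on (Suc k) S f \<longleftrightarrow>
     (\<forall>x\<in>S. f differentiable (at x)) \<and> (\<forall>v. Ck_on k S (\<lambda>x. frechet_derivative f (at x) v))"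

definition smooth_on ::
  "'a::real_normed_vector set \<Rightarrow> ('a \<Rightarrow> 'b::real_normed_vector) \<Rightarrow> bool" where
  "smooth_on S f \<longleftrightarrow> (\<forall>k. Ck_on k S f)"

section \<open>Charts and smooth structures\<close>

text \<open>A chart is a pair of its domain and its coordinate map; the values of the coordinate map
  outside the domain are irrelevant. The underlying set of a manifold is a set \<open>X\<close> of
  points, with the subspace topology.\<close>

type_synonym ('p, 'a) chart = "'p set \<times> ('p \<Rightarrow> 'a)"

definition chart_inv :: "('p, 'a) chart \<Rightarrow> 'a \<Rightarrow> 'p" where
  "chart_inv c = inv_into (fst c) (snd c)"

definition overlap :: "('p, 'a) chart \<Rightarrow> ('p, 'b) chart \<Rightarrow> 'a set" where
  "overlap c d = snd c ` (fst c \<inter> fst d)"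

definition transition :: "('p, 'a) chart \<Rightarrow> ('p, 'b) chart \<Rightarrow> 'a \<Rightarrow> 'b" where
  "transition c d = snd d \<circ> chart_inv c"

definition is_chart ::
  "'p::topological_space set \<Rightarrow> ('p, 'a::euclidean_space) chart \<Rightarrow> bool" where
  "is_chart X c \<longleftrightarrow>
     openin (top_of_set X) (fst c) \<and> open (snd c ` fst c) \<and>
     homeomorphism (fst c) (snd c ` fst c) (snd c) (chart_inv c)"

definition compatible ::
  "('p, 'a::euclidean_space) chart \<Rightarrow> ('p, 'a) chart \<Rightarrow> bool" where
  "compatible c d \<longleftrightarrow>
     smooth_on (overlap c d) (transition c d) \<and> smooth_on (overlap d c) (transition d c)"

text \<open>A smooth structure is a maximal smooth atlas.\<close>

definition smooth_structure ::
  "'p::topological_space set \<Rightarrow> ('p, 'a::euclidean_space) chart set \<Rightarrow> bool" where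
  "smooth_structure X A \<longleftrightarrow>
     (\<forall>c\<in>A. is_chart X c) \<and> (\<Union>c\<in>A. fst c) = X \<and> (\<forall>c\<in>A. \<forall>d\<in>A. compatible c d) \<and>
     (\<forall>c. is_chart X c \<and> (\<forall>d\<in>A. compatible c d) \<longrightarrow> c \<in> A)"

definition charts_at :: "('p, 'a) chart set \<Rightarrow> 'p \<Rightarrow> ('p, 'a) chart set" where
  "charts_at A p = {c \<in> A. p \<in> fst c}"

section \<open>Tangent vectors\<close>

text \<open>A tangent vector at \<open>p\<close> is the family of its coordinate vectors with respect
  to all charts around \<open>p\<close>, which transform by the derivatives of the transition maps. It is
  set to \<open>0\<close> on all other charts, so that the tangent space is a linear subspace of the
  space of all functions from charts to \<open>'a\<close>.\<close>

type_synonym ('p, 'a) tvec = "('p, 'a) chart \<Rightarrow> 'a"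

definition tangent_space ::
  "('p, 'a::euclidean_space) chart set \<Rightarrow> 'p \<Rightarrow> ('p, 'a) tvec set" where
  "tangent_space A p =
     {v. (\<forall>c\<in>charts_at A p. \<forall>d\<in>charts_at A p.
            v d = frechet_derivative (transition c d) (at (snd c p)) (v c)) \<and>
         (\<forall>c. c \<notin> charts_at A p \<longrightarrow> v c = 0)}"

text \<open>The vector at \<open>p\<close> which is the image of \<open>a\<close> under the derivative of the
  parametrization \<open>chart_inv c\<close>. Here \<open>c\<close> is either a chart of \<open>A\<close>, or a
  chart of a submanifold, whose model space \<open>'b\<close> is a different one.\<close>

definition vec_of ::
  "('p, 'a::euclidean_space) chart set \<Rightarrow> ('p, 'b::euclidean_space) chart \<Rightarrow> 'p \<Rightarrow> 'b \<Rightarrow> ('p, 'a) tvec" where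
  "vec_of A c p a =
     (\<lambda>d. if d \<in> charts_at A p then frechet_derivative (transition c d) (at (snd c p)) a else 0)"

text \<open>The derivative at \<open>p\<close> of the inclusion of a submanifold with atlas \<open>B\<close> into a
  manifold with atlas \<open>A\<close>; it does not depend on the selected chart.\<close>

definition inclusion_differential ::
  "('p, 'b::euclidean_space) chart set \<Rightarrow> ('p, 'a::euclidean_space) chart set \<Rightarrow> 'p \<Rightarrow>
   ('p, 'b) tvec \<Rightarrow> ('p, 'a) tvec" where
  "inclusion_differential B A p w =
     (let c = (SOME c. c \<in> charts_at B p) in vec_of A c p (w c))"

section \<open>Riemannian manifolds\<close>

record ('p, 'a) riemannian =
  pts :: "'p set"
  atlas :: "('p, 'a) chart set"
  metric :: "'p \<Rightarrow> ('p, 'a) tvec \<Rightarrow> ('p, 'a) tvec \<Rightarrow> real"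

definition metric_coords ::
  "('p, 'a::euclidean_space) riemannian \<Rightarrow> ('p, 'a) chart \<Rightarrow> 'a \<Rightarrow> 'a \<Rightarrow> 'a \<Rightarrow> real" where
  "metric_coords M c x a b =
     (let p = chart_inv c x in metric M p (vec_of (atlas M) c p a) (vec_of (atlas M) c p b))"

definition inner_product_on :: "'v::real_vector set \<Rightarrow> ('v \<Rightarrow> 'v \<Rightarrow> real) \<Rightarrow> bool" where
  "inner_product_on T g \<longleftrightarrow>
     (\<forall>u\<in>T. \<forall>v\<in>T. g u v = g v u) \<and>
     (\<forall>u\<in>T. \<forall>v\<in>T. \<forall>w\<in>T. \<forall>a b. g (a *\<^sub>R u + b *\<^sub>R v) w = a * g u w + b * g v w) \<and>
     (\<forall>u\<in>T. u \<noteq> 0 \<longrightarrow> g u u > 0)"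

text \<open>The dimension of the manifold is \<open>DIM('a)\<close>.\<close>

definition riemannian_manifold ::
  "('p::{t2_space,second_countable_topology}, 'a::euclidean_space) riemannian \<Rightarrow> bool" where
  "riemannian_manifold M \<longleftrightarrow>
     smooth_structure (pts M) (atlas M) \<and>
     (\<forall>p\<in>pts M. inner_product_on (tangent_space (atlas M) p) (metric M p)) \<and>
     (\<forall>c\<in>atlas M. \<forall>a b. smooth_on (snd c ` fst c) (\<lambda>x. metric_coords M c x a b))"

section \<open>The Levi-Civita connection\<close>

text \<open>The Christoffel map of the Levi-Civita connection in the chart \<open>c\<close>: the vector
  \<open>christoffel M c x a b\<close> is the covariant derivative of the coordinate field \<open>b\<close>
  in the direction \<open>a\<close>, as given by the Koszul formula for constant coordinate fields.\<close>

definition christoffel ::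
  "('p, 'a::euclidean_space) riemannian \<Rightarrow> ('p, 'a) chart \<Rightarrow> 'a \<Rightarrow> 'a \<Rightarrow> 'a \<Rightarrow> 'a" where
  "christoffel M c x a b =
     (THE z. \<forall>w. metric_coords M c x z w =
        (frechet_derivative (\<lambda>y. metric_coords M c y b w) (at x) a
         + frechet_derivative (\<lambda>y. metric_coords M c y a w) (at x) b
         - frechet_derivative (\<lambda>y. metric_coords M c y a b) (at x) w) / 2)"

definition smooth_field ::
  "('p, 'a::euclidean_space) riemannian \<Rightarrow> 'p set \<Rightarrow> ('p \<Rightarrow> ('p, 'a) tvec) \<Rightarrow> bool" where
  "smooth_field M W V \<longleftrightarrow>
     (\<forall>p\<in>W. V p \<in> tangent_space (atlas M) p) \<and>
     (\<forall>c\<in>atlas M. smooth_on (snd c ` (fst c \<inter> W)) (\<lambda>x. V (chart_inv c x) c))"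

definition covariant_derivative ::
  "('p, 'a::euclidean_space) riemannian \<Rightarrow> ('p \<Rightarrow> ('p, 'a) tvec) \<Rightarrow> 'p \<Rightarrow> ('p, 'a) tvec \<Rightarrow> ('p, 'a) tvec" where
  "covariant_derivative M V p u =
     (\<lambda>c. if c \<in> charts_at (atlas M) p
          then frechet_derivative (\<lambda>x. V (chart_inv c x) c) (at (snd c p)) (u c)
               + christoffel M c (snd c p) (u c) (V p c)
          else 0)"

section \<open>Curves and geodesics\<close>

definition smooth_curve ::
  "('p::topological_space, 'a::euclidean_space) riemannian \<Rightarrow> real set \<Rightarrow> (real \<Rightarrow> 'p) \<Rightarrow> bool" where
  "smooth_curve M J \<gamma> \<longleftrightarrow>
     open J \<and> is_interval J \<and> \<gamma> ` J \<subseteq> pts M \<and> continuous_on J \<gamma> \<and>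
     (\<forall>c\<in>atlas M. smooth_on {t \<in> J. \<gamma> t \<in> fst c} (snd c \<circ> \<gamma>))"

definition velocity ::
  "('p, 'a::euclidean_space) riemannian \<Rightarrow> (real \<Rightarrow> 'p) \<Rightarrow> real \<Rightarrow> ('p, 'a) tvec" where
  "velocity M \<gamma> t =
     (\<lambda>c. if c \<in> charts_at (atlas M) (\<gamma> t) then vector_derivative (snd c \<circ> \<gamma>) (at t) else 0)"

definition geodesic_on ::
  "('p::topological_space, 'a::euclidean_space) riemannian \<Rightarrow> real set \<Rightarrow> (real \<Rightarrow> 'p) \<Rightarrow> bool" where
  "geodesic_on M J \<gamma> \<longleftrightarrow>
     smooth_curve M J \<gamma> \<and>
     (\<forall>t\<in>J. \<forall>c\<in>charts_at (atlas M) (\<gamma> t).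
        vector_derivative (\<lambda>\<tau>. velocity M \<gamma> \<tau> c) (at t)
        + christoffel M c (snd c (\<gamma> t)) (velocity M \<gamma> t c) (velocity M \<gamma> t c) = 0)"

section \<open>Submanifolds\<close>

text \<open>Embedded submanifolds of dimension \<open>k\<close>, by slice charts.\<close>

definition submanifold ::
  "('p, 'a::euclidean_space) riemannian \<Rightarrow> nat \<Rightarrow> 'p set \<Rightarrow> bool" where
  "submanifold M k S \<longleftrightarrow>
     S \<subseteq> pts M \<and>
     (\<forall>p\<in>S. \<exists>c\<in>charts_at (atlas M) p. \<exists>L. subspace L \<and> dim L = k \<and>
        snd c ` (fst c \<inter> S) = snd c ` fst c \<inter> L)"

text \<open>A submanifold \<open>S\<close> as a Riemannian manifold in its own right: the charts are those for
  which the inclusion is a smooth immersion, the metric is the induced one. It makes sense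
  if the dimension of \<open>S\<close> is \<open>DIM('b)\<close>.\<close>

definition induced_riemannian ::
  "('p::topological_space, 'a::euclidean_space) riemannian \<Rightarrow> 'p set \<Rightarrow> ('p, 'b::euclidean_space) riemannian" where
  "induced_riemannian M S =
     (let B = {c. is_chart S c \<and>
                (\<forall>d\<in>atlas M. smooth_on (overlap c d) (transition c d) \<and>
                  (\<forall>x\<in>overlap c d. inj (frechet_derivative (transition c d) (at x))))}
      in \<lparr>pts = S, atlas = B,
          metric = (\<lambda>p u v. metric M p (inclusion_differential B (atlas M) p u)
                                       (inclusion_differential B (atlas M) p v))\<rparr>)"

definition riemannian_submanifold ::
  "('p::topological_space, 'b::euclidean_space) riemannian \<Rightarrow> ('p, 'a::euclidean_space) riemannian \<Rightarrow> bool" where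
  "riemannian_submanifold P M \<longleftrightarrow>
     submanifold M DIM('b) (pts P) \<and> P = induced_riemannian M (pts P)"

text \<open>The initial vector of a geodesic of \<open>P\<close> starting at \<open>q\<close> is automatically
  tangent to \<open>P\<close>.\<close>

definition totally_geodesic_at ::
  "('p::topological_space, 'b::euclidean_space) riemannian \<Rightarrow> ('p, 'a::euclidean_space) riemannian \<Rightarrow> 'p \<Rightarrow> bool" where
  "totally_geodesic_at P M q \<longleftrightarrow>
     q \<in> pts P \<and>
     (\<forall>J \<gamma>. geodesic_on P J \<gamma> \<and> 0 \<in> J \<and> \<gamma> 0 = q \<longrightarrow>
        (\<exists>\<epsilon>>0. geodesic_on M (J \<inter> {-\<epsilon><..<\<epsilon>}) \<gamma>))"

text \<open>The tangent space of a subset \<open>S\<close> as a subspace of the ambient tangent space.\<close>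

definition tangent_of ::
  "('p::topological_space, 'a::euclidean_space) riemannian \<Rightarrow> 'p set \<Rightarrow> 'p \<Rightarrow> ('p, 'a) tvec set" where
  "tangent_of M S p =
     {v. \<exists>\<gamma> \<epsilon>. \<epsilon> > 0 \<and> smooth_curve M {-\<epsilon><..<\<epsilon>} \<gamma> \<and> \<gamma> ` {-\<epsilon><..<\<epsilon>} \<subseteq> S \<and>
               \<gamma> 0 = p \<and> v = velocity M \<gamma> 0}"

definition normal_of ::
  "('p::topological_space, 'a::euclidean_space) riemannian \<Rightarrow> 'p set \<Rightarrow> 'p \<Rightarrow> ('p, 'a) tvec set" where
  "normal_of M S p =
     {n \<in> tangent_space (atlas M) p. \<forall>t\<in>tangent_of M S p. metric M p n t = 0}"

definition normal_part ::
  "('p::topological_space, 'a::euclidean_space) riemannian \<Rightarrow> 'p set \<Rightarrow> 'p \<Rightarrow> ('p, 'a) tvec \<Rightarrow> ('p, 'a) tvec" where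
  "normal_part M S p z = (THE n. n \<in> normal_of M S p \<and> z - n \<in> tangent_of M S p)"

section \<open>Second fundamental form and mean curvature\<close>

text \<open>The normal part of the covariant derivative, in the direction \<open>u\<close>, of any local
  extension \<open>V\<close> of \<open>v\<close> that is tangent to \<open>S\<close> along \<open>S\<close>.\<close>

definition second_fundamental_form ::
  "('p::topological_space, 'a::euclidean_space) riemannian \<Rightarrow> 'p set \<Rightarrow> 'p \<Rightarrow>
   ('p, 'a) tvec \<Rightarrow> ('p, 'a) tvec \<Rightarrow> ('p, 'a) tvec" where
  "second_fundamental_form M S p u v =
     (THE z. \<exists>W V. openin (top_of_set (pts M)) W \<and> p \<in> W \<and> smooth_field M W V \<and>
        (\<forall>x\<in>W \<inter> S. V x \<in> tangent_of M S x) \<and> V p = v \<and>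
        z = normal_part M S p (covariant_derivative M V p u))"

definition orthonormal_basis ::
  "('v::real_vector \<Rightarrow> 'v \<Rightarrow> real) \<Rightarrow> 'v set \<Rightarrow> 'v set \<Rightarrow> bool" where
  "orthonormal_basis g T E \<longleftrightarrow>
     finite E \<and> (\<forall>e\<in>E. \<forall>f\<in>E. g e f = (if e = f then 1 else 0)) \<and> span E = T"

definition mean_curvature_vector ::
  "('p::topological_space, 'a::euclidean_space) riemannian \<Rightarrow> 'p set \<Rightarrow> 'p \<Rightarrow> ('p, 'a) tvec" where
  "mean_curvature_vector M S p =
     (THE h. \<exists>E. orthonormal_basis (metric M p) (tangent_of M S p) E \<and>
        h = (1 / real (card E)) *\<^sub>R (\<Sum>e\<in>E. second_fundamental_form M S p e e))"

text \<open>For a hypersurface \<open>S\<close> of \<open>M\<close> and a unit normal vector \<open>n\<close> at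
  \<open>p\<close>.\<close>

definition mean_curvature ::
  "('p::topological_space, 'a::euclidean_space) riemannian \<Rightarrow> 'p set \<Rightarrow> 'p \<Rightarrow> ('p, 'a) tvec \<Rightarrow> real" where
  "mean_curvature M S p n = (THE h. mean_curvature_vector M S p = h *\<^sub>R n)"

definition hypersurface_near ::
  "('p::topological_space, 'a::euclidean_space) riemannian \<Rightarrow> 'p set \<Rightarrow> 'p \<Rightarrow> bool" where
  "hypersurface_near M S q \<longleftrightarrow>
     (\<exists>W. openin (top_of_set (pts M)) W \<and> q \<in> S \<inter> W \<and> submanifold M (DIM('a) - 1) (S \<inter> W))"

text \<open>A vector of the ambient manifold \<open>M\<close> which is tangent to the submanifold \<open>P\<close>,
  as an element of the tangent space of \<open>P\<close>.\<close>

definition as_tangent ::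
  "('p::topological_space, 'b::euclidean_space) riemannian \<Rightarrow> ('p, 'a::euclidean_space) riemannian \<Rightarrow> 'p \<Rightarrow>
   ('p, 'a) tvec \<Rightarrow> ('p, 'b) tvec" where
  "as_tangent P M q v =
     (THE w. w \<in> tangent_space (atlas P) q \<and> inclusion_differential (atlas P) (atlas M) q w = v)"

end

theory Submission
  imports Defs
begin

text \<open>Write \<open>h(v, v)\<close> for the component along \<open>N\<close> of the second fundamental form of \<open>\<Sigma>\<close> at \<open>q\<close>. The key
  point is that \<open>S = M\<^sub>\<alpha> \<inter> \<Sigma>\<close> has the same normal component: the connection of \<open>M\<^sub>\<alpha>\<close> is the tangential
  part of the ambient one and \<open>N\<close> is tangent to \<open>M\<^sub>\<alpha>\<close>, so for \<open>v\<close> tangent to \<open>S\<close> the \<open>N\<close>-components of both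
  covariant derivatives agree. Hence the mean curvature of \<open>S\<close> is the mean of \<open>h(v, v)\<close> over \<open>v \<in> \<alpha>\<close>, and
  averaging over all \<open>\<alpha>\<close> gives the mean over the whole basis, since every basis vector lies in
  the same number of subsets.

  In coordinates, \<open>h(v, v)\<close> in a slice chart is the Koszul expression of the metric
  coefficients evaluated at \<open>(v, v; N)\<close>. Under a smooth map \<open>F\<close> this expression is invariant up to the term
  \<open>g(D\<^sup>2F(v, w), DF n)\<close>. For a change of charts this is the transformation law of the Christoffel maps;
  for the inclusion of \<open>M\<^sub>\<alpha>\<close> it yields the comparison above.\<close>

section \<open>Smooth functions between open sets\<close>

text \<open>The first obstacle is that \<open>normal_part\<close>,
  \<open>second_fundamental_form\<close> and \<open>mean_curvature_vector\<close> are definite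
  descriptions, so each value must be shown independent of the choices behind it. A slice chart
  handles the extension V: in a direction tangent to the hypersurface its coordinate derivative
  stays in the model subspace, so only the Christoffel term can have a normal component. A trace
  argument handles the orthonormal basis. The second obstacle is that the atlas of
  \<open>M\<^sub>\<alpha>\<close> consists of all charts with smooth immersive inclusion, so
  smoothness of its transitions needs a proof. That the intersection with \<Sigma> is a hypersurface
  near q is transversality: N is tangent to \<open>M\<^sub>\<alpha>\<close> but not to \<Sigma>. The
  term with D^2F drops out for the inclusion because F maps the slice of the intersection into the
  slice of \<Sigma>. The averages match because the share of subsets containing a given v is s / m,
  which turns the factor 1 / s of each mean into 1 / m.\<close>

lemma Ck_on_cong:
  assumes "open S" "Ck_on k S f" "\<And>x. x \<in> S \<Longrightarrow> f x = g x"
  shows "Ck_on k S g"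
  using assms(2,3)
proof (induction k arbitrary: f g)
  case 0
  then show ?case using continuous_on_cong[OF refl, of S f g] by (simp only: Ck_on.simps)
next
  case (Suc k)
  have fd: "(f has_derivative frechet_derivative f (at x)) (at x)" if "x \<in> S" for x
    using Suc.prems(1) that frechet_derivative_works by auto
  have gd: "(g has_derivative frechet_derivative f (at x)) (at x)" if "x \<in> S" for x
    by (rule has_derivative_transform_within_open[OF fd[OF that] assms(1) that Suc.prems(2)])
  have eq: "frechet_derivative f (at x) = frechet_derivative g (at x)" if "x \<in> S" for x
    by (rule frechet_derivative_at[OF gd[OF that]])
  have "Ck_on k S (\<lambda>x. frechet_derivative g (at x) v)" for v
    by (rule Suc.IH[of "\<lambda>x. frechet_derivative f (at x) v"]) (use Suc.prems(1) eq in auto)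
  with gd show ?case unfolding Ck_on.simps differentiable_def by blast
qed

lemma Ck_on_subset: "Ck_on k S f \<Longrightarrow> T \<subseteq> S \<Longrightarrow> Ck_on k T f"
  by (induction k arbitrary: f) (auto intro: continuous_on_subset)

lemma Ck_on_local:
  assumes "\<And>x. x \<in> S \<Longrightarrow> \<exists>U. open U \<and> x \<in> U \<and> Ck_on k U f"
  shows "Ck_on k S f"
  using assms
proof (induction k arbitrary: f)
  case 0
  have "isCont f x" if "x \<in> S" for x
    using 0[OF that] by (auto simp: continuous_on_eq_continuous_at)
  then show ?case by (simp add: continuous_at_imp_continuous_on)
next
  case (Suc k)
  have "f differentiable (at x)" if "x \<in> S" for x using Suc.prems[OF that] by auto
  moreover have "Ck_on k S (\<lambda>x. frechet_derivative f (at x) v)" for v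
    by (rule Suc.IH) (use Suc.prems in fastforce)
  ultimately show ?case by auto
qed

lemma Ck_on_SucD: "Ck_on (Suc k) S f \<Longrightarrow> Ck_on k S f"
proof (induction k arbitrary: f)
  case 0
  then show ?case
    by (auto intro!: continuous_at_imp_continuous_on differentiable_imp_continuous_within)
next
  case (Suc k)
  then show ?case by (metis Ck_on.simps(2))
qed

text \<open>Allows a derivative in closed form, on which the closure rules below run their
  inductions, in place of the opaque \<open>frechet_derivative\<close>.\<close>

lemma Ck_on_SucI:
  assumes "open S" "\<And>x. x \<in> S \<Longrightarrow> (f has_derivative f' x) (at x)" "\<And>v. Ck_on k S (\<lambda>x. f' x v)"
  shows "Ck_on (Suc k) S f"
proof -
  have "f' x = frechet_derivative f (at x)" if "x \<in> S" for x
    using assms(2)[OF that] by (rule frechet_derivative_at)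
  then have "Ck_on k S (\<lambda>x. frechet_derivative f (at x) v)" for v
    using Ck_on_cong[OF assms(1) assms(3)[of v]] by simp
  then show ?thesis using assms(2) by (auto simp: differentiable_def)
qed

lemma Ck_on_const: "Ck_on k S (\<lambda>x. c)"
  by (induction k arbitrary: c) auto

lemma Ck_on_bounded_linear:
  assumes "open S" "bounded_linear h" "Ck_on k S f"
  shows "Ck_on k S (\<lambda>x. h (f x))"
  using assms(3)
proof (induction k arbitrary: f)
  case 0
  then show ?case using assms(2) by (auto intro: bounded_linear.continuous_on)
next
  case (Suc k)
  show ?case
    by (rule Ck_on_SucI[OF assms(1), where f' = "\<lambda>x v. h (frechet_derivative f (at x) v)"])
      (use Suc in \<open>auto intro!: bounded_linear.has_derivative[OF assms(2)] simp: frechet_derivative_works[symmetric]\<close>)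
qed

lemma Ck_on_id: "open S \<Longrightarrow> Ck_on k S (\<lambda>x. x)"
  by (cases k) (auto intro!: Ck_on_SucI[where f' = "\<lambda>x v. v"] simp: Ck_on_const)

lemma Ck_on_add:
  assumes "open S" "Ck_on k S f" "Ck_on k S g"
  shows "Ck_on k S (\<lambda>x. f x + g x)"
  using assms(2,3)
proof (induction k arbitrary: f g)
  case 0
  then show ?case by (auto intro: continuous_intros)
next
  case (Suc k)
  show ?case
    by (rule Ck_on_SucI[OF assms(1), where f' = "\<lambda>x v. frechet_derivative f (at x) v + frechet_derivative g (at x) v"])
      (use Suc in \<open>auto intro!: has_derivative_add simp: frechet_derivative_works[symmetric]\<close>)
qed

lemma Ck_on_sum:
  assumes "open S" "\<And>i. i \<in> I \<Longrightarrow> Ck_on k S (f i)"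
  shows "Ck_on k S (\<lambda>x. \<Sum>i\<in>I. f i x)"
  using assms(2)
  by (induction I rule: infinite_finite_induct) (auto intro!: Ck_on_add Ck_on_const assms(1))

text \<open>The product rule leaves one factor undifferentiated in each summand, so the induction
  also needs the functions themselves one order lower, which \<open>Ck_on_SucD\<close>
  supplies.\<close>

lemma Ck_on_scaleR:
  fixes f :: "'a::real_normed_vector \<Rightarrow> real" and g :: "'a \<Rightarrow> 'b::real_normed_vector"
  assumes "open S" "Ck_on k S f" "Ck_on k S g"
  shows "Ck_on k S (\<lambda>x. f x *\<^sub>R g x)"
  using assms(2,3)
proof (induction k arbitrary: f g)
  case 0
  then show ?case by (auto intro: continuous_intros)
next
  case (Suc k)
  show ?case
  proof (rule Ck_on_SucI[OF assms(1), where f' = "\<lambda>x v. f x *\<^sub>R frechet_derivative g (at x) v + frechet_derivative f (at x) v *\<^sub>R g x"])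
    fix x assume "x \<in> S"
    then show "((\<lambda>x. f x *\<^sub>R g x) has_derivative (\<lambda>v. f x *\<^sub>R frechet_derivative g (at x) v + frechet_derivative f (at x) v *\<^sub>R g x)) (at x)"
      using Suc.prems by (auto intro!: has_derivative_scaleR simp: frechet_derivative_works[symmetric])
  next
    fix v
    show "Ck_on k S (\<lambda>x. f x *\<^sub>R frechet_derivative g (at x) v + frechet_derivative f (at x) v *\<^sub>R g x)"
      using Suc.prems Ck_on_SucD[OF Suc.prems(1)] Ck_on_SucD[OF Suc.prems(2)]
      by (intro Ck_on_add Suc.IH assms(1)) auto
  qed
qed

lemma linear_euclidean_expand:
  fixes h :: "'a::euclidean_space \<Rightarrow> 'b::real_vector"
  assumes "linear h"
  shows "h x = (\<Sum>b\<in>Basis. (x \<bullet> b) *\<^sub>R h b)"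
proof -
  have "h x = h (\<Sum>b\<in>Basis. (x \<bullet> b) *\<^sub>R b)" by (simp add: euclidean_representation)
  then show ?thesis by (simp add: linear_sum[OF assms] linear_cmul[OF assms])
qed

text \<open>Expanding the moving argument in a basis leaves only the values of A at fixed vectors.
  Families of linear maps can thus be treated pointwise, without a norm on the space of
  operators.\<close>

lemma Ck_on_linear_apply:
  fixes g :: "'a::real_normed_vector \<Rightarrow> 'b::euclidean_space"
  assumes "open S" "\<And>x. x \<in> S \<Longrightarrow> linear (A x)" "\<And>v. Ck_on k S (\<lambda>x. A x v)" "Ck_on k S g"
  shows "Ck_on k S (\<lambda>x. A x (g x))"
proof (rule Ck_on_cong[OF assms(1)])
  show "Ck_on k S (\<lambda>x. \<Sum>b\<in>Basis. (g x \<bullet> b) *\<^sub>R A x b)"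
    using assms(3,4)
    by (intro Ck_on_sum Ck_on_scaleR assms(1) Ck_on_bounded_linear[OF assms(1) bounded_linear_inner_left]) auto
qed (use linear_euclidean_expand assms(2) in metis)

text \<open>By the chain rule the derivative of the composite is a linear family applied to a moving
  vector, so \<open>Ck_on_linear_apply\<close> closes the induction.\<close>

lemma Ck_on_compose:
  fixes f :: "'a::real_normed_vector \<Rightarrow> 'b::euclidean_space"
  assumes "open S" "open T" "f ` S \<subseteq> T" "Ck_on k S f" "Ck_on k T g"
  shows "Ck_on k S (\<lambda>x. g (f x))"
  using assms(4,5)
proof (induction k arbitrary: g)
  case 0
  then show ?case using assms(3) by (auto intro: continuous_on_compose2)
next
  case (Suc k)
  show ?case
  proof (rule Ck_on_SucI[OF assms(1), where f' = "\<lambda>x v. frechet_derivative g (at (f x)) (frechet_derivative f (at x) v)"])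
    fix x assume "x \<in> S"
    then show "((\<lambda>x. g (f x)) has_derivative (\<lambda>v. frechet_derivative g (at (f x)) (frechet_derivative f (at x) v))) (at x)"
      using Suc.prems assms(3)
      by (intro has_derivative_compose[of f _ x UNIV g]) (auto simp: frechet_derivative_works[symmetric])
  next
    fix v
    show "Ck_on k S (\<lambda>x. frechet_derivative g (at (f x)) (frechet_derivative f (at x) v))"
    proof (rule Ck_on_linear_apply[OF assms(1)])
      show "linear (frechet_derivative g (at (f x)))" if "x \<in> S" for x
        using that assms(3) Suc.prems by (intro linear_frechet_derivative) auto
      show "Ck_on k S (\<lambda>x. frechet_derivative g (at (f x)) v)" for v
        using Suc.prems Ck_on_SucD by (intro Suc.IH) auto
    qed (use Suc.prems in auto)
  qed
qed

lemma smooth_on_cong: "open S \<Longrightarrow> smooth_on S f \<Longrightarrow> (\<And>x. x \<in> S \<Longrightarrow> f x = g x) \<Longrightarrow> smooth_on S g"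
  unfolding smooth_on_def by (rule allI, rule Ck_on_cong[of S _ f]) auto

lemma smooth_on_subset: "smooth_on S f \<Longrightarrow> T \<subseteq> S \<Longrightarrow> smooth_on T f"
  unfolding smooth_on_def by (rule allI, rule Ck_on_subset) auto

lemma smooth_on_local:
  assumes "\<And>x. x \<in> S \<Longrightarrow> \<exists>U. open U \<and> x \<in> U \<and> smooth_on U f"
  shows "smooth_on S f"
  unfolding smooth_on_def by (rule allI, rule Ck_on_local) (use assms[unfolded smooth_on_def] in meson)

lemma smooth_on_bounded_linear:
  "open S \<Longrightarrow> bounded_linear h \<Longrightarrow> smooth_on S f \<Longrightarrow> smooth_on S (\<lambda>x. h (f x))"
  unfolding smooth_on_def by (simp add: Ck_on_bounded_linear)

lemma smooth_on_const: "smooth_on S (\<lambda>x. c)"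
  unfolding smooth_on_def by (simp add: Ck_on_const)

lemma smooth_on_id: "open S \<Longrightarrow> smooth_on S (\<lambda>x. x)"
  unfolding smooth_on_def by (simp add: Ck_on_id)

lemma smooth_on_add:
  "open S \<Longrightarrow> smooth_on S f \<Longrightarrow> smooth_on S g \<Longrightarrow> smooth_on S (\<lambda>x. f x + g x)"
  unfolding smooth_on_def by (simp add: Ck_on_add)

lemma smooth_on_scaleR:
  "open S \<Longrightarrow> smooth_on S f \<Longrightarrow> smooth_on S g \<Longrightarrow> smooth_on S (\<lambda>x. f x *\<^sub>R g x)"
  unfolding smooth_on_def by (simp add: Ck_on_scaleR)

lemma smooth_on_linear_apply:
  fixes g :: "'a::real_normed_vector \<Rightarrow> 'b::euclidean_space"
  assumes "open S" "\<And>x. x \<in> S \<Longrightarrow> linear (A x)" "\<And>v. smooth_on S (\<lambda>x. A x v)" "smooth_on S g"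
  shows "smooth_on S (\<lambda>x. A x (g x))"
  unfolding smooth_on_def
  using Ck_on_linear_apply[of S A _ g] assms(1,2) assms(3,4)[unfolded smooth_on_def] by simp

lemma smooth_on_compose:
  fixes f :: "'a::real_normed_vector \<Rightarrow> 'b::euclidean_space"
  assumes "open S" "open T" "f ` S \<subseteq> T" "smooth_on S f" "smooth_on T g"
  shows "smooth_on S (\<lambda>x. g (f x))"
  unfolding smooth_on_def
  by (rule allI, rule Ck_on_compose[OF assms(1-3)]) (use assms(4,5) in \<open>auto simp: smooth_on_def\<close>)

lemma smooth_on_Suc: "smooth_on S f \<Longrightarrow> Ck_on (Suc k) S f"
  unfolding smooth_on_def by (rule spec)

lemma smooth_on_differentiable: "smooth_on S f \<Longrightarrow> x \<in> S \<Longrightarrow> f differentiable (at x)"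
  using smooth_on_Suc[of S f 0] by simp

lemma smooth_on_has_derivative:
  "smooth_on S f \<Longrightarrow> x \<in> S \<Longrightarrow> (f has_derivative frechet_derivative f (at x)) (at x)"
  by (simp add: smooth_on_differentiable flip: frechet_derivative_works)

lemma smooth_on_frechet_derivative:
  assumes "smooth_on S f"
  shows "smooth_on S (\<lambda>x. frechet_derivative f (at x) v)"
  unfolding smooth_on_def
proof
  fix k
  show "Ck_on k S (\<lambda>x. frechet_derivative f (at x) v)"
    using smooth_on_Suc[OF assms, of k] by simp
qed

lemma smooth_on_continuous: "smooth_on S f \<Longrightarrow> continuous_on S f"
  unfolding smooth_on_def by (drule spec[of _ 0]) simp

lemma smooth_on_linear_derivative:
  "smooth_on S f \<Longrightarrow> x \<in> S \<Longrightarrow> linear (frechet_derivative f (at x))"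
  by (intro linear_frechet_derivative smooth_on_differentiable)

section \<open>Families of linear maps, their inverses, and smoothness of inverse functions\<close>

lemma linear_derivative_of_linear_family:
  assumes S: "open S" "x \<in> S" and lin: "\<And>y. y \<in> S \<Longrightarrow> linear (A y)"
    and d: "\<And>v. ((\<lambda>y. A y v) has_derivative (\<lambda>u. A' u v)) (at x)"
  shows "linear (A' u)"
proof (rule linearI)
  fix v w r
  have "(\<lambda>u. A' u (v + w)) = (\<lambda>u. A' u v + A' u w)"
    by (rule has_derivative_unique[OF d], rule has_derivative_transform_within_open[OF has_derivative_add[OF d d] S])
      (simp add: linear_add[OF lin])
  from fun_cong[OF this, of u] show "A' u (v + w) = A' u v + A' u w" .
  have "(\<lambda>u. A' u (r *\<^sub>R v)) = (\<lambda>u. r *\<^sub>R A' u v)"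
    by (rule has_derivative_unique[OF d], rule has_derivative_transform_within_open[OF has_derivative_scaleR_right[OF d] S])
      (simp add: linear_cmul[OF lin])
  from fun_cong[OF this, of u] show "A' u (r *\<^sub>R v) = r *\<^sub>R A' u v" .
qed

text \<open>The map \<open>(x, v) \<mapsto> (x, A x v)\<close> is a bijection with invertible derivative, and
  \<open>inv (A x) w\<close> is read off its inverse.\<close>

lemma has_derivative_linear_family_inverse:
  fixes A :: "'a::euclidean_space \<Rightarrow> 'b::euclidean_space \<Rightarrow> 'b"
  assumes S: "open S" "x \<in> S" and lin: "\<And>x. x \<in> S \<Longrightarrow> linear (A x)" and bij: "\<And>x. x \<in> S \<Longrightarrow> bij (A x)"
    and d: "\<And>v x. x \<in> S \<Longrightarrow> ((\<lambda>x. A x v) has_derivative (\<lambda>u. A' x u v)) (at x)"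
  shows "((\<lambda>x. inv (A x) w) has_derivative (\<lambda>u. - inv (A x) (A' x u (inv (A x) w)))) (at x)"
proof -
  let ?f = "\<lambda>z::'a \<times> 'b. (fst z, A (fst z) (snd z))"
  let ?g = "\<lambda>z::'a \<times> 'b. (fst z, inv (A (fst z)) (snd z))"
  let ?u = "inv (A x) w"
  let ?f' = "\<lambda>z0 z::'a \<times> 'b. (fst z, (\<Sum>b\<in>Basis. (snd z0 \<bullet> b) *\<^sub>R A' (fst z0) (fst z) b + (snd z \<bullet> b) *\<^sub>R A (fst z0) b))"
  have linA': "linear (A' x u)" for u
    by (rule linear_derivative_of_linear_family[where A = A]) (fact S lin d[OF S(2)])+
  have fd: "(?f has_derivative ?f' z0) (at z0)" if "z0 \<in> S \<times> UNIV" for z0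
  proof -
    have "fst z0 \<in> S" using that by auto
    have *: "((\<lambda>z. A (fst z) b) has_derivative (\<lambda>z. A' (fst z0) (fst z) b)) (at z0)" for b
      using has_derivative_compose[OF has_derivative_fst[OF has_derivative_ident] d[OF \<open>fst z0 \<in> S\<close>]] by simp
    have "((\<lambda>z. (fst z, \<Sum>b\<in>Basis. (snd z \<bullet> b) *\<^sub>R A (fst z) b)) has_derivative
      (\<lambda>z. (fst z, \<Sum>b\<in>Basis. (snd z0 \<bullet> b) *\<^sub>R A' (fst z0) (fst z) b + (snd z \<bullet> b) *\<^sub>R A (fst z0) b))) (at z0)"
      by (intro * derivative_intros)
    then show ?thesis
    proof (rule has_derivative_transform_within_open)
      show "open (S \<times> (UNIV :: 'b set))" using S by (simp add: open_Times)
    qed (use that in \<open>auto simp: linear_euclidean_expand[OF lin, symmetric]\<close>)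
  qed
  have inv: "inv (A y) (A y v) = v" "A y (inv (A y) v) = v" if "y \<in> S" for y v
    using bij[OF that] by (auto simp: bij_is_inj bij_is_surj surj_f_inv_f)
  \<comment> \<open>Inverts the derivative of \<open>?f\<close> at \<open>(x, ?u)\<close>: the
    equation \<open>A' x du ?u + A x dv = dw\<close> is solved for dv.\<close>
  let ?g' = "\<lambda>z::'a \<times> 'b. (fst z, inv (A x) (snd z - A' x (fst z) ?u))"
  have "(?g has_derivative ?g') (at (?f (x, ?u)))"
  proof (rule has_derivative_inverse_strong[where S = "S \<times> UNIV" and f = ?f and x = "(x, ?u)" and f' = "?f' (x, ?u)"])
    show "open (S \<times> (UNIV :: 'b set))" using S by (simp add: open_Times)
    show "continuous_on (S \<times> UNIV) ?f"
      using fd by (meson has_derivative_continuous continuous_at_imp_continuous_on)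
    show "?f' (x, ?u) \<circ> ?g' = id"
      using S by (auto simp: fun_eq_iff sum.distrib linear_euclidean_expand[OF lin, symmetric]
        linear_euclidean_expand[OF linA', symmetric] inv)
  qed (use S inv fd in auto)
  then have "(?g has_derivative ?g') (at (x, w))" using inv S by simp
  from has_derivative_snd[OF this]
  have "((\<lambda>z. inv (A (fst z)) (snd z)) has_derivative (\<lambda>z. inv (A x) (snd z - A' x (fst z) ?u))) (at (x, w))"
    by simp
  from has_derivative_compose[OF has_derivative_Pair[OF has_derivative_ident has_derivative_const] this]
  have "((\<lambda>x. inv (A x) w) has_derivative (\<lambda>u. inv (A x) (0 - A' x u ?u))) (at x)" by simp
  moreover have "linear (inv (A x))"
    using lin[OF S(2)] bij[OF S(2)] by (metis bij_def inj_linear_imp_inv_linear)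
  ultimately show ?thesis by (simp add: linear_neg)
qed

text \<open>The derivative of the inverse is built from derivatives of A and the inverse itself, so
  k orders of smoothness of the inverse yield the next one.\<close>

lemma Ck_on_linear_family_inverse:
  fixes A :: "'a::euclidean_space \<Rightarrow> 'b::euclidean_space \<Rightarrow> 'b"
  assumes S: "open S" and lin: "\<And>x. x \<in> S \<Longrightarrow> linear (A x)" and bij: "\<And>x. x \<in> S \<Longrightarrow> bij (A x)"
    and sm: "\<And>v. smooth_on S (\<lambda>x. A x v)"
  shows "Ck_on k S (\<lambda>x. inv (A x) w)"
proof (induction k arbitrary: w)
  have d: "((\<lambda>x. A x v) has_derivative (\<lambda>u. frechet_derivative (\<lambda>x. A x v) (at x) u)) (at x)" if "x \<in> S" for v x
    using smooth_on_has_derivative[OF sm that] by simp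
  have D: "((\<lambda>x. inv (A x) w) has_derivative
      (\<lambda>u. - inv (A x) (frechet_derivative (\<lambda>y. A y (inv (A x) w)) (at x) u))) (at x)" if "x \<in> S" for x w
    by (rule has_derivative_linear_family_inverse[where A' = "\<lambda>x u v. frechet_derivative (\<lambda>y. A y v) (at x) u", OF S that])
      (fact lin bij d)+
  have linv: "linear (inv (A x))" if "x \<in> S" for x
    using lin[OF that] bij[OF that] by (metis bij_def inj_linear_imp_inv_linear)
  {
    case 0
    have "continuous (at x) (\<lambda>x. inv (A x) w)" if "x \<in> S" for x
      using D[OF that] by (rule has_derivative_continuous)
    then show ?case by (simp add: continuous_at_imp_continuous_on)
  next
    case (Suc k)
    show ?case
    proof (rule Ck_on_SucI[OF S D])
      fix u
      have "Ck_on k S (\<lambda>x. frechet_derivative (\<lambda>y. A y (inv (A x) w)) (at x) u)"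
      proof (rule Ck_on_linear_apply[OF S, where A = "\<lambda>x v. frechet_derivative (\<lambda>y. A y v) (at x) u"])
        show "linear (\<lambda>v. frechet_derivative (\<lambda>y. A y v) (at x) u)" if "x \<in> S" for x
          by (rule linear_derivative_of_linear_family[where A = A and A' = "\<lambda>u v. frechet_derivative (\<lambda>y. A y v) (at x) u"])
            (fact S that lin d[OF that])+
      qed (use Suc smooth_on_frechet_derivative[OF sm] in \<open>auto simp: smooth_on_def\<close>)
      then have "Ck_on k S (\<lambda>x. inv (A x) (frechet_derivative (\<lambda>y. A y (inv (A x) w)) (at x) u))"
        using Ck_on_linear_apply[OF S linv Suc] by blast
      from Ck_on_bounded_linear[OF S bounded_linear_minus[OF bounded_linear_ident] this]
      show "Ck_on k S (\<lambda>x. - inv (A x) (frechet_derivative (\<lambda>y. A y (inv (A x) w)) (at x) u))" .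
    qed auto
  }
qed

text \<open>Once g is known to be differentiable, its derivative at y is the inverse of the
  derivative of f at \<open>g y\<close>. The right side is as smooth as g, which gains one order per
  round. Equality of the dimensions turns injectivity of the derivative into bijectivity.\<close>

lemma smooth_on_inverse:
  fixes f :: "'a::euclidean_space \<Rightarrow> 'a"
  assumes S: "open S" and T: "open T" and f: "smooth_on S f"
    and g: "\<And>y. y \<in> T \<Longrightarrow> g y \<in> S" "\<And>y. y \<in> T \<Longrightarrow> f (g y) = y" "\<And>x. x \<in> S \<Longrightarrow> g (f x) = x"
    and inj: "\<And>x. x \<in> S \<Longrightarrow> inj (frechet_derivative f (at x))"
  shows "smooth_on T g"
  unfolding smooth_on_def
proof
  have lin: "linear (frechet_derivative f (at x))" if "x \<in> S" for x
    by (rule smooth_on_linear_derivative[OF f that])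
  have bij: "bij (frechet_derivative f (at x))" if "x \<in> S" for x
    using linear_injective_imp_surjective[OF lin[OF that] inj[OF that]] inj[OF that] by (simp add: bij_def)
  have D: "(g has_derivative inv (frechet_derivative f (at (g y)))) (at y)" if "y \<in> T" for y
  proof (rule has_derivative_inverse_strong_x[OF S g(1)[OF that] smooth_on_continuous[OF f] g(3)
        smooth_on_has_derivative[OF f g(1)[OF that]]])
    show "frechet_derivative f (at (g y)) \<circ> inv (frechet_derivative f (at (g y))) = id"
      using bij[OF g(1)[OF that]] by (auto simp: fun_eq_iff bij_is_surj surj_f_inv_f)
  qed (use g that in auto)
  fix k
  show "Ck_on k T g"
  proof (induction k)
    case 0
    then show ?case using D by (auto intro: continuous_at_imp_continuous_on has_derivative_continuous)
  next
    case (Suc k)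
    have "Ck_on k S (\<lambda>x. inv (frechet_derivative f (at x)) v)" for v
      by (rule Ck_on_linear_family_inverse[OF S lin bij smooth_on_frechet_derivative[OF f]])
    then have "Ck_on k T (\<lambda>y. inv (frechet_derivative f (at (g y))) v)" for v
      by (rule Ck_on_compose[OF T S _ Suc, rotated]) (use g in auto)
    then show ?case by (rule Ck_on_SucI[OF T D, rotated])
  qed
qed

section \<open>Symmetry of the second derivative\<close>

lemma second_difference_mean_value:
  fixes f :: "'a::euclidean_space \<Rightarrow> real"
  assumes f: "smooth_on S f" and h: "h > 0"
    and S: "\<And>s t. 0 \<le> s \<Longrightarrow> s \<le> h \<Longrightarrow> 0 \<le> t \<Longrightarrow> t \<le> h \<Longrightarrow> x + s *\<^sub>R u + t *\<^sub>R v \<in> S"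
  obtains s t where "0 < s" "s < h" "0 < t" "t < h"
    "f (x + h *\<^sub>R u + h *\<^sub>R v) - f (x + h *\<^sub>R u) - f (x + h *\<^sub>R v) + f x
      = h * h * frechet_derivative (\<lambda>y. frechet_derivative f (at y) u) (at (x + s *\<^sub>R u + t *\<^sub>R v)) v"
proof -
  let ?D = "\<lambda>y. frechet_derivative f (at y) u"
  have line: "((\<lambda>s. g (y + s *\<^sub>R w)) has_real_derivative frechet_derivative g (at (y + s *\<^sub>R w)) w) (at s)"
    if "smooth_on S g" "y + s *\<^sub>R w \<in> S" for g :: "'a \<Rightarrow> real" and y w s
  proof -
    note d = smooth_on_has_derivative[OF that]
    have "((\<lambda>s. g (y + s *\<^sub>R w)) has_derivative (\<lambda>r. frechet_derivative g (at (y + s *\<^sub>R w)) (r *\<^sub>R w))) (at s)"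
      by (rule has_derivative_compose[of "\<lambda>s. y + s *\<^sub>R w" _ _ _ g, OF _ d]) (auto intro!: derivative_eq_intros)
    moreover have "(\<lambda>r. frechet_derivative g (at (y + s *\<^sub>R w)) (r *\<^sub>R w)) = (*) (frechet_derivative g (at (y + s *\<^sub>R w)) w)"
      using linear_cmul[OF smooth_on_linear_derivative[OF that]] by (auto simp: fun_eq_iff)
    ultimately show ?thesis by (simp add: has_field_derivative_def)
  qed
  \<comment> \<open>The increment over [0, h] of the difference of f along two parallel lines in
    direction u is the second difference; a second mean value argument in direction v
    follows.\<close>
  have "\<exists>s>0. s < h \<and> (f (x + h *\<^sub>R v + h *\<^sub>R u) - f (x + h *\<^sub>R u)) - (f (x + h *\<^sub>R v + 0 *\<^sub>R u) - f (x + 0 *\<^sub>R u))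
      = (h - 0) * (?D (x + h *\<^sub>R v + s *\<^sub>R u) - ?D (x + s *\<^sub>R u))"
  proof (rule MVT2[OF h, where f = "\<lambda>s. f (x + h *\<^sub>R v + s *\<^sub>R u) - f (x + s *\<^sub>R u)"])
    fix s assume s: "0 \<le> s" "s \<le> h"
    have "x + h *\<^sub>R v + s *\<^sub>R u \<in> S" "x + s *\<^sub>R u \<in> S"
      using S[OF s, of h] S[OF s, of 0] h by (auto simp: algebra_simps)
    then show "((\<lambda>s. f (x + h *\<^sub>R v + s *\<^sub>R u) - f (x + s *\<^sub>R u)) has_real_derivative
        (?D (x + h *\<^sub>R v + s *\<^sub>R u) - ?D (x + s *\<^sub>R u))) (at s)"
      by (intro DERIV_diff line f)
  qed
  then obtain s where s: "0 < s" "s < h" and s_eq: "f (x + h *\<^sub>R v + h *\<^sub>R u) - f (x + h *\<^sub>R u) - f (x + h *\<^sub>R v) + f x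
      = h * (?D (x + h *\<^sub>R v + s *\<^sub>R u) - ?D (x + s *\<^sub>R u))" by auto
  have "\<exists>t>0. t < h \<and> ?D (x + s *\<^sub>R u + h *\<^sub>R v) - ?D (x + s *\<^sub>R u + 0 *\<^sub>R v)
      = (h - 0) * frechet_derivative ?D (at (x + s *\<^sub>R u + t *\<^sub>R v)) v"
    by (rule MVT2[OF h, where f = "\<lambda>t. ?D (x + s *\<^sub>R u + t *\<^sub>R v)"])
      (use s in \<open>auto intro!: line smooth_on_frechet_derivative f S\<close>)
  then obtain t where "0 < t" "t < h" and "?D (x + s *\<^sub>R u + h *\<^sub>R v) - ?D (x + s *\<^sub>R u)
      = h * frechet_derivative ?D (at (x + s *\<^sub>R u + t *\<^sub>R v)) v" by auto
  then show thesis using that[OF s] s_eq by (simp add: algebra_simps)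
qed

text \<open>The second difference does not change when u and v are exchanged. So the two mixed
  derivatives take a common value at two points arbitrarily close to x, and continuity carries this
  to x.\<close>

lemma second_derivative_symmetric_real:
  fixes f :: "'a::euclidean_space \<Rightarrow> real"
  assumes S: "open S" "x \<in> S" and f: "smooth_on S f"
  shows "frechet_derivative (\<lambda>y. frechet_derivative f (at y) u) (at x) v
       = frechet_derivative (\<lambda>y. frechet_derivative f (at y) v) (at x) u"
proof (rule ccontr)
  let ?H = "\<lambda>u v y. frechet_derivative (\<lambda>y. frechet_derivative f (at y) u) (at y) v"
  assume neq: "\<not> ?thesis"
  \<comment> \<open>Half the supposed gap: two numbers that are closer than e to the respective
    limits cannot coincide.\<close>
  define e where "e = \<bar>?H u v x - ?H v u x\<bar> / 2"
  have e: "e > 0" using neq by (simp add: e_def)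
  have "isCont (?H u v) x" for u v
    using smooth_on_continuous[OF smooth_on_frechet_derivative[OF smooth_on_frechet_derivative[OF f]]] S
    by (simp add: continuous_on_eq_continuous_at)
  then have "\<forall>\<^sub>F y in nhds x. dist (?H u v y) (?H u v x) < e" for u v
    using e by (metis continuous_at tendsto_at_iff_tendsto_nhds tendstoD)
  moreover have "\<forall>\<^sub>F y in nhds x. y \<in> S" using S eventually_nhds by blast
  ultimately have "\<forall>\<^sub>F y in nhds x. y \<in> S \<and> dist (?H u v y) (?H u v x) < e \<and> dist (?H v u y) (?H v u x) < e"
    by (intro eventually_conj)
  then obtain r where r: "r > 0" and near: "\<And>y. dist y x < r \<Longrightarrow> y \<in> S \<and> dist (?H u v y) (?H u v x) < e \<and> dist (?H v u y) (?H v u x) < e"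
    unfolding eventually_nhds_metric by blast
  \<comment> \<open>The summand 1 keeps K positive when u and v both vanish. With
    \<open>h * K = r / 2\<close> all points of both parallelograms stay within r of x.\<close>
  define K where "K = norm u + norm v + 1"
  define h where "h = r / (2 * K)"
  have K: "K > 0" by (simp add: K_def add_nonneg_pos)
  have "h * K = r / 2" using K by (simp add: h_def)
  moreover have "h > 0" using r K by (simp add: h_def)
  ultimately have h: "h > 0" "h * (norm u + norm v) < r"
    using r by (auto simp: K_def algebra_simps)
  have bound: "dist (x + s *\<^sub>R u + t *\<^sub>R v) x < r" "dist (x + s *\<^sub>R v + t *\<^sub>R u) x < r"
    if st: "0 \<le> s" "s \<le> h" "0 \<le> t" "t \<le> h" for s t
  proof -
    have "s * norm u + t * norm v < r" "s * norm v + t * norm u < r"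
      using h mult_right_mono[OF st(2), of "norm u"] mult_right_mono[OF st(4), of "norm v"]
        mult_right_mono[OF st(2), of "norm v"] mult_right_mono[OF st(4), of "norm u"]
      by (auto simp: algebra_simps)
    moreover have "norm (s *\<^sub>R u + t *\<^sub>R v) \<le> s * norm u + t * norm v"
      "norm (s *\<^sub>R v + t *\<^sub>R u) \<le> s * norm v + t * norm u"
      using norm_triangle_ineq[of "s *\<^sub>R u" "t *\<^sub>R v"] norm_triangle_ineq[of "s *\<^sub>R v" "t *\<^sub>R u"] st by auto
    ultimately show "dist (x + s *\<^sub>R u + t *\<^sub>R v) x < r" "dist (x + s *\<^sub>R v + t *\<^sub>R u) x < r"
      by (auto simp: dist_norm add.assoc)
  qed
  obtain s t where st: "0 < s" "s < h" "0 < t" "t < h"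
    "f (x + h *\<^sub>R u + h *\<^sub>R v) - f (x + h *\<^sub>R u) - f (x + h *\<^sub>R v) + f x = h * h * ?H u v (x + s *\<^sub>R u + t *\<^sub>R v)"
    using second_difference_mean_value[OF f h(1), of x u v] near bound by metis
  obtain s' t' where st': "0 < s'" "s' < h" "0 < t'" "t' < h"
    "f (x + h *\<^sub>R v + h *\<^sub>R u) - f (x + h *\<^sub>R v) - f (x + h *\<^sub>R u) + f x = h * h * ?H v u (x + s' *\<^sub>R v + t' *\<^sub>R u)"
    using second_difference_mean_value[OF f h(1), of x v u] near bound by metis
  have "h * h * ?H u v (x + s *\<^sub>R u + t *\<^sub>R v) = h * h * ?H v u (x + s' *\<^sub>R v + t' *\<^sub>R u)"
    using st(5) st'(5) by (simp add: algebra_simps)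
  then have "?H u v (x + s *\<^sub>R u + t *\<^sub>R v) = ?H v u (x + s' *\<^sub>R v + t' *\<^sub>R u)" using h by simp
  moreover have "dist (?H u v (x + s *\<^sub>R u + t *\<^sub>R v)) (?H u v x) < e"
    using near[OF bound(1)[of s t]] st by auto
  moreover have "dist (?H v u (x + s' *\<^sub>R v + t' *\<^sub>R u)) (?H v u x) < e"
    using near[OF bound(2)[of s' t']] st' by auto
  ultimately show False unfolding e_def dist_real_def by (auto simp: abs_if split: if_splits)
qed

lemma second_derivative_symmetric:
  fixes f :: "'a::euclidean_space \<Rightarrow> 'b::euclidean_space"
  assumes S: "open S" "x \<in> S" and f: "smooth_on S f"
  shows "frechet_derivative (\<lambda>y. frechet_derivative f (at y) u) (at x) v
       = frechet_derivative (\<lambda>y. frechet_derivative f (at y) v) (at x) u"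
proof (rule euclidean_eqI)
  fix b :: 'b
  let ?F = "\<lambda>y. f y \<bullet> b"
  have F: "smooth_on S ?F" by (rule smooth_on_bounded_linear[OF S(1) bounded_linear_inner_left f])
  have inner: "frechet_derivative (\<lambda>y. g y \<bullet> b) (at y) w = frechet_derivative g (at y) w \<bullet> b"
    if "smooth_on S g" "y \<in> S" for g :: "'a \<Rightarrow> 'b" and y w
    using frechet_derivative_at[OF has_derivative_inner_left[OF smooth_on_has_derivative[OF that]], of b] by metis
  have "frechet_derivative (\<lambda>y. frechet_derivative ?F (at y) u) (at x) v = frechet_derivative (\<lambda>y. frechet_derivative f (at y) u) (at x) v \<bullet> b" for u v
  proof -
    have "frechet_derivative (\<lambda>y. frechet_derivative ?F (at y) u) (at x) v = frechet_derivative (\<lambda>y. frechet_derivative f (at y) u \<bullet> b) (at x) v"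
      by (rule fun_cong[OF frechet_derivative_transform_within_open[OF _ S]])
        (use S F in \<open>auto intro: smooth_on_differentiable smooth_on_frechet_derivative simp: inner f\<close>)
    then show ?thesis using inner[OF smooth_on_frechet_derivative[OF f] S(2)] by simp
  qed
  then show "frechet_derivative (\<lambda>y. frechet_derivative f (at y) u) (at x) v \<bullet> b
       = frechet_derivative (\<lambda>y. frechet_derivative f (at y) v) (at x) u \<bullet> b"
    using second_derivative_symmetric_real[OF S F] by metis
qed

lemma has_derivative_linear_apply:
  fixes g :: "'a::real_normed_vector \<Rightarrow> 'b::euclidean_space"
  assumes S: "open S" "x \<in> S" and lin: "\<And>y. y \<in> S \<Longrightarrow> linear (A y)"
    and d: "\<And>v. ((\<lambda>y. A y v) has_derivative (\<lambda>u. A' u v)) (at x)" and g: "(g has_derivative g') (at x)"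
  shows "((\<lambda>y. A y (g y)) has_derivative (\<lambda>u. A' u (g x) + A x (g' u))) (at x)"
proof -
  have linA': "linear (A' u)" for u
    by (rule linear_derivative_of_linear_family[where A = A]) (fact S lin d)+
  have "((\<lambda>y. \<Sum>b\<in>Basis. (g y \<bullet> b) *\<^sub>R A y b) has_derivative
      (\<lambda>u. \<Sum>b\<in>Basis. (g x \<bullet> b) *\<^sub>R A' u b + (g' u \<bullet> b) *\<^sub>R A x b)) (at x)"
    by (intro derivative_intros d g)
  moreover have "(\<lambda>u. \<Sum>b\<in>Basis. (g x \<bullet> b) *\<^sub>R A' u b + (g' u \<bullet> b) *\<^sub>R A x b) = (\<lambda>u. A' u (g x) + A x (g' u))"
    by (simp add: sum.distrib linear_euclidean_expand[OF linA', symmetric] linear_euclidean_expand[OF lin[OF S(2)], symmetric])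
  ultimately show ?thesis
    using has_derivative_transform_within_open[OF _ S, of "\<lambda>y. \<Sum>b\<in>Basis. (g y \<bullet> b) *\<^sub>R A y b"]
      linear_euclidean_expand[OF lin, symmetric] by simp
qed

section \<open>The Koszul formula under pullback\<close>

text \<open>The Christoffel symbol with lowered index: g(nabla_a b, w) for constant coordinate
  fields. As a form in w it can be pulled back along maps between spaces of different dimensions,
  where the vector \<open>christoffel\<close> would first have to be projected.\<close>

definition koszul :: "('a::real_normed_vector \<Rightarrow> 'a \<Rightarrow> 'a \<Rightarrow> real) \<Rightarrow> 'a \<Rightarrow> 'a \<Rightarrow> 'a \<Rightarrow> 'a \<Rightarrow> real" where
  "koszul G x a b w =
     (frechet_derivative (\<lambda>y. G y b w) (at x) a + frechet_derivative (\<lambda>y. G y a w) (at x) b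
      - frechet_derivative (\<lambda>y. G y a b) (at x) w) / 2"

lemma koszul_linear:
  assumes S: "open S" "x \<in> S"
    and lin: "\<And>y a. y \<in> S \<Longrightarrow> linear (G y a)" "\<And>y b. y \<in> S \<Longrightarrow> linear (\<lambda>a. G y a b)"
    and G: "\<And>a b. smooth_on S (\<lambda>y. G y a b)"
  shows "linear (koszul G x a b)" "linear (\<lambda>b. koszul G x a b w)" "linear (\<lambda>a. koszul G x a b w)"
proof -
  note d = smooth_on_has_derivative[OF G S(2)]
  have 1: "linear (\<lambda>b. frechet_derivative (\<lambda>y. G y a b) (at x) u)" for a u
    by (rule linear_derivative_of_linear_family[OF S, where A = "\<lambda>y b. G y a b" and A' = "\<lambda>u b. frechet_derivative (\<lambda>y. G y a b) (at x) u"])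
      (fact lin d)+
  have 2: "linear (\<lambda>a. frechet_derivative (\<lambda>y. G y a b) (at x) u)" for b u
    by (rule linear_derivative_of_linear_family[OF S, where A = "\<lambda>y a. G y a b" and A' = "\<lambda>u a. frechet_derivative (\<lambda>y. G y a b) (at x) u"])
      (fact lin d)+
  have 3: "linear (frechet_derivative (\<lambda>y. G y a b) (at x))" for a b
    by (rule smooth_on_linear_derivative[OF G S(2)])
  note adds = linear_add[OF 1] linear_add[OF 2] linear_add[OF 3] linear_cmul[OF 1] linear_cmul[OF 2] linear_cmul[OF 3]
  show "linear (koszul G x a b)" "linear (\<lambda>b. koszul G x a b w)" "linear (\<lambda>a. koszul G x a b w)"
    unfolding koszul_def by (rule linearI; simp add: adds; simp add: field_simps)+
qed

text \<open>The product rule for a metric along F evaluated on two moving vectors. The case of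
  interest has the images of constant vectors under the derivative of F as P and Q.\<close>

lemma has_derivative_bilinear_compose:
  fixes G :: "'a::euclidean_space \<Rightarrow> 'a \<Rightarrow> 'a \<Rightarrow> real" and F :: "'b::real_normed_vector \<Rightarrow> 'a"
  assumes S: "open S" "x \<in> S" and F: "F ` S \<subseteq> T" "(F has_derivative F') (at x)"
    and lin: "\<And>y a. y \<in> T \<Longrightarrow> linear (G y a)" "\<And>y b. y \<in> T \<Longrightarrow> linear (\<lambda>a. G y a b)"
    and G: "\<And>a b. smooth_on T (\<lambda>y. G y a b)"
    and P: "(P has_derivative P') (at x)" and Q: "(Q has_derivative Q') (at x)"
  shows "((\<lambda>y. G (F y) (P y) (Q y)) has_derivative
      (\<lambda>u. frechet_derivative (\<lambda>z. G z (P x) (Q x)) (at (F x)) (F' u) + G (F x) (P' u) (Q x) + G (F x) (P x) (Q' u))) (at x)"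
proof -
  have d: "((\<lambda>y. G (F y) a b) has_derivative (\<lambda>u. frechet_derivative (\<lambda>z. G z a b) (at (F x)) (F' u))) (at x)" for a b
    by (rule has_derivative_compose[of F _ _ _ "\<lambda>z. G z a b", OF F(2) smooth_on_has_derivative[OF G]]) (use S F in auto)
  have d1: "((\<lambda>y. G (F y) (P y) b) has_derivative
      (\<lambda>u. frechet_derivative (\<lambda>z. G z (P x) b) (at (F x)) (F' u) + G (F x) (P' u) b)) (at x)" for b
    by (rule has_derivative_linear_apply[OF S, where A = "\<lambda>y a. G (F y) a b"
          and A' = "\<lambda>u a. frechet_derivative (\<lambda>z. G z a b) (at (F x)) (F' u)"])
      (use F lin d P in auto)
  show ?thesis
    by (rule has_derivative_linear_apply[OF S, where A = "\<lambda>y. G (F y) (P y)"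
          and A' = "\<lambda>u b. frechet_derivative (\<lambda>z. G z (P x) b) (at (F x)) (F' u) + G (F x) (P' u) b"])
      (use F lin d1 Q in auto)
qed

text \<open>Differentiating the pulled back metric produces six terms with second derivatives of F.
  By symmetry of G and of the second derivative four of them cancel and the other two are equal, so
  the factor 1/2 leaves one. F may change the dimension, which makes the lemma fit both chart
  changes and inclusions.\<close>

lemma koszul_pullback:
  fixes G :: "'a::euclidean_space \<Rightarrow> 'a \<Rightarrow> 'a \<Rightarrow> real" and F :: "'b::euclidean_space \<Rightarrow> 'a"
  assumes S: "open S" "x \<in> S" and F: "F ` S \<subseteq> T" "smooth_on S F"
    and lin: "\<And>y a. y \<in> T \<Longrightarrow> linear (G y a)" "\<And>y b. y \<in> T \<Longrightarrow> linear (\<lambda>a. G y a b)"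
    and sym: "\<And>y a b. y \<in> T \<Longrightarrow> G y a b = G y b a"
    and G: "\<And>a b. smooth_on T (\<lambda>y. G y a b)"
    and pull: "\<And>y a b. y \<in> S \<Longrightarrow> G' y a b = G (F y) (frechet_derivative F (at y) a) (frechet_derivative F (at y) b)"
  shows "koszul G' x a b w =
      koszul G (F x) (frechet_derivative F (at x) a) (frechet_derivative F (at x) b) (frechet_derivative F (at x) w)
      + G (F x) (frechet_derivative (\<lambda>y. frechet_derivative F (at y) b) (at x) a) (frechet_derivative F (at x) w)"
proof -
  let ?J = "frechet_derivative F (at x)"
  let ?H = "\<lambda>b. frechet_derivative (\<lambda>y. frechet_derivative F (at y) b) (at x)"
  have D: "frechet_derivative (\<lambda>y. G' y a b) (at x) u =
      frechet_derivative (\<lambda>z. G z (?J a) (?J b)) (at (F x)) (?J u) + G (F x) (?H a u) (?J b) + G (F x) (?J a) (?H b u)" for a b u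
  proof -
    have "((\<lambda>y. G (F y) (frechet_derivative F (at y) a) (frechet_derivative F (at y) b)) has_derivative
      (\<lambda>u. frechet_derivative (\<lambda>z. G z (?J a) (?J b)) (at (F x)) (?J u) + G (F x) (?H a u) (?J b) + G (F x) (?J a) (?H b u))) (at x)"
      by (rule has_derivative_bilinear_compose[OF S F(1) smooth_on_has_derivative[OF F(2) S(2)] lin G])
        (auto intro: smooth_on_has_derivative[OF smooth_on_frechet_derivative[OF F(2)] S(2)])
    then have "((\<lambda>y. G' y a b) has_derivative
      (\<lambda>u. frechet_derivative (\<lambda>z. G z (?J a) (?J b)) (at (F x)) (?J u) + G (F x) (?H a u) (?J b) + G (F x) (?J a) (?H b u))) (at x)"
      by (rule has_derivative_transform_within_open[OF _ S]) (simp add: pull)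
    from fun_cong[OF frechet_derivative_at[OF this], of u] show ?thesis by simp
  qed
  have T: "F x \<in> T" using S F by auto
  note H = second_derivative_symmetric[OF S F(2)]
  show ?thesis
    unfolding koszul_def D
    using H[of a b] H[of a w] H[of b w] sym[OF T, of "?J a" "?H b w"] sym[OF T, of "?J a" "?H w b"] sym[OF T, of "?J b" "?H w a"]
    by (simp add: field_simps)
qed

text \<open>The map from z to the coefficients of \<open>G z\<close> is injective by positivity,
  hence surjective for reasons of dimension. This is what gives meaning to the description in
  \<open>christoffel\<close>.\<close>

lemma inner_product_riesz:
  fixes G :: "'a::euclidean_space \<Rightarrow> 'a \<Rightarrow> real"
  assumes lin: "\<And>a. linear (G a)" "\<And>b. linear (\<lambda>a. G a b)" and pos: "\<And>a. a \<noteq> 0 \<Longrightarrow> G a a > 0" and l: "linear l"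
  shows "\<exists>!z. \<forall>w. G z w = l w"
proof (rule ex_ex1I)
  let ?T = "\<lambda>z. \<Sum>b\<in>Basis. G z b *\<^sub>R b"
  have T: "linear ?T"
    by (rule linearI) (simp_all add: linear_add[OF lin(2)] linear_cmul[OF lin(2)] scaleR_add_left sum.distrib scaleR_sum_right)
  have "z = 0" if "?T z = 0" for z
  proof -
    have "G z b = 0" if "b \<in> Basis" for b
      using arg_cong[OF \<open>?T z = 0\<close>, of "\<lambda>v. v \<bullet> b"] that by simp
    then have "G z z = 0" using linear_euclidean_expand[OF lin(1), of z z] by simp
    then show ?thesis using pos[of z] by auto
  qed
  then have "inj ?T" using T linear_injective_0 by blast
  then have "surj ?T" using linear_injective_imp_surjective T by blast
  from surjD[OF this, of "\<Sum>b\<in>Basis. l b *\<^sub>R b"]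
  obtain z where z: "(\<Sum>b\<in>Basis. l b *\<^sub>R b) = ?T z" by blast
  have "G z b = l b" if "b \<in> Basis" for b
    using arg_cong[OF z, of "\<lambda>v. v \<bullet> b"] that by simp
  then have "G z w = l w" for w
    using linear_euclidean_expand[OF lin(1), of z w] linear_euclidean_expand[OF l, of w] by simp
  then show "\<exists>z. \<forall>w. G z w = l w" by auto
next
  fix z z' assume "\<forall>w. G z w = l w" "\<forall>w. G z' w = l w"
  then have "G (z - z') (z - z') = 0" by (simp add: linear_diff[OF lin(2)])
  then show "z = z'" using pos[of "z - z'"] by auto
qed

section \<open>Charts and tangent vectors\<close>

lemma is_chart_inv: "is_chart X c \<Longrightarrow> p \<in> fst c \<Longrightarrow> chart_inv c (snd c p) = p"
  by (auto simp: is_chart_def homeomorphism_def)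

lemma is_chart_inv_mem: "is_chart X c \<Longrightarrow> x \<in> snd c ` fst c \<Longrightarrow> chart_inv c x \<in> fst c"
  by (auto simp: is_chart_inv)

lemma is_chart_inv_right: "x \<in> snd c ` fst c \<Longrightarrow> snd c (chart_inv c x) = x"
  by (simp add: chart_inv_def f_inv_into_f)

lemma is_chart_subset: "is_chart X c \<Longrightarrow> fst c \<subseteq> X"
  by (auto simp: is_chart_def dest: openin_imp_subset)

text \<open>U is open only in the larger space Y, because charts of a submanifold X are to be
  intersected with domains of ambient charts.\<close>

lemma open_chart_image:
  assumes c: "is_chart X c" and U: "openin (top_of_set Y) U" and "X \<subseteq> Y"
  shows "open (snd c ` (fst c \<inter> U))"
proof -
  have "openin (top_of_set (fst c)) (fst c \<inter> U)"
    using U is_chart_subset[OF c] \<open>X \<subseteq> Y\<close> by (auto simp: openin_open)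
  then have "openin (top_of_set (snd c ` fst c)) (snd c ` (fst c \<inter> U))"
    using c homeomorphism_imp_open_map unfolding is_chart_def by blast
  then show ?thesis using c openin_open_eq unfolding is_chart_def by blast
qed

lemma open_overlap: "is_chart X c \<Longrightarrow> is_chart Y d \<Longrightarrow> X \<subseteq> Y \<Longrightarrow> open (overlap c d)"
  unfolding overlap_def by (rule open_chart_image) (auto simp: is_chart_def)

lemma transition_apply: "is_chart X c \<Longrightarrow> p \<in> fst c \<Longrightarrow> transition c d (snd c p) = snd d p"
  by (simp add: transition_def is_chart_inv)

lemma transition_compose:
  "is_chart X c \<Longrightarrow> is_chart Y d \<Longrightarrow> x \<in> overlap c d \<Longrightarrow> transition d e (transition c d x) = transition c e x"
  by (auto simp: overlap_def transition_def is_chart_inv)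

text \<open>The two model spaces may differ: for a chart of a submanifold and an ambient chart this
  is the Jacobian matrix of the inclusion.\<close>

definition jac :: "('p, 'a::euclidean_space) chart \<Rightarrow> ('p, 'b::euclidean_space) chart \<Rightarrow> 'p \<Rightarrow> 'a \<Rightarrow> 'b" where
  "jac c d p = frechet_derivative (transition c d) (at (snd c p))"

lemma has_derivative_transition_compose:
  assumes "is_chart X c" "is_chart Y d" "X \<subseteq> Y" "p \<in> fst c" "p \<in> fst d"
    and "(transition c d has_derivative f) (at (snd c p))" "(transition d e has_derivative g) (at (snd d p))"
  shows "(transition c e has_derivative g \<circ> f) (at (snd c p))"
proof (rule has_derivative_transform_within_open)
  show "open (overlap c d)" "snd c p \<in> overlap c d"
    using assms open_overlap[OF assms(1-3)] by (auto simp: overlap_def)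
  show "(transition d e \<circ> transition c d has_derivative g \<circ> f) (at (snd c p))"
    using assms by (intro diff_chain_at) (simp_all add: transition_apply)
qed (use assms in \<open>auto simp: transition_compose\<close>)

lemma jac_self:
  assumes "is_chart X c" "p \<in> fst c"
  shows "jac c c p = id"
  unfolding jac_def
proof (rule frechet_derivative_at[symmetric], rule has_derivative_transform_within_open[OF has_derivative_id])
  show "open (snd c ` fst c)" "snd c p \<in> snd c ` fst c" using assms by (auto simp: is_chart_def)
qed (use assms in \<open>auto simp: transition_apply\<close>)

text \<open>Chart maps of subsets \<open>X\<close> whose inverses are smooth as maps into \<open>M\<close>: these cover both the
  charts of \<open>M\<close> itself and those of a submanifold.\<close>

definition smooth_param ::
  "('p::topological_space, 'a::euclidean_space) riemannian \<Rightarrow> 'p set \<Rightarrow> ('p, 'b::euclidean_space) chart \<Rightarrow> bool" where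
  "smooth_param M X c \<longleftrightarrow> is_chart X c \<and> X \<subseteq> pts M \<and> (\<forall>d\<in>atlas M. smooth_on (overlap c d) (transition c d))"

lemma inner_product_on_linear:
  assumes "inner_product_on T g" "subspace T"
  shows "u \<in> T \<Longrightarrow> v \<in> T \<Longrightarrow> g u v = g v u"
    "u \<in> T \<Longrightarrow> v \<in> T \<Longrightarrow> w \<in> T \<Longrightarrow> g (u + v) w = g u w + g v w"
    "u \<in> T \<Longrightarrow> v \<in> T \<Longrightarrow> w \<in> T \<Longrightarrow> g w (u + v) = g w u + g w v"
    "u \<in> T \<Longrightarrow> w \<in> T \<Longrightarrow> g (r *\<^sub>R u) w = r * g u w"
    "u \<in> T \<Longrightarrow> w \<in> T \<Longrightarrow> g w (r *\<^sub>R u) = r * g w u"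
    "w \<in> T \<Longrightarrow> g 0 w = 0" "w \<in> T \<Longrightarrow> g w 0 = 0"
    "u \<in> T \<Longrightarrow> v \<in> T \<Longrightarrow> w \<in> T \<Longrightarrow> g (u - v) w = g u w - g v w"
    "u \<in> T \<Longrightarrow> u \<noteq> 0 \<Longrightarrow> g u u > 0"
proof -
  note T = subspace_0[OF assms(2)] subspace_add[OF assms(2)] subspace_scale[OF assms(2)]
  have lin: "g (a *\<^sub>R u + b *\<^sub>R v) w = a * g u w + b * g v w" if "u \<in> T" "v \<in> T" "w \<in> T" for u v w a b
    using assms(1)[unfolded inner_product_on_def, THEN conjunct2, THEN conjunct1, rule_format, OF that] .
  show sym: "g u v = g v u" if "u \<in> T" "v \<in> T" for u v
    using assms(1)[unfolded inner_product_on_def, THEN conjunct1, rule_format, OF that] .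
  show add: "g (u + v) w = g u w + g v w" if "u \<in> T" "v \<in> T" "w \<in> T" for u v w
    using lin[OF that, of 1 1] by simp
  show scale: "g (r *\<^sub>R u) w = r * g u w" if "u \<in> T" "w \<in> T" for u w r
    using lin[of u u w r 0] that by simp
  show "g (u - v) w = g u w - g v w" if "u \<in> T" "v \<in> T" "w \<in> T" for u v w
    using lin[OF that, of 1 "-1"] by simp
  show "g w (u + v) = g w u + g w v" if "u \<in> T" "v \<in> T" "w \<in> T" for u v w
    using sym[of w] add that T by simp
  show "g w (r *\<^sub>R u) = r * g w u" if "u \<in> T" "w \<in> T" for u w r
    using sym[of w] scale that T by simp
  show z: "g 0 w = 0" if "w \<in> T" for w using scale[of 0 w 0] that T by simp
  show "g w 0 = 0" if "w \<in> T" for w using z[OF that] sym[of w 0] that T by simp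
  show "g u u > 0" if "u \<in> T" "u \<noteq> 0" for u
    using assms(1)[unfolded inner_product_on_def, THEN conjunct2, THEN conjunct2, rule_format, OF that] .
qed

text \<open>The properties of a Riemannian manifold in a form that the induced structure of a
  submanifold is later shown to have as well, so that every result proved here holds for M and for
  P.\<close>

locale riemannian_atlas =
  fixes M :: "('p::topological_space, 'a::euclidean_space) riemannian"
  assumes chart: "c \<in> atlas M \<Longrightarrow> is_chart (pts M) c"
    and cover: "(\<Union>c\<in>atlas M. fst c) = pts M"
    and smooth_transition: "c \<in> atlas M \<Longrightarrow> d \<in> atlas M \<Longrightarrow> smooth_on (overlap c d) (transition c d)"
    and inner_product: "p \<in> pts M \<Longrightarrow> inner_product_on (tangent_space (atlas M) p) (metric M p)"
    and smooth_metric: "c \<in> atlas M \<Longrightarrow> smooth_on (snd c ` fst c) (\<lambda>x. metric_coords M c x a b)"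
begin

abbreviation "A \<equiv> atlas M"
abbreviation "T p \<equiv> tangent_space (atlas M) p"

lemma smooth_param_atlas: "c \<in> A \<Longrightarrow> smooth_param M (pts M) c"
  by (simp add: smooth_param_def chart smooth_transition)

lemma charts_atD:
  assumes "c \<in> charts_at A p"
  shows "c \<in> A" "p \<in> fst c" "is_chart (pts M) c" "p \<in> pts M" "smooth_param M (pts M) c"
proof -
  show c: "c \<in> A" "p \<in> fst c" using assms by (simp_all add: charts_at_def)
  show "is_chart (pts M) c" by (rule chart[OF c(1)])
  then show "p \<in> pts M" using is_chart_subset c by blast
  show "smooth_param M (pts M) c" by (rule smooth_param_atlas[OF c(1)])
qed

lemma charts_at_nonempty: "p \<in> pts M \<Longrightarrow> \<exists>c. c \<in> charts_at A p"
  using cover unfolding charts_at_def by blast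

lemma open_param_overlap: "smooth_param M X c \<Longrightarrow> d \<in> A \<Longrightarrow> open (overlap c d)"
  unfolding smooth_param_def using open_overlap chart by blast

lemma transition_has_derivative:
  assumes "smooth_param M X c" "p \<in> fst c" "d \<in> charts_at A p"
  shows "(transition c d has_derivative jac c d p) (at (snd c p))"
  unfolding jac_def using assms
  by (intro smooth_on_has_derivative[of "overlap c d"]) (auto simp: smooth_param_def charts_at_def overlap_def)

lemma linear_jac: "smooth_param M X c \<Longrightarrow> p \<in> fst c \<Longrightarrow> d \<in> charts_at A p \<Longrightarrow> linear (jac c d p)"
  using transition_has_derivative has_derivative_linear by blast

lemma jac_compose:
  assumes "smooth_param M X c" "p \<in> fst c" "d \<in> charts_at A p" "e \<in> charts_at A p"
  shows "jac c e p a = jac d e p (jac c d p a)"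
proof -
  have "(transition c e has_derivative jac d e p \<circ> jac c d p) (at (snd c p))"
    using assms(1) unfolding smooth_param_def
    by (intro has_derivative_transition_compose[of X c "pts M" d] transition_has_derivative[of X c] transition_has_derivative[of "pts M" d]
        assms charts_atD(2,3,5)[OF assms(3)]) auto
  from frechet_derivative_at[OF this] show ?thesis by (simp add: jac_def[of c e] fun_eq_iff)
qed

lemma vec_of_apply: "vec_of A c p a d = (if d \<in> charts_at A p then jac c d p a else 0)"
  by (simp add: vec_of_def jac_def)

lemma tangent_space_iff:
  "v \<in> T p \<longleftrightarrow> (\<forall>c\<in>charts_at A p. \<forall>d\<in>charts_at A p. v d = jac c d p (v c)) \<and> (\<forall>c. c \<notin> charts_at A p \<longrightarrow> v c = 0)"
  by (simp add: tangent_space_def jac_def)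

lemma vec_of_tangent:
  assumes "smooth_param M X c" "p \<in> fst c"
  shows "vec_of A c p a \<in> T p"
  unfolding tangent_space_iff
proof (intro conjI ballI allI impI)
  fix d e assume "d \<in> charts_at A p" "e \<in> charts_at A p"
  then show "vec_of A c p a e = jac d e p (vec_of A c p a d)"
    using jac_compose[OF assms, of d e a] by (simp only: vec_of_apply if_True)
qed (simp add: vec_of_apply)

lemma vec_of_change:
  assumes "smooth_param M X c" "p \<in> fst c" "d \<in> charts_at A p"
  shows "vec_of A c p a = vec_of A d p (jac c d p a)"
proof
  fix e
  show "vec_of A c p a e = vec_of A d p (jac c d p a) e"
    using jac_compose[OF assms, of e a] by (cases "e \<in> charts_at A p") (simp_all only: vec_of_apply if_True if_False)
qed

lemma tangent_space_apply:
  assumes "v \<in> T p" "c \<in> charts_at A p" "d \<in> charts_at A p"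
  shows "v d = jac c d p (v c)"
proof -
  have "\<forall>c\<in>charts_at A p. \<forall>d\<in>charts_at A p. v d = jac c d p (v c)"
    using assms(1) by (rule tangent_space_iff[THEN iffD1, THEN conjunct1])
  then show ?thesis using assms(2,3) by blast
qed

lemma vec_of_tangent_eq:
  assumes "v \<in> T p" "c \<in> charts_at A p"
  shows "vec_of A c p (v c) = v"
proof
  fix e
  show "vec_of A c p (v c) e = v e"
  proof (cases "e \<in> charts_at A p")
    case True
    then show ?thesis using tangent_space_apply[OF assms True] by (simp only: vec_of_apply if_True)
  next
    case False
    then have "v e = 0" using assms(1) unfolding tangent_space_iff by blast
    with False show ?thesis by (simp add: vec_of_apply)
  qed
qed

lemma vec_of_self: "c \<in> charts_at A p \<Longrightarrow> vec_of A c p a c = a"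
  using jac_self[of "pts M" c p] charts_atD[of c p] by (simp add: vec_of_apply)

lemma linear_vec_of:
  assumes "smooth_param M X c" "p \<in> fst c"
  shows "linear (vec_of A c p)"
  using linear_jac[OF assms]
  by (intro linearI) (auto simp: vec_of_apply fun_eq_iff scaleR_fun_def linear_add linear_cmul)

lemma subspace_tangent_space: "subspace (T p)"
proof -
  have lin: "linear (jac c d p)" if "c \<in> charts_at A p" "d \<in> charts_at A p" for c d
    using charts_atD(5,2)[OF that(1)] that(2) by (rule linear_jac)
  have zero: "v c = 0" if "v \<in> T p" "c \<notin> charts_at A p" for v c
    using that unfolding tangent_space_iff by blast
  show ?thesis
  proof (rule subspaceI)
    show "0 \<in> T p" using lin by (simp add: tangent_space_iff linear_0)
    show "x + y \<in> T p" if "x \<in> T p" "y \<in> T p" for x y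
      unfolding tangent_space_iff
    proof (intro conjI ballI allI impI)
      fix c d assume cd: "c \<in> charts_at A p" "d \<in> charts_at A p"
      then show "(x + y) d = jac c d p ((x + y) c)"
        unfolding plus_fun_def using linear_add[OF lin[OF cd]] tangent_space_apply[OF _ cd] that by metis
    qed (simp add: zero that)
    show "r *\<^sub>R x \<in> T p" if "x \<in> T p" for r x
      unfolding tangent_space_iff
    proof (intro conjI ballI allI impI)
      fix c d assume cd: "c \<in> charts_at A p" "d \<in> charts_at A p"
      then show "(r *\<^sub>R x) d = jac c d p ((r *\<^sub>R x) c)"
        unfolding scaleR_fun_def using linear_cmul[OF lin[OF cd]] tangent_space_apply[OF _ cd] that by metis
    qed (simp add: zero that scaleR_fun_def)
  qed
qed

lemma pts_open: "c \<in> A \<Longrightarrow> open (snd c ` fst c)"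
  using chart by (simp add: is_chart_def)

lemmas metric_linear = inner_product_on_linear[OF inner_product subspace_tangent_space]

lemma metric_coords_apply:
  "c \<in> charts_at A p \<Longrightarrow> metric_coords M c (snd c p) a b = metric M p (vec_of A c p a) (vec_of A c p b)"
  using charts_atD[of c p] is_chart_inv[of "pts M" c p] by (simp add: metric_coords_def Let_def)

lemma metric_coords_linear:
  assumes c: "c \<in> A" and x: "x \<in> snd c ` fst c"
  shows "linear (metric_coords M c x a)" "linear (\<lambda>a. metric_coords M c x a b)"
    "metric_coords M c x a b = metric_coords M c x b a" "a \<noteq> 0 \<Longrightarrow> metric_coords M c x a a > 0"
proof -
  obtain p where p: "p \<in> fst c" "x = snd c p" using x by auto
  then have cp: "c \<in> charts_at A p" using c by (simp add: charts_at_def)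
  note v = vec_of_tangent[OF charts_atD(5,2)[OF cp]] linear_add[OF linear_vec_of[OF charts_atD(5,2)[OF cp]]]
    linear_cmul[OF linear_vec_of[OF charts_atD(5,2)[OF cp]]]
  note m = metric_linear[OF charts_atD(4)[OF cp]] metric_coords_apply[OF cp]
  show "linear (metric_coords M c x a)" "linear (\<lambda>a. metric_coords M c x a b)"
    by (rule linearI; simp add: p m v)+
  show "metric_coords M c x a b = metric_coords M c x b a"
    using m(1)[OF v(1) v(1)] by (simp add: p m(10))
  have "vec_of A c p a \<noteq> 0" if "a \<noteq> 0"
    using that vec_of_self[OF cp, of a] by auto
  then show "a \<noteq> 0 \<Longrightarrow> metric_coords M c x a a > 0" by (simp add: p m v)
qed

lemma linear_koszul_metric:
  assumes "c \<in> A" "x \<in> snd c ` fst c"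
  shows "linear (koszul (metric_coords M c) x a b)" "linear (\<lambda>b. koszul (metric_coords M c) x a b w)"
    "linear (\<lambda>a. koszul (metric_coords M c) x a b w)"
  by (rule koszul_linear[OF pts_open[OF assms(1)] assms(2)];
      fact metric_coords_linear(1,2)[OF assms(1)] smooth_metric[OF assms(1)])+

text \<open>The Koszul expression is linear in its last argument, so it is represented by exactly
  one vector, and the description in \<open>christoffel\<close> denotes it.\<close>

lemma metric_christoffel:
  assumes "c \<in> A" "x \<in> snd c ` fst c"
  shows "metric_coords M c x (christoffel M c x a b) w = koszul (metric_coords M c) x a b w"
  using theI'[OF inner_product_riesz[OF metric_coords_linear(1,2,4)[OF assms] linear_koszul_metric(1)[OF assms]]]
  unfolding christoffel_def koszul_def by blast

section \<open>Behaviour of Christoffel maps and covariant derivatives under a change of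
  charts\<close>

lemma jac_inverse:
  "c \<in> charts_at A p \<Longrightarrow> d \<in> charts_at A p \<Longrightarrow> jac c d p (jac d c p a) = a"
  using jac_compose[of "pts M" d p c d a] jac_self[of "pts M" d p] charts_atD[of d p] by simp

text \<open>The transition map pulls the coefficients of the metric in d back to those in c, so
  \<open>koszul_pullback\<close> gives the law as an identity of forms. Nondegeneracy turns it into
  an identity of vectors.\<close>

lemma christoffel_transition:
  assumes c: "c \<in> charts_at A p" and d: "d \<in> charts_at A p"
  shows "jac c d p (christoffel M c (snd c p) a b) = christoffel M d (snd d p) (jac c d p a) (jac c d p b)
     + frechet_derivative (\<lambda>y. frechet_derivative (transition c d) (at y) b) (at (snd c p)) a"
    (is "?l = ?r")
proof -
  note cA = charts_atD[OF c] note dA = charts_atD[OF d]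
  let ?J = "jac c d p"
  have x: "snd c p \<in> snd c ` fst c" "snd d p \<in> snd d ` fst d" "snd c p \<in> overlap c d" using cA dA by (auto simp: overlap_def)
  have J: "metric_coords M c (snd c p) v w = metric_coords M d (snd d p) (?J v) (?J w)" for v w
    using vec_of_change[OF cA(5,2) d] by (simp add: metric_coords_apply c d)
  have t: "transition c d (snd c p) = snd d p" using transition_apply[OF cA(3,2)] .
  have K: "koszul (metric_coords M c) (snd c p) a b w = koszul (metric_coords M d) (transition c d (snd c p)) (frechet_derivative (transition c d) (at (snd c p)) a) (frechet_derivative (transition c d) (at (snd c p)) b) (frechet_derivative (transition c d) (at (snd c p)) w)
      + metric_coords M d (transition c d (snd c p)) (frechet_derivative (\<lambda>y. frechet_derivative (transition c d) (at y) b) (at (snd c p)) a) (frechet_derivative (transition c d) (at (snd c p)) w)" for w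
  proof (rule koszul_pullback[OF open_param_overlap[OF cA(5) dA(1)] x(3) _ smooth_transition[OF cA(1) dA(1)] _ _ _ smooth_metric[OF dA(1)]])
    show "transition c d ` overlap c d \<subseteq> snd d ` fst d"
      by (auto simp: overlap_def transition_apply[OF cA(3)])
    fix y a b assume "y \<in> overlap c d"
    then obtain p' where p': "y = snd c p'" "c \<in> charts_at A p'" "d \<in> charts_at A p'"
      using cA dA by (auto simp: overlap_def charts_at_def)
    note cA' = charts_atD[OF p'(2)]
    show "metric_coords M c y a b = metric_coords M d (transition c d y) (frechet_derivative (transition c d) (at y) a) (frechet_derivative (transition c d) (at y) b)"
      using vec_of_change[OF cA'(5,2) p'(3)] transition_apply[OF cA'(3,2), of d]
      by (simp add: p' metric_coords_apply jac_def)
  qed (fact metric_coords_linear[OF dA(1)])+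
  note Gd = metric_coords_linear[OF dA(1) x(2)]
  have eq: "metric_coords M d (snd d p) (?l - ?r) (?J w) = 0" for w
    using K[of w] metric_christoffel[OF cA(1) x(1), of a b w] metric_christoffel[OF dA(1) x(2), of "?J a" "?J b" "?J w"]
    by (simp add: linear_diff[OF Gd(2)] linear_add[OF Gd(2)] J t flip: jac_def)
  \<comment> \<open>The Jacobian is onto, so the difference itself can be the test vector, and
    positivity makes it vanish.\<close>
  have "?l - ?r = 0"
    using eq[of "jac d c p (?l - ?r)"] Gd(4)[of "?l - ?r"] jac_inverse[OF c d] by fastforce
  then show ?thesis by simp
qed

lemma open_smooth_field_domain:
  "c \<in> A \<Longrightarrow> openin (top_of_set (pts M)) W \<Longrightarrow> open (snd c ` (fst c \<inter> W))"
  by (rule open_chart_image[OF chart]) auto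

lemma smooth_field_has_derivative:
  assumes "smooth_field M W V" "p \<in> W" "c \<in> charts_at A p"
  shows "((\<lambda>x. V (chart_inv c x) c) has_derivative frechet_derivative (\<lambda>x. V (chart_inv c x) c) (at (snd c p))) (at (snd c p))"
  by (rule smooth_on_has_derivative[of "snd c ` (fst c \<inter> W)"])
    (use assms charts_atD in \<open>auto simp: smooth_field_def\<close>)

text \<open>Differentiating the transformation law of the components of V produces the second
  derivative of the transition map; the law of the Christoffel maps contains the same term with
  opposite sign.\<close>

lemma covariant_derivative_tangent:
  assumes W: "openin (top_of_set (pts M)) W" "p \<in> W" and V: "smooth_field M W V" and u: "u \<in> T p"
  shows "covariant_derivative M V p u \<in> T p"
proof -
  have "covariant_derivative M V p u d = jac c d p (covariant_derivative M V p u c)"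
    if c: "c \<in> charts_at A p" and d: "d \<in> charts_at A p" for c d
  proof -
    note cA = charts_atD[OF c] note dA = charts_atD[OF d]
    let ?t = "transition c d"
    let ?Vc = "\<lambda>x. V (chart_inv c x) c" let ?Vd = "\<lambda>x. V (chart_inv d x) d"
    let ?O = "snd c ` (fst c \<inter> (fst d \<inter> W))"
    have O: "open ?O" "snd c p \<in> ?O"
      using cA dA W by (auto intro!: open_smooth_field_domain openin_Int simp: is_chart_def)
    have sub: "?O \<subseteq> overlap c d" by (auto simp: overlap_def)
    have x: "snd c p \<in> overlap c d" using O(2) sub by auto
    have t: "?t (snd c p) = snd d p" using transition_apply[OF cA(3,2)] .
    have 1: "((\<lambda>y. ?Vd (?t y)) has_derivative (\<lambda>u. frechet_derivative ?Vd (at (snd d p)) (jac c d p u))) (at (snd c p))"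
      by (rule has_derivative_compose[of ?t _ _ _ ?Vd, OF transition_has_derivative[OF cA(5,2) d]])
        (use smooth_field_has_derivative[OF V W(2) d] t in simp)
    have 2: "((\<lambda>y. frechet_derivative ?t (at y) (?Vc y)) has_derivative
        (\<lambda>u. frechet_derivative (\<lambda>y. frechet_derivative ?t (at y) (?Vc (snd c p))) (at (snd c p)) u
           + frechet_derivative ?t (at (snd c p)) (frechet_derivative ?Vc (at (snd c p)) u))) (at (snd c p))"
      by (rule has_derivative_linear_apply[OF O, where A = "\<lambda>y. frechet_derivative ?t (at y)"
            and A' = "\<lambda>u v. frechet_derivative (\<lambda>y. frechet_derivative ?t (at y) v) (at (snd c p)) u"])
        (use smooth_on_linear_derivative[OF smooth_transition[OF cA(1) dA(1)]] sub
          smooth_on_has_derivative[OF smooth_on_frechet_derivative[OF smooth_transition[OF cA(1) dA(1)]] x]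
          smooth_field_has_derivative[OF V W(2) c] in auto)
    have "?Vd (?t y) = frechet_derivative ?t (at y) (?Vc y)" if "y \<in> ?O" for y
    proof -
      obtain p' where p': "y = snd c p'" "c \<in> charts_at A p'" "d \<in> charts_at A p'" "p' \<in> W"
        using cA dA \<open>y \<in> ?O\<close> by (auto simp: charts_at_def)
      moreover have "V p' \<in> T p'" using V p' by (simp add: smooth_field_def)
      ultimately show ?thesis
        using charts_atD[OF p'(2)] charts_atD[OF p'(3)] tangent_space_apply[of "V p'", OF _ p'(2,3)]
        by (simp add: transition_apply is_chart_inv jac_def)
    qed
    from has_derivative_transform_within_open[OF 1 O this]
    have e: "frechet_derivative ?Vd (at (snd d p)) (jac c d p v) =
        frechet_derivative (\<lambda>y. frechet_derivative ?t (at y) (?Vc (snd c p))) (at (snd c p)) v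
           + jac c d p (frechet_derivative ?Vc (at (snd c p)) v)" for v
      using has_derivative_unique[OF _ 2] by (simp add: jac_def fun_eq_iff)
    have "V p \<in> T p" using V W by (simp add: smooth_field_def)
    then have "u d = jac c d p (u c)" "V p d = jac c d p (V p c)"
      using tangent_space_apply[OF _ c d] u by auto
    then show ?thesis
      using c d christoffel_transition[OF c d, of "u c" "V p c"] e[of "u c"]
        linear_add[OF linear_jac[OF cA(5,2) d]]
      by (simp add: covariant_derivative_def is_chart_inv[OF cA(3,2)])
  qed
  note * = this
  show ?thesis
    unfolding tangent_space_iff
  proof (intro conjI ballI allI impI)
    fix c d assume "c \<in> charts_at A p" "d \<in> charts_at A p"
    then show "covariant_derivative M V p u d = jac c d p (covariant_derivative M V p u c)" by (rule *)
  qed (simp add: covariant_derivative_def)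
qed

end

section \<open>Traces with respect to orthonormal bases\<close>

lemma inner_product_on_sum:
  assumes g: "inner_product_on T g" "subspace T" and F: "F \<subseteq> T" and f: "f \<in> T"
  shows "g (\<Sum>e\<in>F. a e *\<^sub>R e) f = (\<Sum>e\<in>F. a e * g e f)"
  using F
proof (induction F rule: infinite_finite_induct)
  case (insert x F)
  then have F: "(\<Sum>e\<in>F. a e *\<^sub>R e) \<in> T" and x: "x \<in> T"
    by (auto intro!: subspace_sum subspace_scale g(2))
  then show ?case
    using insert inner_product_on_linear(2)[OF g subspace_scale[OF g(2) x] F f]
      inner_product_on_linear(4)[OF g x f] by simp
qed (use f inner_product_on_linear(6)[OF g] in auto)

lemma orthonormal_expand:
  assumes E: "orthonormal_basis g T E" and g: "inner_product_on T g" "subspace T" and v: "v \<in> T"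
  shows "v = (\<Sum>e\<in>E. g v e *\<^sub>R e)"
proof -
  have fin: "finite E" and on: "\<And>e f. e \<in> E \<Longrightarrow> f \<in> E \<Longrightarrow> g e f = (if e = f then 1 else 0)" and sp: "span E = T"
    using E by (auto simp: orthonormal_basis_def)
  have ET: "E \<subseteq> T" using sp span_superset by blast
  obtain a where a: "v = (\<Sum>e\<in>E. a e *\<^sub>R e)"
    using v span_finite[OF fin] unfolding sp by auto
  have "g v f = a f" if "f \<in> E" for f
  proof -
    have "f \<in> T" using ET that by blast
    then have "g v f = (\<Sum>e\<in>E. a e * g e f)"
      unfolding a by (rule inner_product_on_sum[OF g ET])
    also have "\<dots> = (\<Sum>e\<in>E. if e = f then a e else 0)"
      by (rule sum.cong) (use on that in auto)
    finally have "g v f = (\<Sum>e\<in>E. if e = f then a e else 0)" .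
    then show ?thesis using fin that by simp
  qed
  then show ?thesis using a by simp
qed

text \<open>Each e is expanded in F. Summing the products of coefficients over E gives g f f' by
  expansion in E, hence the Kronecker delta, and only the diagonal terms of h remain.\<close>

lemma trace_orthonormal_basis:
  fixes h :: "'v::real_vector \<Rightarrow> 'v \<Rightarrow> real"
  assumes E: "orthonormal_basis g T E" and F: "orthonormal_basis g T F"
    and g: "inner_product_on T g" "subspace T"
    and h: "\<And>u. linear (h u)" "\<And>v. linear (\<lambda>u. h u v)"
  shows "(\<Sum>e\<in>E. h e e) = (\<Sum>f\<in>F. h f f)"
proof -
  have on: "\<And>e f. e \<in> F \<Longrightarrow> f \<in> F \<Longrightarrow> g e f = (if e = f then 1 else 0)" and "finite F"
    using F by (auto simp: orthonormal_basis_def)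
  have "span E = T" "span F = T" using E F by (simp_all add: orthonormal_basis_def)
  then have ET: "E \<subseteq> T" "F \<subseteq> T" using span_superset by blast+
  have parseval: "(\<Sum>e\<in>E. g e f * g e f') = g f f'" if f: "f \<in> F" "f' \<in> F" for f f'
  proof -
    have fT: "f \<in> T" "f' \<in> T" using f ET by auto
    have "g f f' = (\<Sum>e\<in>E. g f e * g e f')"
      using inner_product_on_sum[OF g ET(1) fT(2), of "g f"] orthonormal_expand[OF E g fT(1)] by simp
    also have "\<dots> = (\<Sum>e\<in>E. g e f * g e f')"
    proof (rule sum.cong[OF refl])
      fix e assume "e \<in> E"
      then have "g f e = g e f" using ET fT by (intro inner_product_on_linear(1)[OF g]) auto
      then show "g f e * g e f' = g e f * g e f'" by simp
    qed
    finally show ?thesis ..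
  qed
  have "h e e = (\<Sum>f\<in>F. \<Sum>f'\<in>F. (g e f * g e f') * h f f')" if "e \<in> E" for e
  proof -
    have e: "e = (\<Sum>f\<in>F. g e f *\<^sub>R f)" using orthonormal_expand[OF F g] that ET by blast
    have "h e e = h (\<Sum>f\<in>F. g e f *\<^sub>R f) (\<Sum>f\<in>F. g e f *\<^sub>R f)" using e by simp
    also have "\<dots> = (\<Sum>f\<in>F. g e f * h f (\<Sum>f\<in>F. g e f *\<^sub>R f))"
      by (simp only: linear_sum[OF h(2)] linear_cmul[OF h(2)] real_scaleR_def)
    also have "\<dots> = (\<Sum>f\<in>F. \<Sum>f'\<in>F. (g e f * g e f') * h f f')"
      by (simp only: linear_sum[OF h(1)] linear_cmul[OF h(1)] real_scaleR_def sum_distrib_left mult.assoc)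
    finally show ?thesis .
  qed
  then have "(\<Sum>e\<in>E. h e e) = (\<Sum>e\<in>E. \<Sum>f\<in>F. \<Sum>f'\<in>F. (g e f * g e f') * h f f')" by simp
  also have "\<dots> = (\<Sum>f\<in>F. \<Sum>e\<in>E. \<Sum>f'\<in>F. (g e f * g e f') * h f f')" by (rule sum.swap)
  also have "\<dots> = (\<Sum>f\<in>F. \<Sum>f'\<in>F. \<Sum>e\<in>E. (g e f * g e f') * h f f')"
    by (rule sum.cong[OF refl], rule sum.swap)
  also have "\<dots> = (\<Sum>f\<in>F. \<Sum>f'\<in>F. g f f' * h f f')"
    by (intro sum.cong[OF refl]) (simp add: parseval flip: sum_distrib_right)
  also have "\<dots> = (\<Sum>f\<in>F. \<Sum>f'\<in>F. if f' = f then h f f' else 0)"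
    by (intro sum.cong[OF refl]) (simp add: on)
  also have "\<dots> = (\<Sum>f\<in>F. h f f)" using \<open>finite F\<close> by simp
  finally show ?thesis .
qed

text \<open>Everything spanned by the other vectors is orthogonal to e, whereas
  \<open>g e e = 1\<close>.\<close>

lemma orthonormal_basis_independent:
  assumes E: "orthonormal_basis g T E" and g: "inner_product_on T g" "subspace T"
  shows "independent E"
proof -
  have fin: "finite E" and on: "\<And>e f. e \<in> E \<Longrightarrow> f \<in> E \<Longrightarrow> g e f = (if e = f then 1 else 0)" and sp: "span E = T"
    using E by (auto simp: orthonormal_basis_def)
  have "e \<notin> span (E - {e})" if e: "e \<in> E" for e
  proof
    assume "e \<in> span (E - {e})"
    moreover have "x \<in> T \<and> g x e = 0" if "x \<in> span (E - {e})" for x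
      using that
    proof (induction rule: span_induct_alt)
      case base
      then show ?case using e sp span_base[OF e] inner_product_on_linear(6)[OF g] subspace_0[OF g(2)] by simp
    next
      case (step c x y)
      then have "x \<in> T" "y \<in> T" "e \<in> T" using e sp span_base[of _ E] by auto
      then show ?case
        using step e on[of x e] inner_product_on_linear(2)[OF g, of "c *\<^sub>R x" y e]
          inner_product_on_linear(4)[OF g, of x e c] subspace_scale[OF g(2)] subspace_add[OF g(2)] by auto
    qed
    ultimately show False using on[OF e e] by fastforce
  qed
  then show ?thesis by (auto simp: dependent_def)
qed

section \<open>Submanifolds in slice charts\<close>

text \<open>Paired with any y orthogonal to L, the values of f along the line vanish near x, and so
  does their derivative; L is its own double orthogonal complement. Only the values on one line are
  constrained, which suits fields that are tangent to S merely along S.\<close>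

lemma derivative_in_subspace:
  fixes f :: "'a::real_normed_vector \<Rightarrow> 'b::euclidean_space"
  assumes L: "subspace L" and f: "(f has_derivative f') (at x)" and U: "open U" "x \<in> U"
    and in_L: "\<And>t. x + t *\<^sub>R u \<in> U \<Longrightarrow> f (x + t *\<^sub>R u) \<in> L"
  shows "f' u \<in> L"
proof -
  have "f' u \<bullet> y = 0" if y: "\<And>z. z \<in> L \<Longrightarrow> z \<bullet> y = 0" for y
  proof -
    have "((\<lambda>t. f (x + t *\<^sub>R u)) has_derivative (\<lambda>t. f' (t *\<^sub>R u))) (at 0)"
      by (rule has_derivative_compose[of "\<lambda>t. x + t *\<^sub>R u" _ _ _ f]) (use f in \<open>auto intro!: derivative_eq_intros\<close>)
    from has_derivative_inner_left[OF this, of y]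
    have 1: "((\<lambda>t. f (x + t *\<^sub>R u) \<bullet> y) has_derivative (\<lambda>t. f' (t *\<^sub>R u) \<bullet> y)) (at 0)" .
    have "((\<lambda>t. f (x + t *\<^sub>R u) \<bullet> y) has_derivative (\<lambda>t. 0)) (at 0)"
    proof (rule has_derivative_transform_within_open[OF has_derivative_const])
      show "open ((\<lambda>t. x + t *\<^sub>R u) -` U)"
        by (rule open_vimage[OF U(1)]) (intro continuous_intros)
    qed (use U in_L y in auto)
    from fun_cong[OF has_derivative_unique[OF 1 this], of 1] show ?thesis by simp
  qed
  then have "f' u \<in> orthogonal_comp (orthogonal_comp L)"
    by (auto simp: orthogonal_comp_def orthogonal_def inner_commute)
  then show ?thesis using orthogonal_comp_self[OF L] by simp
qed

lemma hyperplane_decompose: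
  fixes L :: "'a::euclidean_space set"
  assumes "subspace L" "dim L = DIM('a) - 1" "n \<notin> L"
  shows "\<exists>r. z - r *\<^sub>R n \<in> L"
proof -
  obtain a where a: "a \<noteq> 0" "span L = {x. a \<bullet> x = 0}" using lowdim_eq_hyperplane[OF assms(2)] .
  then have L: "L = {x. a \<bullet> x = 0}" using span_eq_iff[of L] assms(1) by simp
  then have "a \<bullet> n \<noteq> 0" using assms(3) by simp
  then have "z - ((a \<bullet> z) / (a \<bullet> n)) *\<^sub>R n \<in> L" by (simp add: L inner_diff_right)
  then show ?thesis by blast
qed

text \<open>The condition on a single chart in \<open>submanifold\<close>. The dimension is kept
  apart, since both hypersurfaces and the submanifolds P are described this way.\<close>

definition slice_chart ::
  "('p, 'a::euclidean_space) riemannian \<Rightarrow> ('p, 'a) chart \<Rightarrow> 'a set \<Rightarrow> 'p set \<Rightarrow> bool" where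
  "slice_chart M c L S \<longleftrightarrow>
     c \<in> atlas M \<and> subspace L \<and> snd c ` (fst c \<inter> S) = snd c ` fst c \<inter> L"

context riemannian_atlas
begin

lemma slice_chart_mem:
  assumes "slice_chart M c L S" "p \<in> fst c"
  shows "p \<in> S \<longleftrightarrow> snd c p \<in> L"
proof -
  have c: "is_chart (pts M) c" using assms(1) chart by (simp add: slice_chart_def)
  have eq: "snd c ` (fst c \<inter> S) = snd c ` fst c \<inter> L" using assms(1) by (simp add: slice_chart_def)
  show ?thesis
  proof
    assume "p \<in> S" then have "snd c p \<in> snd c ` (fst c \<inter> S)" using assms(2) by blast
    then show "snd c p \<in> L" using eq by blast
  next
    assume "snd c p \<in> L"
    then have "snd c p \<in> snd c ` (fst c \<inter> S)" using eq assms(2) by blast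
    then obtain p' where "p' \<in> fst c" "p' \<in> S" "snd c p = snd c p'" by blast
    then have "p = p'" using is_chart_inv[OF c assms(2)] is_chart_inv[OF c, of p'] by (metis (no_types))
    then show "p \<in> S" using \<open>p' \<in> S\<close> by simp
  qed
qed

section \<open>Curves, their velocities, and the tangent space in a slice chart\<close>

lemma open_curve_preimage:
  assumes "smooth_curve M J \<gamma>" "c \<in> A"
  shows "open {t \<in> J. \<gamma> t \<in> fst c}"
proof -
  have J: "open J" "\<gamma> \<in> J \<rightarrow> pts M" "continuous_on J \<gamma>" using assms by (auto simp: smooth_curve_def)
  have "openin (top_of_set J) (J \<inter> \<gamma> -` fst c)"
    using chart[OF assms(2)] by (intro continuous_openin_preimage[OF J(3,2)]) (simp add: is_chart_def)
  moreover have "J \<inter> \<gamma> -` fst c = {t \<in> J. \<gamma> t \<in> fst c}" by auto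
  ultimately show ?thesis using openin_open_eq[OF J(1)] by simp
qed

lemma curve_has_vector_derivative:
  assumes "smooth_curve M J \<gamma>" "t \<in> J" "c \<in> charts_at A (\<gamma> t)"
  shows "(snd c \<circ> \<gamma> has_vector_derivative velocity M \<gamma> t c) (at t)"
proof -
  have "smooth_on {t \<in> J. \<gamma> t \<in> fst c} (snd c \<circ> \<gamma>)"
    using assms(1) charts_atD(1)[OF assms(3)] by (simp add: smooth_curve_def)
  then have "snd c \<circ> \<gamma> differentiable (at t)"
    by (rule smooth_on_differentiable) (use assms charts_atD(2)[OF assms(3)] in auto)
  then show ?thesis using assms(3) by (simp add: velocity_def vector_derivative_works)
qed

lemma velocity_tangent:
  assumes \<gamma>: "smooth_curve M J \<gamma>" "t \<in> J"
  shows "velocity M \<gamma> t \<in> T (\<gamma> t)"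
  unfolding tangent_space_iff
proof (intro conjI ballI allI impI)
  fix c d assume c: "c \<in> charts_at A (\<gamma> t)" and d: "d \<in> charts_at A (\<gamma> t)"
  note cA = charts_atD[OF c]
  have "(snd c \<circ> \<gamma> has_derivative (\<lambda>r. r *\<^sub>R velocity M \<gamma> t c)) (at t)"
    using curve_has_vector_derivative[OF \<gamma> c] by (simp add: has_vector_derivative_def)
  from diff_chain_at[OF this, of "transition c d" "jac c d (\<gamma> t)"] transition_has_derivative[OF cA(5,2) d]
  have "(transition c d \<circ> (snd c \<circ> \<gamma>) has_derivative jac c d (\<gamma> t) \<circ> (\<lambda>r. r *\<^sub>R velocity M \<gamma> t c)) (at t)"
    by (simp add: comp_def)
  then have "(snd d \<circ> \<gamma> has_derivative jac c d (\<gamma> t) \<circ> (\<lambda>r. r *\<^sub>R velocity M \<gamma> t c)) (at t)"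
    by (rule has_derivative_transform_within_open[OF _ open_curve_preimage[OF \<gamma>(1) cA(1)]])
      (use \<gamma> cA in \<open>auto simp: transition_apply[OF cA(3)]\<close>)
  from has_derivative_unique[OF this curve_has_vector_derivative[OF \<gamma> d, unfolded has_vector_derivative_def]]
  show "velocity M \<gamma> t d = jac c d (\<gamma> t) (velocity M \<gamma> t c)"
    by (auto simp: fun_eq_iff dest: spec[of _ 1])
qed (simp add: velocity_def)

text \<open>Realizes a vector with prescribed coordinates as a velocity, as the definition of
  \<open>tangent_of\<close> by curves demands.\<close>

lemma coordinate_line_curve:
  assumes c: "c \<in> charts_at A p" and line: "\<And>t. t \<in> {-\<epsilon><..<\<epsilon>} \<Longrightarrow> snd c p + t *\<^sub>R a \<in> snd c ` fst c" and "\<epsilon> > 0"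
  defines "\<gamma> \<equiv> \<lambda>t. chart_inv c (snd c p + t *\<^sub>R a)"
  shows "smooth_curve M {-\<epsilon><..<\<epsilon>} \<gamma>" "velocity M \<gamma> 0 = vec_of A c p a"
proof -
  note cA = charts_atD[OF c]
  let ?J = "{-\<epsilon><..<\<epsilon>}"
  have mem: "\<gamma> t \<in> fst c" "snd c (\<gamma> t) = snd c p + t *\<^sub>R a" if "t \<in> ?J" for t
    using is_chart_inv_mem[OF cA(3) line[OF that]] is_chart_inv_right[OF line[OF that]] by (simp_all add: \<gamma>_def)
  have \<gamma>0: "\<gamma> 0 = p" using is_chart_inv[OF cA(3,2)] by (simp add: \<gamma>_def)
  have cont_line: "continuous_on X (\<lambda>t. snd c p + t *\<^sub>R a)" for X by (intro continuous_intros)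
  have "continuous_on (snd c ` fst c) (chart_inv c)"
    using cA(3) by (simp add: is_chart_def homeomorphism_def)
  then have cont: "continuous_on ?J \<gamma>"
    unfolding \<gamma>_def using line by (intro continuous_on_compose2[OF _ cont_line]) auto
  have set: "{t \<in> ?J. \<gamma> t \<in> fst d} = ?J \<inter> (\<lambda>t. snd c p + t *\<^sub>R a) -` overlap c d" for d :: "('p, 'a) chart"
  proof (intro set_eqI iffI)
    fix t assume "t \<in> {t \<in> ?J. \<gamma> t \<in> fst d}"
    then show "t \<in> ?J \<inter> (\<lambda>t. snd c p + t *\<^sub>R a) -` overlap c d" using mem[of t] by (auto simp: overlap_def image_iff intro!: bexI[of _ "\<gamma> t"])
  next
    fix t assume t: "t \<in> ?J \<inter> (\<lambda>t. snd c p + t *\<^sub>R a) -` overlap c d"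
    then obtain p' where "p' \<in> fst c" "p' \<in> fst d" "snd c p + t *\<^sub>R a = snd c p'" by (auto simp: overlap_def)
    then show "t \<in> {t \<in> ?J. \<gamma> t \<in> fst d}" using t is_chart_inv[OF cA(3)] by (auto simp: \<gamma>_def)
  qed
  have smooth: "smooth_on {t \<in> ?J. \<gamma> t \<in> fst d} (snd d \<circ> \<gamma>)" if d: "d \<in> A" for d
  proof -
    have op: "open {t \<in> ?J. \<gamma> t \<in> fst d}"
      unfolding set by (intro open_Int open_vimage[OF open_param_overlap[OF cA(5) d] cont_line]) auto
    have "smooth_on {t \<in> ?J. \<gamma> t \<in> fst d} (\<lambda>t. transition c d (snd c p + t *\<^sub>R a))"
    proof (rule smooth_on_compose[OF op open_param_overlap[OF cA(5) d] _ _ smooth_transition[OF cA(1) d]])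
      show "smooth_on {t \<in> ?J. \<gamma> t \<in> fst d} (\<lambda>t. snd c p + t *\<^sub>R a)"
        by (intro smooth_on_add[OF op] smooth_on_scaleR[OF op] smooth_on_const smooth_on_id[OF op])
      show "(\<lambda>t. snd c p + t *\<^sub>R a) ` {t \<in> ?J. \<gamma> t \<in> fst d} \<subseteq> overlap c d"
        unfolding set by auto
    qed
    then show ?thesis by (simp add: transition_def \<gamma>_def comp_def)
  qed
  have "\<gamma> ` ?J \<subseteq> pts M" using mem(1) is_chart_subset[OF cA(3)] by blast
  then show curve: "smooth_curve M ?J \<gamma>"
    unfolding smooth_curve_def using smooth cont by (auto intro!: is_interval_oo)
  have "velocity M \<gamma> 0 \<in> T p" using velocity_tangent[OF curve, of 0] \<open>\<epsilon> > 0\<close> \<gamma>0 by simp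
  moreover have "velocity M \<gamma> 0 c = a"
  proof -
    have "((\<lambda>t. snd c p + t *\<^sub>R a) has_vector_derivative a) (at 0)"
      by (auto intro!: derivative_eq_intros)
    then have "(snd c \<circ> \<gamma> has_vector_derivative a) (at 0)"
      by (rule has_vector_derivative_transform_within_open[of _ _ _ ?J]) (use mem \<open>\<epsilon> > 0\<close> in auto)
    then show ?thesis using c \<gamma>0 by (simp add: velocity_def vector_derivative_at)
  qed
  ultimately show "velocity M \<gamma> 0 = vec_of A c p a" using vec_of_tangent_eq[OF _ c] by metis
qed

text \<open>A curve in S has coordinates in L, hence velocity in L; conversely a coordinate line
  through p in a direction of L stays in S. A set defined by curves thereby becomes a linear
  subspace.\<close>

lemma tangent_of_slice:
  assumes s: "slice_chart M c L S" and p: "p \<in> fst c" "p \<in> S"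
  shows "tangent_of M S p = {v \<in> T p. v c \<in> L}"
proof (intro set_eqI iffI)
  have c: "c \<in> charts_at A p" and L: "subspace L" using s p by (auto simp: slice_chart_def charts_at_def)
  note cA = charts_atD[OF c]
  {
    fix v assume "v \<in> tangent_of M S p"
    then obtain \<gamma> \<epsilon> where \<gamma>: "\<epsilon> > 0" "smooth_curve M {-\<epsilon><..<\<epsilon>} \<gamma>" "\<gamma> ` {-\<epsilon><..<\<epsilon>} \<subseteq> S" "\<gamma> 0 = p" "v = velocity M \<gamma> 0"
      by (auto simp: tangent_of_def)
    have 0: "0 \<in> {-\<epsilon><..<\<epsilon>}" using \<gamma> by simp
    have "v \<in> T p" using velocity_tangent[OF \<gamma>(2) 0] \<gamma> by simp
    moreover have "(\<lambda>r. r *\<^sub>R v c) 1 \<in> L"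
    proof (rule derivative_in_subspace[OF L, where x = 0 and U = "{t \<in> {-\<epsilon><..<\<epsilon>}. \<gamma> t \<in> fst c}" and f = "snd c \<circ> \<gamma>"])
      show "(snd c \<circ> \<gamma> has_derivative (\<lambda>r. r *\<^sub>R v c)) (at 0)"
        using curve_has_vector_derivative[OF \<gamma>(2) 0] c \<gamma> by (simp add: has_vector_derivative_def)
      show "open {t \<in> {-\<epsilon><..<\<epsilon>}. \<gamma> t \<in> fst c}" by (rule open_curve_preimage[OF \<gamma>(2) cA(1)])
      show "(snd c \<circ> \<gamma>) (0 + t *\<^sub>R 1) \<in> L" if "0 + t *\<^sub>R 1 \<in> {t \<in> {-\<epsilon><..<\<epsilon>}. \<gamma> t \<in> fst c}" for t
      proof -
        have t: "t \<in> {-\<epsilon><..<\<epsilon>}" "\<gamma> t \<in> fst c" using that by auto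
        then have "\<gamma> t \<in> S" using \<gamma>(3) by blast
        then show ?thesis using slice_chart_mem[OF s t(2)] by simp
      qed
    qed (use 0 \<gamma> cA in auto)
    ultimately show "v \<in> {v \<in> T p. v c \<in> L}" by simp
  next
    fix v assume v: "v \<in> {v \<in> T p. v c \<in> L}"
    let ?f = "\<lambda>t. snd c p + t *\<^sub>R v c"
    have "open (?f -` (snd c ` fst c))" by (intro open_vimage[OF pts_open[OF cA(1)]] continuous_intros)
    moreover have "0 \<in> ?f -` (snd c ` fst c)" using cA by simp
    ultimately obtain \<epsilon> where \<epsilon>: "\<epsilon> > 0" "ball 0 \<epsilon> \<subseteq> ?f -` (snd c ` fst c)" using openE by blast
    have line: "?f t \<in> snd c ` fst c" if "t \<in> {-\<epsilon><..<\<epsilon>}" for t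
      using subsetD[OF \<epsilon>(2), of t] that by (auto simp: abs_less_iff)
    note curve = coordinate_line_curve[OF c line \<epsilon>(1)]
    have "chart_inv c (?f t) \<in> S" if t: "t \<in> {-\<epsilon><..<\<epsilon>}" for t
    proof -
      have "snd c p \<in> L" using slice_chart_mem[OF s p(1)] p(2) by simp
      then have "?f t \<in> L" using v L by (auto intro: subspace_add subspace_scale)
      then show ?thesis
        using slice_chart_mem[OF s is_chart_inv_mem[OF cA(3) line[OF t]]] is_chart_inv_right[OF line[OF t]] by simp
    qed
    then show "v \<in> tangent_of M S p"
      unfolding tangent_of_def mem_Collect_eq using curve \<epsilon>(1) is_chart_inv[OF cA(3,2)] vec_of_tangent_eq[OF _ c, of v] v
      by (intro exI[of _ "\<lambda>t. chart_inv c (?f t)"] exI[of _ \<epsilon>]) auto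
  }
qed

lemma subspace_tangent_of_slice:
  assumes s: "slice_chart M c L S" and p: "p \<in> fst c" "p \<in> S"
  shows "subspace (tangent_of M S p)"
  unfolding tangent_of_slice[OF assms]
  using subspace_tangent_space[of p] s unfolding slice_chart_def subspace_def scaleR_fun_def plus_fun_def zero_fun_def
  by (simp add: zero_fun_def)

end

lemma linear_tvec_component: "linear (\<lambda>v :: ('p, 'a::euclidean_space) tvec. v c)"
  by (rule linearI) (simp_all add: scaleR_fun_def)

context riemannian_atlas
begin

lemma slice_chart_charts_at: "slice_chart M c L S \<Longrightarrow> p \<in> fst c \<Longrightarrow> c \<in> charts_at A p"
  by (simp add: slice_chart_def charts_at_def)

text \<open>Provides the local extension that the second fundamental form asks for: constant
  coordinates in L are tangent to S at every point of S in the chart.\<close>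

lemma constant_slice_field:
  assumes s: "slice_chart M c L S" and a: "a \<in> L"
  shows "smooth_field M (fst c) (\<lambda>x. vec_of A c x a)"
    "\<And>x. x \<in> fst c \<inter> S \<Longrightarrow> vec_of A c x a \<in> tangent_of M S x"
proof -
  have c: "c \<in> A" using s by (simp add: slice_chart_def)
  show "smooth_field M (fst c) (\<lambda>x. vec_of A c x a)"
    unfolding smooth_field_def
  proof (intro conjI ballI)
    show "vec_of A c p a \<in> T p" if "p \<in> fst c" for p
      by (rule vec_of_tangent[OF smooth_param_atlas[OF c] that])
    fix d assume d: "d \<in> A"
    have eq: "snd d ` (fst d \<inter> fst c) = overlap d c" by (simp add: overlap_def)
    have op: "open (overlap d c)" "open (overlap c d)"
      using open_param_overlap smooth_param_atlas c d by blast+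
    have "smooth_on (overlap d c) (\<lambda>x. frechet_derivative (transition c d) (at (transition d c x)) a)"
      by (rule smooth_on_compose[OF op _ smooth_transition[OF d c] smooth_on_frechet_derivative[OF smooth_transition[OF c d]]])
        (auto simp: overlap_def transition_apply[OF chart[OF d]])
    then show "smooth_on (snd d ` (fst d \<inter> fst c)) (\<lambda>x. vec_of A c (chart_inv d x) a d)"
      unfolding eq
    proof (rule smooth_on_cong[OF op(1)])
      fix x assume "x \<in> overlap d c"
      then obtain p where p: "p \<in> fst d" "p \<in> fst c" "x = snd d p" by (auto simp: overlap_def)
      then have "d \<in> charts_at A p" using d by (simp add: charts_at_def)
      with p show "frechet_derivative (transition c d) (at (transition d c x)) a = vec_of A c (chart_inv d x) a d"
        using transition_apply[OF chart[OF d] p(1), of c] is_chart_inv[OF chart[OF d] p(1)]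
        by (simp add: vec_of_apply jac_def)
    qed
  qed
  fix x assume x: "x \<in> fst c \<inter> S"
  then show "vec_of A c x a \<in> tangent_of M S x"
    using tangent_of_slice[OF s, of x] vec_of_tangent[OF smooth_param_atlas[OF c], of x a]
      vec_of_self[OF slice_chart_charts_at[OF s, of x], of a] a by auto
qed

end

text \<open>A hypersurface seen from one point in one slice chart. It is used twice: for \<Sigma> in
  M, and for the intersection of P with \<Sigma> inside P.\<close>

locale hypersurface_point = riemannian_atlas M
  for M :: "('p::topological_space, 'a::euclidean_space) riemannian" +
  fixes c L S p n
  assumes slice: "slice_chart M c L S" and p: "p \<in> fst c" "p \<in> S" and dim_L: "dim L = DIM('a) - 1"
    and n_normal: "n \<in> normal_of M S p" and n_unit: "metric M p n n = 1"
begin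

lemma chart_at_p: "c \<in> charts_at A p" by (rule slice_chart_charts_at[OF slice p(1)])

lemmas chart_facts = charts_atD[OF chart_at_p]

lemma coord: "snd c p \<in> snd c ` fst c" using p by blast

lemma subspace_L: "subspace L" using slice by (simp add: slice_chart_def)

lemmas g_linear = metric_linear[OF chart_facts(4)]

lemma tangent_iff: "v \<in> tangent_of M S p \<longleftrightarrow> v \<in> T p \<and> v c \<in> L"
  using tangent_of_slice[OF slice p] by simp

lemma n_tangent_space: "n \<in> T p" using n_normal by (simp add: normal_of_def)

lemma n_orthogonal: "t \<in> tangent_of M S p \<Longrightarrow> metric M p n t = 0"
  using n_normal by (simp add: normal_of_def)

text \<open>A tangent n would be orthogonal to itself, so its coordinates lie outside the hyperplane
  L and complement it. Pairing with n then identifies the coefficient.\<close>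

lemma tangent_decompose:
  assumes z: "z \<in> T p"
  shows "z - metric M p z n *\<^sub>R n \<in> tangent_of M S p"
proof -
  have "n \<notin> tangent_of M S p" using n_orthogonal[of n] n_unit by auto
  then have "n c \<notin> L" using tangent_iff n_tangent_space by blast
  from hyperplane_decompose[OF subspace_L dim_L this] obtain r where r: "z c - r *\<^sub>R n c \<in> L" by blast
  have t: "z - r *\<^sub>R n \<in> tangent_of M S p"
    using r z n_tangent_space subspace_diff[OF subspace_tangent_space] subspace_scale[OF subspace_tangent_space]
    by (simp add: tangent_iff scaleR_fun_def)
  have "metric M p (z - r *\<^sub>R n) n = 0"
    using n_orthogonal[OF t] g_linear(1)[OF n_tangent_space, of "z - r *\<^sub>R n"] t tangent_iff by simp
  then have "metric M p z n = r"
    using g_linear(8)[OF z subspace_scale[OF subspace_tangent_space n_tangent_space] n_tangent_space]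
      g_linear(4)[OF n_tangent_space n_tangent_space] n_unit by simp
  then show ?thesis using t by simp
qed

text \<open>Two candidates differ by a vector that is both tangent and normal, hence zero.\<close>

lemma normal_part_eq:
  assumes z: "z \<in> T p"
  shows "normal_part M S p z = metric M p z n *\<^sub>R n"
  unfolding normal_part_def
proof (rule the_equality)
  let ?n = "metric M p z n *\<^sub>R n"
  have nT: "?n \<in> T p" by (rule subspace_scale[OF subspace_tangent_space n_tangent_space])
  have Tan: "tangent_of M S p \<subseteq> T p" using tangent_iff by blast
  have nn: "?n \<in> normal_of M S p"
    using nT n_orthogonal g_linear(4)[OF n_tangent_space] Tan by (auto simp: normal_of_def)
  then show "?n \<in> normal_of M S p \<and> z - ?n \<in> tangent_of M S p" using tangent_decompose[OF z] by blast
  fix n' assume n': "n' \<in> normal_of M S p \<and> z - n' \<in> tangent_of M S p"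
  then have n'T: "n' \<in> T p" by (simp add: normal_of_def)
  let ?d = "?n - n'"
  have "(z - n') - (z - ?n) \<in> tangent_of M S p"
    using subspace_diff[OF subspace_tangent_of_slice[OF slice p]] n' tangent_decompose[OF z] by blast
  then have d: "?d \<in> tangent_of M S p" by (simp add: algebra_simps)
  have "metric M p ?d ?d = 0"
    using g_linear(8)[OF nT n'T, of ?d] d Tan nn n' by (auto simp: normal_of_def)
  then have "?d = 0" using g_linear(9)[of ?d] d Tan by fastforce
  then show "n' = ?n" by simp
qed

text \<open>The component along n of the second fundamental form. Written in coordinates it is
  bilinear on the whole type of families, as \<open>trace_orthonormal_basis\<close> requires, and
  not only on tangent vectors.\<close>

abbreviation "K u v \<equiv> koszul (metric_coords M c) (snd c p) (u c) (v c) (n c)"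

text \<open>For any admissible extension V the derivative of its coordinates in direction u lies in
  L, since V is tangent to S along S. Pairing with n removes this term and leaves the Christoffel
  term, which involves only the value v of V at p.\<close>

lemma second_fundamental_form_eq:
  assumes u: "u \<in> tangent_of M S p" and v: "v \<in> tangent_of M S p"
  shows "second_fundamental_form M S p u v = K u v *\<^sub>R n"
  unfolding second_fundamental_form_def
proof (rule the_equality)
  have field: "normal_part M S p (covariant_derivative M V p u) = K u v *\<^sub>R n"
    if W: "openin (top_of_set (pts M)) W" "p \<in> W" and V: "smooth_field M W V"
      and tan: "\<forall>x\<in>W \<inter> S. V x \<in> tangent_of M S x" and Vp: "V p = v" for W V
  proof -
    let ?z = "covariant_derivative M V p u"
    let ?D = "frechet_derivative (\<lambda>x. V (chart_inv c x) c) (at (snd c p))"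
    have uT: "u \<in> T p" and uL: "u c \<in> L" using u tangent_iff by auto
    have z: "?z \<in> T p" by (rule covariant_derivative_tangent[OF W V uT])
    have DL: "?D (u c) \<in> L"
    proof (rule derivative_in_subspace[OF subspace_L smooth_field_has_derivative[OF V W(2) chart_at_p] open_smooth_field_domain[OF chart_facts(1) W(1)]])
      show "snd c p \<in> snd c ` (fst c \<inter> W)" using W p by blast
      fix t assume "snd c p + t *\<^sub>R u c \<in> snd c ` (fst c \<inter> W)"
      then obtain x where x: "x \<in> fst c" "x \<in> W" "snd c p + t *\<^sub>R u c = snd c x" by auto
      have "snd c p \<in> L" using slice_chart_mem[OF slice p(1)] p(2) by simp
      then have "snd c x \<in> L" using x(3) uL subspace_add[OF subspace_L] subspace_scale[OF subspace_L] by metis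
      then have "x \<in> S" using slice_chart_mem[OF slice x(1)] by simp
      then show "V (chart_inv c (snd c p + t *\<^sub>R u c)) c \<in> L"
        using tan x tangent_of_slice[OF slice x(1)] is_chart_inv[OF chart_facts(3) x(1)] by auto
    qed
    let ?G = "metric_coords M c (snd c p)"
    have G: "?G a (n c) = metric M p (vec_of A c p a) n" for a
      by (simp add: metric_coords_apply[OF chart_at_p] vec_of_tangent_eq[OF n_tangent_space chart_at_p])
    have "vec_of A c p (?D (u c)) \<in> tangent_of M S p"
      using constant_slice_field(2)[OF slice DL, of p] p by blast
    then have 0: "?G (?D (u c)) (n c) = 0"
      using n_orthogonal g_linear(1)[OF n_tangent_space] tangent_iff by (simp add: G)
    have "metric M p ?z n = ?G (?z c) (n c)" by (simp add: G vec_of_tangent_eq[OF z chart_at_p])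
    also have "\<dots> = ?G (?D (u c) + christoffel M c (snd c p) (u c) (v c)) (n c)"
      using chart_at_p Vp by (simp add: covariant_derivative_def)
    also have "\<dots> = K u v"
      using 0 metric_christoffel[OF chart_facts(1) coord] linear_add[OF metric_coords_linear(2)[OF chart_facts(1) coord]] by simp
    finally show ?thesis by (simp add: normal_part_eq[OF z])
  qed
  have vL: "v c \<in> L" and vT: "v \<in> T p" using v tangent_iff by auto
  let ?V = "\<lambda>x. vec_of A c x (v c)"
  have "openin (top_of_set (pts M)) (fst c)" using chart_facts(3) by (simp add: is_chart_def)
  note V = this p(1) constant_slice_field(1)[OF slice vL]
  have V': "\<forall>x\<in>fst c \<inter> S. ?V x \<in> tangent_of M S x" "?V p = v"
    by (rule ballI, erule constant_slice_field(2)[OF slice vL]) (rule vec_of_tangent_eq[OF vT chart_at_p])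
  show "\<exists>W V. openin (top_of_set (pts M)) W \<and> p \<in> W \<and> smooth_field M W V \<and>
        (\<forall>x\<in>W \<inter> S. V x \<in> tangent_of M S x) \<and> V p = v \<and>
        K u v *\<^sub>R n = normal_part M S p (covariant_derivative M V p u)"
    using field[OF V V'] V V' by (intro exI[of _ "fst c"] exI[of _ ?V]) simp
  show "z = K u v *\<^sub>R n" if "\<exists>W V. openin (top_of_set (pts M)) W \<and> p \<in> W \<and> smooth_field M W V \<and>
        (\<forall>x\<in>W \<inter> S. V x \<in> tangent_of M S x) \<and> V p = v \<and>
        z = normal_part M S p (covariant_derivative M V p u)" for z
    using that field by (elim exE conjE) simp
qed

lemma subspace_tangent: "subspace (tangent_of M S p)"
  by (rule subspace_tangent_of_slice[OF slice p])

lemma inner_product_tangent: "inner_product_on (tangent_of M S p) (metric M p)"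
proof -
  have Tan: "u \<in> T p" if "u \<in> tangent_of M S p" for u using that tangent_iff by simp
  show ?thesis
    unfolding inner_product_on_def
    using g_linear(1,2,4,9) Tan subspace_scale[OF subspace_tangent_space] by (simp add: Tan)
qed

text \<open>Evaluation at c maps the tangent space isomorphically onto L, which moves the count from
  the large space of families into a Euclidean space.\<close>

lemma card_orthonormal_basis:
  assumes E: "orthonormal_basis (metric M p) (tangent_of M S p) E"
  shows "card E = dim L"
proof -
  have sp: "span E = tangent_of M S p" using E by (simp add: orthonormal_basis_def)
  have inj: "inj_on (\<lambda>v. v c) (span E)"
    unfolding sp using vec_of_tangent_eq[OF _ chart_at_p] tangent_iff by (intro inj_on_inverseI[of _ "vec_of A c p"]) blast
  have "(\<lambda>v. v c) ` span E = L"
  proof (intro equalityI subsetI)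
    fix a assume "a \<in> L"
    then have "vec_of A c p a \<in> span E" unfolding sp using constant_slice_field(2)[OF slice, of a p] p by blast
    then show "a \<in> (\<lambda>v. v c) ` span E" using vec_of_self[OF chart_at_p, of a] by (metis image_eqI)
  qed (use sp tangent_iff in auto)
  then have "span ((\<lambda>v. v c) ` E) = L"
    using linear_span_image[OF linear_tvec_component[of c], of E] by simp
  moreover have "independent ((\<lambda>v. v c) ` E)"
    by (rule linear_independent_injective_image[OF linear_tvec_component orthonormal_basis_independent[OF E inner_product_tangent subspace_tangent] inj])
  ultimately have "dim L = card ((\<lambda>v. v c) ` E)"
    by (metis dim_eq_card_independent dim_span)
  also have "\<dots> = card E" using inj_on_subset[OF inj span_superset] by (rule card_image)
  finally show ?thesis ..
qed

text \<open>Every orthonormal basis gives the same trace and has the same cardinality, so the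
  description has exactly one value. It is a multiple of n, and the factor is determined because n
  is not zero.\<close>

lemma mean_curvature_eq:
  assumes E: "orthonormal_basis (metric M p) (tangent_of M S p) E"
  shows "mean_curvature M S p n = (\<Sum>e\<in>E. K e e) / real (card E)"
proof -
  have lin: "linear (K u)" "linear (\<lambda>u. K u v)" for u v
    using linear_compose[OF linear_tvec_component[of c] linear_koszul_metric(2)[OF chart_facts(1) coord]]
      linear_compose[OF linear_tvec_component[of c] linear_koszul_metric(3)[OF chart_facts(1) coord]]
    by (simp_all add: comp_def)
  have H: "(1 / real (card F)) *\<^sub>R (\<Sum>e\<in>F. second_fundamental_form M S p e e) = ((\<Sum>e\<in>E. K e e) / real (card E)) *\<^sub>R n"
    if F: "orthonormal_basis (metric M p) (tangent_of M S p) F" for F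
  proof -
    have "F \<subseteq> tangent_of M S p" using F span_superset[of F] by (simp add: orthonormal_basis_def)
    then have "(\<Sum>e\<in>F. second_fundamental_form M S p e e) = (\<Sum>e\<in>F. K e e *\<^sub>R n)"
      by (intro sum.cong refl second_fundamental_form_eq) auto
    also have "\<dots> = (\<Sum>e\<in>E. K e e) *\<^sub>R n"
    proof -
      have "(\<Sum>e\<in>F. K e e) = (\<Sum>e\<in>E. K e e)"
        by (rule trace_orthonormal_basis[OF F E inner_product_tangent subspace_tangent, of K]) (fact lin)+
      then show ?thesis by (simp flip: scaleR_left.sum)
    qed
    finally show ?thesis using card_orthonormal_basis[OF E] card_orthonormal_basis[OF F] by simp
  qed
  have "mean_curvature_vector M S p = ((\<Sum>e\<in>E. K e e) / real (card E)) *\<^sub>R n"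
    unfolding mean_curvature_vector_def
    by (rule the_equality) (use E H in auto)
  moreover have "n \<noteq> 0" using n_unit g_linear(6)[OF n_tangent_space] by auto
  ultimately show ?thesis unfolding mean_curvature_def by simp
qed

end

section \<open>Submanifolds as Riemannian manifolds\<close>

text \<open>A chart determines its \<open>chart_inv\<close>, so an inverse given by a formula must
  be identified with it on the image.\<close>

lemma is_chartI:
  assumes "openin (top_of_set X) U" "open (\<phi> ` U)" "continuous_on U \<phi>" "continuous_on (\<phi> ` U) \<psi>"
    and inv: "\<And>p. p \<in> U \<Longrightarrow> \<psi> (\<phi> p) = p"
  shows "is_chart X (U, \<phi>)" "\<And>x. x \<in> \<phi> ` U \<Longrightarrow> chart_inv (U, \<phi>) x = \<psi> x"
proof -
  have inj: "inj_on \<phi> U" using inv by (rule inj_on_inverseI)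
  show eq: "chart_inv (U, \<phi>) x = \<psi> x" if "x \<in> \<phi> ` U" for x
    using that inv inj by (auto simp: chart_inv_def)
  have "continuous_on (\<phi> ` U) (chart_inv (U, \<phi>))"
    using assms(4) by (rule continuous_on_eq) (simp add: eq)
  then have "homeomorphism U (\<phi> ` U) \<phi> (chart_inv (U, \<phi>))"
    using assms(3) inv by (auto simp: homeomorphism_def eq image_image)
  then show "is_chart X (U, \<phi>)" using assms(1,2) by (simp add: is_chart_def)
qed

locale riemannian_submanifold_atlas = riemannian_atlas M
  for M :: "('p::topological_space, 'a::euclidean_space) riemannian" +
  fixes P :: "('p, 'b::euclidean_space) riemannian"
  assumes submanifold_P: "riemannian_submanifold P M"
begin

lemma P_eq: "P = induced_riemannian M (pts P)"
  using submanifold_P by (simp add: riemannian_submanifold_def)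

lemma pts_P: "pts P \<subseteq> pts M"
  using submanifold_P by (simp add: riemannian_submanifold_def submanifold_def)

lemma atlas_P: "c \<in> atlas P \<longleftrightarrow> is_chart (pts P) c \<and>
    (\<forall>d\<in>A. smooth_on (overlap c d) (transition c d) \<and>
      (\<forall>x\<in>overlap c d. inj (frechet_derivative (transition c d) (at x))))"
  by (subst P_eq) (simp add: induced_riemannian_def Let_def)

abbreviation "incl \<equiv> inclusion_differential (atlas P) (atlas M)"

lemma metric_P: "metric P p u v = metric M p (incl p u) (incl p v)"
proof -
  have "metric P = (\<lambda>p u v. metric M p (inclusion_differential (atlas P) (atlas M) p u) (inclusion_differential (atlas P) (atlas M) p v))"
    by (subst (1 2 3) P_eq) (simp only: induced_riemannian_def Let_def riemannian.simps)
  then show ?thesis by metis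
qed

lemma atlas_PD:
  assumes "c \<in> charts_at (atlas P) p"
  shows "c \<in> atlas P" "p \<in> fst c" "is_chart (pts P) c" "p \<in> pts P" "p \<in> pts M" "smooth_param M (pts P) c"
proof -
  show c: "c \<in> atlas P" "p \<in> fst c" using assms by (simp_all add: charts_at_def)
  show "is_chart (pts P) c" using c atlas_P by blast
  then show "p \<in> pts P" using is_chart_subset c by blast
  then show "p \<in> pts M" using pts_P by blast
  show "smooth_param M (pts P) c" using c(1) atlas_P pts_P by (simp add: smooth_param_def)
qed

lemma inj_jac_P: "c \<in> charts_at (atlas P) p \<Longrightarrow> d \<in> charts_at A p \<Longrightarrow> inj (jac c d p)"
  unfolding jac_def using atlas_P[of c] by (auto simp: charts_at_def overlap_def)

lemma slice_P:
  assumes "p \<in> pts P"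
  obtains e L where "e \<in> charts_at A p" "slice_chart M e L (pts P)" "dim L = DIM('b)"
proof -
  have "\<exists>e\<in>charts_at A p. \<exists>L. subspace L \<and> dim L = DIM('b) \<and> snd e ` (fst e \<inter> pts P) = snd e ` fst e \<inter> L"
    using submanifold_P assms unfolding riemannian_submanifold_def submanifold_def by blast
  then show thesis using that charts_atD(1) unfolding slice_chart_def by blast
qed

lemma transition_in_slice:
  assumes e: "slice_chart M e L (pts P)" and d: "is_chart (pts P) d" and x: "x \<in> overlap d e"
  shows "transition d e x \<in> L"
proof -
  obtain p where p: "p \<in> fst d" "p \<in> fst e" "x = snd d p" using x by (auto simp: overlap_def)
  then have "p \<in> pts P" using is_chart_subset[OF d] by blast
  then show ?thesis
    using slice_chart_mem[OF e p(2)] transition_apply[OF d p(1), of e] p(3) by simp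
qed

lemma jac_in_slice:
  assumes e: "slice_chart M e L (pts P)" and d: "d \<in> charts_at (atlas P) p" and p: "p \<in> fst e"
  shows "jac d e p v \<in> L"
proof -
  note dA = atlas_PD[OF d]
  have eA: "e \<in> charts_at A p" by (rule slice_chart_charts_at[OF e p])
  show ?thesis
  proof (rule derivative_in_subspace[OF _ transition_has_derivative[OF dA(6,2) eA] open_param_overlap[OF dA(6) charts_atD(1)[OF eA]]])
    show "subspace L" using e by (simp add: slice_chart_def)
    show "snd d p \<in> overlap d e" using dA p by (simp add: overlap_def)
  qed (rule transition_in_slice[OF e dA(3)])
qed

text \<open>A slice chart of \<open>M\<close> followed by a linear isomorphism of the slice with the model space.\<close>

lemma adapted_chart:
  assumes p: "p \<in> pts P"
  obtains c where "c \<in> charts_at (atlas P) p"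
    "\<And>d. d \<in> atlas P \<Longrightarrow> smooth_on (overlap d c) (transition d c)"
    "\<And>d. d \<in> atlas P \<Longrightarrow> smooth_on (overlap c d) (transition c d)"
proof -
  obtain e L where e: "e \<in> charts_at A p" "slice_chart M e L (pts P)" "dim L = DIM('b)" using slice_P[OF p] .
  note eA = charts_atD[OF e(1)]
  have L: "subspace L" using e by (simp add: slice_chart_def)
  obtain f :: "'b \<Rightarrow> 'a" and g where f: "linear f" "f ` UNIV = L" and g: "linear g"
    and gf: "\<And>x. g (f x) = x" and fg: "\<And>y. y \<in> L \<Longrightarrow> f (g y) = y"
    using isometries_subspaces[OF subspace_UNIV L, where 'a = 'b] e(3) by (metis UNIV_I dim_UNIV)
  have fL: "f x \<in> L" for x using f(2) by blast
  have bf: "bounded_linear f" and bg: "bounded_linear g"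
    using f g linear_conv_bounded_linear by blast+
  let ?c = "(fst e \<inter> pts P, g \<circ> snd e)"
  have eL: "snd e r \<in> L \<longleftrightarrow> r \<in> pts P" if "r \<in> fst e" for r using slice_chart_mem[OF e(2) that] by simp
  \<comment> \<open>As a preimage under the continuous map f the image of the new chart is visibly
    open.\<close>
  have img: "(g \<circ> snd e) ` (fst e \<inter> pts P) = f -` (snd e ` fst e)"
  proof (intro set_eqI iffI)
    fix x assume "x \<in> (g \<circ> snd e) ` (fst e \<inter> pts P)"
    then show "x \<in> f -` (snd e ` fst e)" using eL fg by auto
  next
    fix x assume "x \<in> f -` (snd e ` fst e)"
    then obtain r where r: "r \<in> fst e" "f x = snd e r" by auto
    then have "r \<in> pts P" using eL fL[of x] by metis
    then show "x \<in> (g \<circ> snd e) ` (fst e \<inter> pts P)" using r gf[of x] by (auto simp: image_iff intro!: bexI[of _ r])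
  qed
  have cont_e: "continuous_on (fst e) (snd e)" "continuous_on (snd e ` fst e) (chart_inv e)"
    using eA(3) by (simp_all add: is_chart_def homeomorphism_def)
  have chart_c: "is_chart (pts P) ?c" and inv_c: "\<And>x. x \<in> (g \<circ> snd e) ` (fst e \<inter> pts P) \<Longrightarrow> chart_inv ?c x = chart_inv e (f x)"
  proof -
    have op: "openin (top_of_set (pts P)) (fst e \<inter> pts P)"
      using eA(3) pts_P by (auto simp: is_chart_def openin_open)
    have "open (f -` (snd e ` fst e))"
      using eA(3) by (intro open_vimage) (auto simp: is_chart_def linear_continuous_on bf)
    then have op': "open ((g \<circ> snd e) ` (fst e \<inter> pts P))" unfolding img .
    have c1: "continuous_on (fst e \<inter> pts P) (g \<circ> snd e)"
      by (intro continuous_on_compose continuous_on_subset[OF cont_e(1)] linear_continuous_on bg) auto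
    have c2: "continuous_on ((g \<circ> snd e) ` (fst e \<inter> pts P)) (\<lambda>x. chart_inv e (f x))"
      unfolding img by (rule continuous_on_compose2[OF cont_e(2) linear_continuous_on[OF bf]]) auto
    have "chart_inv e (f ((g \<circ> snd e) r)) = r" if "r \<in> fst e \<inter> pts P" for r
      using that eL fg is_chart_inv[OF eA(3)] by simp
    note is_chartI[OF op op' c1 c2 this]
    then show "is_chart (pts P) ?c" "\<And>x. x \<in> (g \<circ> snd e) ` (fst e \<inter> pts P) \<Longrightarrow> chart_inv ?c x = chart_inv e (f x)" by blast+
  qed
  have c_to: "smooth_on (overlap ?c d) (transition ?c d) \<and> (\<forall>x\<in>overlap ?c d. inj (frechet_derivative (transition ?c d) (at x)))"
    if d: "d \<in> A" for d
  proof -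
    have op: "open (overlap ?c d)" by (rule open_overlap[OF chart_c chart[OF d] pts_P])
    have ov: "f x \<in> overlap e d \<and> transition e d (f x) = transition ?c d x" if x: "x \<in> overlap ?c d" for x
    proof -
      obtain r where r: "r \<in> fst e" "r \<in> pts P" "r \<in> fst d" "x = g (snd e r)" using x by (auto simp: overlap_def)
      then have "f x = snd e r" using eL fg by simp
      then show ?thesis using r inv_c[of x] by (auto simp: overlap_def transition_def)
    qed
    note sm = smooth_transition[OF eA(1) d]
    have "smooth_on (overlap ?c d) (\<lambda>x. transition e d (f x))"
      by (rule smooth_on_compose[OF op open_param_overlap[OF eA(5) d] _ smooth_on_bounded_linear[OF op bf smooth_on_id[OF op]] sm])
        (use ov in auto)
    then have 1: "smooth_on (overlap ?c d) (transition ?c d)"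
      by (rule smooth_on_cong[OF op]) (use ov in auto)
    moreover have "inj (frechet_derivative (transition ?c d) (at x))" if x: "x \<in> overlap ?c d" for x
    proof -
      obtain r where r: "r \<in> fst e" "r \<in> pts P" "r \<in> fst d" "f x = snd e r"
        using x eL fg by (auto simp: overlap_def)
      have ed: "e \<in> charts_at A r" "d \<in> charts_at A r" using r eA d by (auto simp: charts_at_def)
      have "(transition e d \<circ> f has_derivative jac e d r \<circ> f) (at x)"
        using transition_has_derivative[OF charts_atD(5,2)[OF ed(1)] ed(2)] r(4) bounded_linear_imp_has_derivative[OF bf]
        by (intro diff_chain_at) auto
      then have "(transition ?c d has_derivative jac e d r \<circ> f) (at x)"
        by (rule has_derivative_transform_within_open[OF _ op x]) (use ov in auto)
      then have "frechet_derivative (transition ?c d) (at x) = jac e d r \<circ> f" by (rule frechet_derivative_at[symmetric])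
      moreover have "inj (jac e d r)" by (rule inj_on_inverseI[of _ "jac d e r"]) (rule jac_inverse[OF ed(2,1)])
      moreover have "inj f" by (rule inj_on_inverseI[of _ g]) (rule gf)
      ultimately show ?thesis by (simp add: inj_compose)
    qed
    ultimately show ?thesis by blast
  qed
  then have c: "?c \<in> charts_at (atlas P) p" using atlas_P chart_c p eA(2) by (auto simp: charts_at_def)
  have to_c: "smooth_on (overlap d ?c) (transition d ?c)" "\<And>x. x \<in> overlap d ?c \<Longrightarrow> inj (frechet_derivative (transition d ?c) (at x))"
    if d: "d \<in> atlas P" for d
  proof -
    have dc: "is_chart (pts P) d" and dp: "smooth_param M (pts P) d"
      using d atlas_P pts_P by (auto simp: smooth_param_def)
    have ov: "overlap d ?c = overlap d e" using is_chart_subset[OF dc] by (auto simp: overlap_def)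
    have op: "open (overlap d e)" by (rule open_param_overlap[OF dp eA(1)])
    have tr: "transition d ?c = (\<lambda>x. g (transition d e x))" by (simp add: transition_def comp_def)
    have sm: "smooth_on (overlap d e) (transition d e)" using dp eA(1) by (simp add: smooth_param_def)
    show "smooth_on (overlap d ?c) (transition d ?c)"
      unfolding ov tr by (rule smooth_on_bounded_linear[OF op bg sm])
    show "inj (frechet_derivative (transition d ?c) (at x))" if x: "x \<in> overlap d ?c" for x
    proof -
      obtain r where r: "r \<in> fst d" "r \<in> fst e" "x = snd d r" using x unfolding ov by (auto simp: overlap_def)
      have dr: "d \<in> charts_at (atlas P) r" and er: "e \<in> charts_at A r" using r d eA by (auto simp: charts_at_def)
      have "(transition d e has_derivative jac d e r) (at x)"
        using transition_has_derivative[OF dp r(1) er] r by simp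
      then have "((\<lambda>x. g (transition d e x)) has_derivative (\<lambda>v. g (jac d e r v))) (at x)"
        by (rule bounded_linear.has_derivative[OF bg])
      then have "frechet_derivative (transition d ?c) (at x) = (\<lambda>v. g (jac d e r v))"
        unfolding tr by (rule frechet_derivative_at[symmetric])
      \<comment> \<open>g is known to be injective only on L, but the Jacobian takes its values
        there.\<close>
      moreover have "inj (\<lambda>v. g (jac d e r v))"
      proof (rule injI)
        fix v w assume "g (jac d e r v) = g (jac d e r w)"
        then have "jac d e r v = jac d e r w" using fg jac_in_slice[OF e(2) dr r(2)] by metis
        then show "v = w" using inj_jac_P[OF dr er] by (simp add: inj_def)
      qed
      ultimately show ?thesis by simp
    qed
  qed
  \<comment> \<open>Membership of d in the atlas concerns maps from the model space into M, which is
    the other direction. The transition is therefore obtained as the inverse of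
    \<open>transition d ?c\<close>, whose derivative is injective between spaces of equal
    dimension.\<close>
  have "smooth_on (overlap ?c d) (transition ?c d)" if d: "d \<in> atlas P" for d
  proof -
    have dc: "is_chart (pts P) d" using d atlas_P by blast
    have op: "open (overlap ?c d)" "open (overlap d ?c)" using open_overlap chart_c dc by blast+
    have mem: "x \<in> overlap ?c d \<Longrightarrow> transition ?c d x \<in> overlap d ?c" for x
      using transition_apply[OF chart_c, where d = d] unfolding overlap_def by blast
    have self: "transition c c x = x" if "is_chart (pts P) c" "x \<in> overlap c d'" for c d' :: "('p, 'b) chart" and x
      using that transition_apply[OF that(1), where d = c] unfolding overlap_def by blast
    show ?thesis
    proof (rule smooth_on_inverse[OF op(2,1) to_c(1)[OF d] mem _ _ to_c(2)[OF d]])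
      show "transition d ?c (transition ?c d y) = y" if "y \<in> overlap ?c d" for y
        using transition_compose[OF chart_c dc that, of ?c] self[OF chart_c that] by simp
      show "transition ?c d (transition d ?c x) = x" if "x \<in> overlap d ?c" for x
        using transition_compose[OF dc chart_c that, of d] self[OF dc that] by simp
    qed
  qed
  then show thesis using that[OF c] to_c(1) by blast
qed

text \<open>The charts of P are related to M, not to each other. Near each point the transition
  factors through an adapted chart, for which both directions are known to be smooth.\<close>

lemma smooth_transition_P:
  assumes c: "c \<in> atlas P" and d: "d \<in> atlas P"
  shows "smooth_on (overlap c d) (transition c d)"
proof (rule smooth_on_local)
  have chart_c: "is_chart (pts P) c" "is_chart (pts P) d" using c d atlas_P by auto
  fix x assume "x \<in> overlap c d"
  then obtain p where p: "p \<in> fst c" "p \<in> fst d" "x = snd c p" by (auto simp: overlap_def)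
  then have "p \<in> pts P" using is_chart_subset[OF chart_c(1)] by blast
  then obtain e where e: "e \<in> charts_at (atlas P) p"
    and to: "\<And>d. d \<in> atlas P \<Longrightarrow> smooth_on (overlap d e) (transition d e)"
    and from_e: "\<And>d. d \<in> atlas P \<Longrightarrow> smooth_on (overlap e d) (transition e d)" using adapted_chart by metis
  note eA = atlas_PD[OF e]
  let ?U = "snd c ` (fst c \<inter> (fst d \<inter> fst e))"
  have U: "open ?U"
    by (rule open_chart_image[OF chart_c(1)]) (use chart_c eA in \<open>auto simp: is_chart_def\<close>)
  have "smooth_on ?U (\<lambda>x. transition e d (transition c e x))"
  proof (rule smooth_on_compose[OF U _ _ smooth_on_subset[OF to[OF c]] from_e[OF d]])
    show "open (overlap e d)" using open_overlap[OF eA(3) chart_c(2)] by simp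
    show "transition c e ` ?U \<subseteq> overlap e d"
      using transition_apply[OF chart_c(1), where d = e] unfolding overlap_def by auto
    show "?U \<subseteq> overlap c e" by (auto simp: overlap_def)
  qed
  then have "smooth_on ?U (transition c d)"
    by (rule smooth_on_cong[OF U]) (rule transition_compose[OF chart_c(1) eA(3)], auto simp: overlap_def)
  moreover have "x \<in> ?U" using p eA by auto
  ultimately show "\<exists>U. open U \<and> x \<in> U \<and> smooth_on U (transition c d)" using U by blast
qed

section \<open>The differential of the inclusion and the induced metric\<close>

lemma jac_P_has_derivative:
  assumes "c \<in> charts_at (atlas P) p" "d \<in> charts_at (atlas P) p"
  shows "(transition c d has_derivative jac c d p) (at (snd c p))"
  unfolding jac_def using atlas_PD[OF assms(1)] atlas_PD[OF assms(2)]
  by (intro smooth_on_has_derivative[OF smooth_transition_P]) (auto simp: overlap_def)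

lemma vec_of_change_P:
  assumes c: "c \<in> charts_at (atlas P) p" and d: "d \<in> charts_at (atlas P) p"
  shows "vec_of A c p a = vec_of A d p (jac c d p a)"
proof
  fix e
  show "vec_of A c p a e = vec_of A d p (jac c d p a) e"
  proof (cases "e \<in> charts_at A p")
    case True
    have "(transition c e has_derivative jac d e p \<circ> jac c d p) (at (snd c p))"
      by (rule has_derivative_transition_compose[OF atlas_PD(3)[OF c] atlas_PD(3)[OF d] order_refl atlas_PD(2)[OF c] atlas_PD(2)[OF d]
            jac_P_has_derivative[OF c d] transition_has_derivative[OF atlas_PD(6,2)[OF d] True]])
    from frechet_derivative_at[OF this] have "jac c e p = jac d e p \<circ> jac c d p" by (simp add: jac_def[of c e])
    then show ?thesis using True by (simp add: vec_of_apply)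
  qed (simp add: vec_of_apply)
qed

lemma chart_P: "c \<in> atlas P \<Longrightarrow> is_chart (pts P) c"
  using atlas_P by blast

lemma linear_incl: assumes "p \<in> pts P" shows "linear (incl p)"
proof -
  obtain c where "c \<in> charts_at (atlas P) p" using adapted_chart[OF assms] .
  then have c: "(SOME c. c \<in> charts_at (atlas P) p) \<in> charts_at (atlas P) p" (is "?c \<in> _") by (rule someI)
  have "incl p = vec_of A ?c p \<circ> (\<lambda>w. w ?c)" by (rule ext) (simp add: inclusion_differential_def Let_def)
  then show ?thesis
    using linear_compose[OF linear_tvec_component linear_vec_of[OF atlas_PD(6,2)[OF c]], of ?c] by simp
qed

text \<open>Frees \<open>inclusion_differential\<close> from the chart that it selects by choice:
  changing the chart of P does not change the ambient vector.\<close>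

lemma incl_vec_of:
  assumes c: "c \<in> charts_at (atlas P) p"
  shows "incl p (vec_of (atlas P) c p a) = vec_of A c p a"
proof -
  let ?c = "SOME c. c \<in> charts_at (atlas P) p"
  have c': "?c \<in> charts_at (atlas P) p" using c by (rule someI)
  then have "incl p (vec_of (atlas P) c p a) = vec_of A ?c p (jac c ?c p a)"
    by (simp add: inclusion_differential_def Let_def vec_of_def[of "atlas P"] jac_def)
  then show ?thesis using vec_of_change_P[OF c c'] by simp
qed

lemma incl_tangent:
  assumes "p \<in> pts P" shows "incl p w \<in> T p"
proof -
  obtain c where "c \<in> charts_at (atlas P) p" using adapted_chart[OF assms] .
  then have c: "(SOME c. c \<in> charts_at (atlas P) p) \<in> charts_at (atlas P) p" by (rule someI)
  show ?thesis unfolding inclusion_differential_def Let_def by (rule vec_of_tangent[OF atlas_PD(6,2)[OF c]])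
qed

lemma incl_eq_0:
  assumes p: "p \<in> pts P" and w: "w \<in> tangent_space (atlas P) p" and 0: "incl p w = 0"
  shows "w = 0"
proof -
  let ?c = "SOME c. c \<in> charts_at (atlas P) p"
  obtain c where "c \<in> charts_at (atlas P) p" using adapted_chart[OF p] .
  then have c: "?c \<in> charts_at (atlas P) p" by (rule someI)
  obtain e where e: "e \<in> charts_at A p" using charts_at_nonempty p pts_P by blast
  have "vec_of A ?c p (w ?c) e = 0" using 0 by (simp add: inclusion_differential_def Let_def)
  then have "jac ?c e p (w ?c) = 0" using e by (simp add: vec_of_apply)
  moreover have "linear (jac ?c e p)" by (rule linear_jac[OF atlas_PD(6,2)[OF c] e])
  ultimately have w0: "w ?c = 0" using inj_jac_P[OF c e] by (metis linear_injective_0)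
  have "w d = 0" for d
  proof (cases "d \<in> charts_at (atlas P) p")
    case True
    have "w d = jac ?c d p (w ?c)" using w c True unfolding tangent_space_def jac_def by blast
    also have "\<dots> = 0" using w0 linear_0[OF has_derivative_linear[OF jac_P_has_derivative[OF c True]]] by simp
    finally show ?thesis .
  next
    case False
    then show ?thesis using w unfolding tangent_space_def by blast
  qed
  then show ?thesis by (simp add: fun_eq_iff)
qed

lemma metric_coords_P:
  assumes c: "c \<in> charts_at (atlas P) p" and e: "e \<in> charts_at A p"
  shows "metric_coords P c (snd c p) a b = metric_coords M e (snd e p) (jac c e p a) (jac c e p b)"
proof -
  note cA = atlas_PD[OF c]
  have "metric_coords P c (snd c p) a b = metric M p (vec_of A c p a) (vec_of A c p b)"
    by (simp add: metric_coords_def Let_def is_chart_inv[OF cA(3,2)] metric_P incl_vec_of[OF c])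
  then show ?thesis
    by (simp add: metric_coords_apply[OF e] vec_of_change[OF cA(6,2) e])
qed

lemma metric_coords_P_pullback:
  assumes c: "c \<in> atlas P" and e: "e \<in> A" and x: "x \<in> overlap c e"
  shows "metric_coords P c x a b = metric_coords M e (transition c e x)
    (frechet_derivative (transition c e) (at x) a) (frechet_derivative (transition c e) (at x) b)"
proof -
  obtain p where p: "p \<in> fst c" "p \<in> fst e" "x = snd c p" using x by (auto simp: overlap_def)
  then have "c \<in> charts_at (atlas P) p" "e \<in> charts_at A p" using c e by (auto simp: charts_at_def)
  from metric_coords_P[OF this] show ?thesis
    using transition_apply[OF chart_P[OF c] p(1), of e] by (simp add: p jac_def)
qed

lemma transition_P_mem: "c \<in> atlas P \<Longrightarrow> transition c e ` overlap c e \<subseteq> snd e ` fst e"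
  using transition_apply[OF chart_P, of c _ e] by (auto simp: overlap_def)

lemma smooth_param_P: "c \<in> atlas P \<Longrightarrow> smooth_param M (pts P) c"
  using atlas_P pts_P by (simp add: smooth_param_def)

text \<open>Locally the coefficients are those of the ambient metric, composed with a smooth
  parametrization and evaluated on the images of two constant vectors under its derivative.\<close>

lemma smooth_metric_P:
  assumes c: "c \<in> atlas P"
  shows "smooth_on (snd c ` fst c) (\<lambda>x. metric_coords P c x a b)"
proof (rule smooth_on_local)
  fix x assume "x \<in> snd c ` fst c"
  then obtain p where p: "p \<in> fst c" "x = snd c p" by auto
  then have "p \<in> pts M" using is_chart_subset[OF chart_P[OF c]] pts_P by blast
  then obtain e where e: "e \<in> charts_at A p" using charts_at_nonempty by blast
  note eA = charts_atD[OF e]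
  let ?O = "overlap c e" let ?F = "transition c e" let ?D = "\<lambda>a x. frechet_derivative ?F (at x) a"
  have op: "open ?O" by (rule open_param_overlap[OF smooth_param_P[OF c] eA(1)])
  have F: "smooth_on ?O ?F" using smooth_param_P[OF c] eA(1) by (simp add: smooth_param_def)
  have mem: "?F y \<in> snd e ` fst e" if "y \<in> ?O" for y using transition_P_mem[OF c, of e] that by blast
  have 1: "smooth_on ?O (\<lambda>y. metric_coords M e (?F y) u v)" for u v
    by (rule smooth_on_compose[OF op pts_open[OF eA(1)] _ F smooth_metric[OF eA(1)]]) (use mem in blast)
  have 2: "smooth_on ?O (\<lambda>y. metric_coords M e (?F y) (?D a y) v)" for v
    by (rule smooth_on_linear_apply[OF op _ _ smooth_on_frechet_derivative[OF F], where A = "\<lambda>y u. metric_coords M e (?F y) u v"])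
      (fact metric_coords_linear(2)[OF eA(1) mem] 1)+
  have "smooth_on ?O (\<lambda>y. metric_coords M e (?F y) (?D a y) (?D b y))"
    by (rule smooth_on_linear_apply[OF op _ _ smooth_on_frechet_derivative[OF F], where A = "\<lambda>y. metric_coords M e (?F y) (?D a y)"])
      (fact metric_coords_linear(1)[OF eA(1) mem] 2)+
  then have "smooth_on ?O (\<lambda>x. metric_coords P c x a b)"
    by (rule smooth_on_cong[OF op]) (rule metric_coords_P_pullback[OF c eA(1), symmetric])
  moreover have "x \<in> ?O" using p eA by (simp add: overlap_def)
  ultimately show "\<exists>U. open U \<and> x \<in> U \<and> smooth_on U (\<lambda>x. metric_coords P c x a b)" using op by blast
qed

lemma inner_product_P:
  assumes p: "p \<in> pts P"
  shows "inner_product_on (tangent_space (atlas P) p) (metric P p)"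
proof -
  have pM: "p \<in> pts M" using p pts_P by blast
  note g = metric_linear[OF pM] note i = incl_tangent[OF p]
  note l = linear_add[OF linear_incl[OF p]] linear_cmul[OF linear_incl[OF p]]
  have sc: "r *\<^sub>R incl p w \<in> T p" for r w by (rule subspace_scale[OF subspace_tangent_space i])
  show ?thesis
    unfolding inner_product_on_def metric_P
  proof (intro conjI ballI allI impI)
    show "metric M p (incl p u) (incl p v) = metric M p (incl p v) (incl p u)" for u v by (rule g(1)[OF i i])
    show "metric M p (incl p (a *\<^sub>R u + b *\<^sub>R v)) (incl p w) = a * metric M p (incl p u) (incl p w) + b * metric M p (incl p v) (incl p w)" for u v w a b
      by (simp add: l g(2)[OF sc sc i] g(4)[OF i i])
    show "0 < metric M p (incl p u) (incl p u)" if "u \<in> tangent_space (atlas P) p" "u \<noteq> 0" for u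
      using g(9)[OF i] incl_eq_0[OF p that(1)] that(2) by blast
  qed
qed

sublocale P: riemannian_atlas P
proof
  show "(\<Union>c\<in>atlas P. fst c) = pts P"
  proof (intro equalityI subsetI)
    fix p assume "p \<in> pts P"
    then obtain c where "c \<in> charts_at (atlas P) p" using adapted_chart by blast
    then show "p \<in> (\<Union>c\<in>atlas P. fst c)" unfolding charts_at_def by blast
  qed (use chart_P is_chart_subset in blast)
qed (fact chart_P smooth_transition_P inner_product_P smooth_metric_P)+

lemma incl_eq_vec_of: "w \<in> P.T p \<Longrightarrow> c \<in> charts_at (atlas P) p \<Longrightarrow> incl p w = vec_of A c p (w c)"
  using incl_vec_of[of c p "w c"] P.vec_of_tangent_eq[of w p c] by simp

lemma incl_apply: "w \<in> P.T p \<Longrightarrow> c \<in> charts_at (atlas P) p \<Longrightarrow> e \<in> charts_at A p \<Longrightarrow> incl p w e = jac c e p (w c)"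
  by (simp add: incl_eq_vec_of vec_of_apply)

text \<open>In a slice chart the Jacobian of the inclusion maps injectively into L, and the
  dimensions agree, so it is onto L. This reconciles the tangent space defined by charts of P with
  the one defined by curves in M.\<close>

lemma incl_image:
  assumes p: "p \<in> pts P"
  shows "incl p ` P.T p = tangent_of M (pts P) p"
proof -
  obtain e L where e: "e \<in> charts_at A p" "slice_chart M e L (pts P)" "dim L = DIM('b)" using slice_P[OF p] .
  note eA = charts_atD[OF e(1)]
  obtain c where c: "c \<in> charts_at (atlas P) p" using adapted_chart[OF p] .
  note cA = atlas_PD[OF c]
  have tan: "tangent_of M (pts P) p = {v \<in> T p. v e \<in> L}" by (rule tangent_of_slice[OF e(2) eA(2) p])
  have lin: "linear (jac c e p)" by (rule linear_jac[OF cA(6,2) e(1)])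
  have J: "range (jac c e p) = L"
  proof (rule subspace_dim_equal)
    show "subspace (range (jac c e p))" using linear_subspace_image[OF lin subspace_UNIV] .
    show "subspace L" using e(2) by (simp add: slice_chart_def)
    show "range (jac c e p) \<subseteq> L" using jac_in_slice[OF e(2) c eA(2)] by blast
    have "dim (range (jac c e p)) = DIM('b)"
      using dim_image_eq[OF lin, of UNIV] inj_jac_P[OF c e(1)] by (simp add: inj_on_subset)
    then show "dim L \<le> dim (range (jac c e p))" using e(3) by simp
  qed
  show ?thesis
  proof (intro equalityI subsetI)
    fix v assume "v \<in> incl p ` P.T p"
    then obtain w where w: "w \<in> P.T p" "v = incl p w" by blast
    then show "v \<in> tangent_of M (pts P) p"
      using incl_tangent[OF p] incl_apply[OF w(1) c e(1)] J by (auto simp: tan)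
  next
    fix v assume "v \<in> tangent_of M (pts P) p"
    then have v: "v \<in> T p" "v e \<in> L" by (auto simp: tan)
    then obtain b where "v e = jac c e p b" using J by blast
    then have "incl p (vec_of (atlas P) c p b) = v"
      using vec_of_change[OF cA(6,2) e(1), of b] vec_of_tangent_eq[OF v(1) e(1)] by (simp add: incl_vec_of[OF c])
    moreover have "vec_of (atlas P) c p b \<in> P.T p"
      by (rule P.vec_of_tangent[OF P.smooth_param_atlas[OF cA(1)] cA(2)])
    ultimately show "v \<in> incl p ` P.T p" by blast
  qed
qed

lemma inj_incl:
  assumes p: "p \<in> pts P" and uv: "u \<in> P.T p" "v \<in> P.T p" "incl p u = incl p v"
  shows "u = v"
proof -
  have "u - v \<in> P.T p" using subspace_diff[OF P.subspace_tangent_space uv(1,2)] .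
  moreover have "incl p (u - v) = 0" using uv(3) linear_diff[OF linear_incl[OF p]] by simp
  ultimately show ?thesis using incl_eq_0[OF p] by fastforce
qed

lemma as_tangent:
  assumes p: "p \<in> pts P" and v: "v \<in> tangent_of M (pts P) p"
  shows "as_tangent P M p v \<in> P.T p" "incl p (as_tangent P M p v) = v"
proof -
  have "v \<in> incl p ` P.T p" using v incl_image[OF p] by simp
  then obtain w where w: "w \<in> P.T p" "incl p w = v" by (elim imageE) simp
  have "as_tangent P M p v = w"
    unfolding as_tangent_def by (rule the_equality) (use w inj_incl[OF p] in auto)
  then show "as_tangent P M p v \<in> P.T p" "incl p (as_tangent P M p v) = v" using w by simp_all
qed

end

section \<open>Normal sections\<close>

text \<open>Removing the n-component from a normal vector leaves a tangent vector orthogonal to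
  itself.\<close>

lemma (in hypersurface_point) normal_of_eq: "normal_of M S p = span {n}"
proof (intro equalityI subsetI)
  fix z assume z: "z \<in> normal_of M S p"
  then have zT: "z \<in> T p" by (simp add: normal_of_def)
  let ?d = "z - metric M p z n *\<^sub>R n"
  have d: "?d \<in> tangent_of M S p" by (rule tangent_decompose[OF zT])
  then have dT: "?d \<in> T p" using tangent_iff by blast
  have "metric M p ?d ?d = metric M p z ?d - metric M p z n * metric M p n ?d"
    using g_linear(8)[OF zT subspace_scale[OF subspace_tangent_space n_tangent_space] dT]
      g_linear(4)[OF n_tangent_space dT] by simp
  also have "\<dots> = 0" using z d n_orthogonal[OF d] by (simp add: normal_of_def)
  finally have "?d = 0" using g_linear(9)[OF dT] by fastforce
  then show "z \<in> span {n}" by (auto simp: span_singleton)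
next
  fix z assume "z \<in> span {n}"
  then obtain k where "z = k *\<^sub>R n" by (auto simp: span_singleton)
  then show "z \<in> normal_of M S p"
    using subspace_scale[OF subspace_tangent_space n_tangent_space] n_orthogonal g_linear(4)[OF n_tangent_space] tangent_iff
    by (auto simp: normal_of_def)
qed

text \<open>The last assumption, together with n being a unit normal of S, says that P meets S
  transversally at p.\<close>

locale normal_section = riemannian_submanifold_atlas M P + hypersurface_point M c L S p n
  for M :: "('p::topological_space, 'a::euclidean_space) riemannian"
    and P :: "('p, 'b::euclidean_space) riemannian" and c L S p n +
  assumes p_P: "p \<in> pts P" and n_P: "n \<in> tangent_of M (pts P) p"
begin

text \<open>The defining function \<open>\<phi>\<close> of \<open>S\<close> in a chart of \<open>P\<close> is made linear by the local
  diffeomorphism \<open>x \<mapsto> x + (\<phi> x - \<ell> x) w\<close>, where \<open>\<ell>\<close> is the derivative of \<open>\<phi>\<close> at \<open>p\<close> and \<open>\<ell> w = 1\<close>;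
  such a \<open>w\<close> exists because \<open>n\<close> is tangent to \<open>P\<close>.\<close>

lemma section_slice_chart:
  obtains d L' where "slice_chart P d L' (pts P \<inter> S)" "p \<in> fst d" "dim L' = DIM('b) - 1"
    "\<And>w. w \<in> P.T p \<Longrightarrow> w d \<in> L' \<longleftrightarrow> incl p w \<in> tangent_of M S p"
proof -
  obtain \<nu> where \<nu>: "\<nu> \<noteq> 0" "span L = {x. \<nu> \<bullet> x = 0}" using lowdim_eq_hyperplane[OF dim_L] .
  moreover have "span L = L" using subspace_L by (simp add: span_eq_iff)
  ultimately have L: "x \<in> L \<longleftrightarrow> \<nu> \<bullet> x = 0" for x by simp
  obtain d where d: "d \<in> charts_at (atlas P) p" using adapted_chart[OF p_P] .
  note dA = atlas_PD[OF d]
  let ?O = "overlap d c"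
  let ?F = "transition d c"
  let ?J = "jac d c p"
  define x0 where "x0 = snd d p"
  have opO: "open ?O" by (rule open_param_overlap[OF dA(6) chart_facts(1)])
  have x0: "x0 \<in> ?O" using dA p by (simp add: overlap_def x0_def)
  have F: "smooth_on ?O ?F" using dA(6) chart_facts(1) by (simp add: smooth_param_def)
  define \<phi> where "\<phi> = (\<lambda>x. ?F x \<bullet> \<nu>)"
  define l where "l = (\<lambda>v. ?J v \<bullet> \<nu>)"
  have \<phi>: "smooth_on ?O \<phi>" unfolding \<phi>_def by (rule smooth_on_bounded_linear[OF opO bounded_linear_inner_left F])
  have linJ: "linear ?J" by (rule linear_jac[OF dA(6,2) chart_at_p])
  have l: "linear l" unfolding l_def
    by (rule linearI) (simp_all add: linear_add[OF linJ] linear_cmul[OF linJ] inner_add_left)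
  have bl: "bounded_linear l" using l linear_conv_bounded_linear by blast
  have D\<phi>: "frechet_derivative \<phi> (at x0) = l"
  proof (rule frechet_derivative_at[symmetric])
    show "(\<phi> has_derivative l) (at x0)"
      unfolding \<phi>_def l_def x0_def by (rule has_derivative_inner_left[OF transition_has_derivative[OF dA(6,2) chart_at_p]])
  qed
  obtain w where w: "l w = 1"
  proof -
    have "n \<notin> tangent_of M S p" using n_orthogonal[of n] n_unit by auto
    then have "\<nu> \<bullet> n c \<noteq> 0" using tangent_iff n_tangent_space L by blast
    moreover have "n c = ?J (as_tangent P M p n d)"
      using incl_apply[OF as_tangent(1)[OF p_P n_P] d chart_at_p] as_tangent(2)[OF p_P n_P] by simp
    ultimately have "l (as_tangent P M p n d) \<noteq> 0" by (simp add: l_def inner_commute)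
    then have "l ((1 / l (as_tangent P M p n d)) *\<^sub>R as_tangent P M p n d) = 1" by (simp add: linear_cmul[OF l])
    then show thesis using that by blast
  qed
  define \<psi> where "\<psi> = (\<lambda>x. x + (\<phi> x + (-1) *\<^sub>R l x) *\<^sub>R w)"
  \<comment> \<open>The purpose of \<psi>: in the new coordinates S is the kernel of the linear form
    l.\<close>
  have l\<psi>: "l (\<psi> x) = \<phi> x" for x by (simp add: \<psi>_def linear_add[OF l] linear_cmul[OF l] w)
  have \<psi>: "smooth_on ?O \<psi>"
    unfolding \<psi>_def
    by (intro smooth_on_add[OF opO] smooth_on_scaleR[OF opO] smooth_on_id[OF opO] smooth_on_const \<phi>
        smooth_on_bounded_linear[OF opO bl])
  have D\<psi>: "frechet_derivative \<psi> (at x0) = id"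
  proof (rule frechet_derivative_at[symmetric])
    have "(\<phi> has_derivative l) (at x0)" using smooth_on_has_derivative[OF \<phi> x0] D\<phi> by simp
    then have "(\<psi> has_derivative (\<lambda>v. v + (l v + (-1) *\<^sub>R l v) *\<^sub>R w)) (at x0)"
      unfolding \<psi>_def
      by (intro has_derivative_add has_derivative_ident has_derivative_scaleR_left has_derivative_scaleR_right
          bounded_linear_imp_has_derivative[OF bl])
    then show "(\<psi> has_derivative id) (at x0)" by (simp add: id_def)
  qed
  \<comment> \<open>\<open>inverse_function_theorem\<close> wants the derivative as a continuous map
    into bounded operators; in finite dimension continuity may be tested on basis vectors.\<close>
  let ?f' = "\<lambda>x. Blinfun (frechet_derivative \<psi> (at x))"
  have f': "blinfun_apply (?f' x) = frechet_derivative \<psi> (at x)" if "x \<in> ?O" for x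
    using smooth_on_linear_derivative[OF \<psi> that] linear_conv_bounded_linear bounded_linear_Blinfun_apply by blast
  have contf: "continuous_on ?O ?f'"
  proof (rule continuous_on_blinfun_componentwise)
    fix i :: 'b
    have "continuous_on ?O (\<lambda>x. frechet_derivative \<psi> (at x) i)"
      by (rule smooth_on_continuous[OF smooth_on_frechet_derivative[OF \<psi>]])
    then show "continuous_on ?O (\<lambda>x. blinfun_apply (?f' x) i)"
      by (rule continuous_on_eq) (simp add: f')
  qed
  have inv0: "id_blinfun o\<^sub>L ?f' x0 = id_blinfun"
    using f'[OF x0] unfolding D\<psi> by (intro blinfun_eqI) simp
  obtain U V \<theta> \<theta>' where U: "open U" "U \<subseteq> ?O" "x0 \<in> U" and V: "open V" and hom: "homeomorphism U V \<psi> \<theta>"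
    and D\<theta>: "\<And>y. y \<in> V \<Longrightarrow> (\<theta> has_derivative \<theta>' y) (at y)"
    and \<theta>': "\<And>y. y \<in> V \<Longrightarrow> \<theta>' y = inv (blinfun_apply (?f' (\<theta> y)))"
    and bij: "\<And>y. y \<in> V \<Longrightarrow> bij (blinfun_apply (?f' (\<theta> y)))"
  proof (rule inverse_function_theorem[OF opO _ contf x0 inv0])
    show "(\<psi> has_derivative blinfun_apply (?f' x)) (at x)" if "x \<in> ?O" for x
      using smooth_on_has_derivative[OF \<psi> that] f'[OF that] by simp
  qed blast
  have h: "\<psi> ` U = V" "\<theta> ` V = U" "\<And>x. x \<in> U \<Longrightarrow> \<theta> (\<psi> x) = x" "\<And>y. y \<in> V \<Longrightarrow> \<psi> (\<theta> y) = y"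
    "continuous_on U \<psi>" "continuous_on V \<theta>" using hom by (auto simp: homeomorphism_def)
  have \<theta>U: "\<theta> y \<in> U" if "y \<in> V" for y using h(2) that by blast
  have \<psi>V: "\<psi> x \<in> V" if "x \<in> U" for x using h(1) that by blast
  \<comment> \<open>The inverse function theorem yields one derivative of the local inverse; the
    remaining orders come from \<open>smooth_on_inverse\<close>.\<close>
  have \<theta>: "smooth_on V \<theta>"
  proof (rule smooth_on_inverse[OF U(1) V smooth_on_subset[OF \<psi> U(2)] \<theta>U h(4) h(3)])
    show "inj (frechet_derivative \<psi> (at x))" if "x \<in> U" for x
      using bij[OF \<psi>V[OF that]] f'[of x] h(3)[OF that] U(2) that by (auto simp: bij_def)
  qed
  let ?W = "fst d \<inter> snd d -` U"
  let ?d = "(?W, \<psi> \<circ> snd d)"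
  have cont_d: "continuous_on (fst d) (snd d)" "continuous_on (snd d ` fst d) (chart_inv d)"
    using dA(3) by (simp_all add: is_chart_def homeomorphism_def)
  have OU: "?O \<subseteq> snd d ` fst d" by (auto simp: overlap_def)
  have W_img: "snd d ` ?W = U" using U(2) OU by auto
  then have img: "(\<psi> \<circ> snd d) ` ?W = V" using h(1) by (simp only: image_comp[symmetric])
  have mem: "snd d r \<in> U" "r \<in> fst d" "r \<in> fst c" "r \<in> pts P" if "r \<in> ?W" for r
  proof -
    show r: "snd d r \<in> U" "r \<in> fst d" using that by auto
    show "r \<in> pts P" using r(2) is_chart_subset[OF dA(3)] by blast
    obtain r' where r': "r' \<in> fst d" "r' \<in> fst c" "snd d r = snd d r'" using r(1) U(2) by (auto simp: overlap_def)
    have "r = r'" using is_chart_inv[OF dA(3) r(2)] unfolding r'(3) is_chart_inv[OF dA(3) r'(1)] by (rule sym)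
    then show "r \<in> fst c" using r' by simp
  qed
  have opW: "openin (top_of_set (pts P)) ?W"
  proof (rule openin_trans)
    show "openin (top_of_set (fst d)) ?W" by (rule continuous_openin_preimage_gen[OF cont_d(1) U(1)])
    show "openin (top_of_set (pts P)) (fst d)" using dA(3) by (simp add: is_chart_def)
  qed
  have chart': "is_chart (pts P) ?d" and inv': "\<And>y. y \<in> V \<Longrightarrow> chart_inv ?d y = chart_inv d (\<theta> y)"
  proof -
    have c1: "continuous_on ?W (\<psi> \<circ> snd d)"
      by (rule continuous_on_compose[OF continuous_on_subset[OF cont_d(1)]]) (use W_img h(5) in auto)
    have c2: "continuous_on ((\<psi> \<circ> snd d) ` ?W) (\<lambda>y. chart_inv d (\<theta> y))"
      unfolding img by (rule continuous_on_compose2[OF cont_d(2) h(6)]) (use h(2) U(2) OU in auto)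
    have inv: "chart_inv d (\<theta> ((\<psi> \<circ> snd d) r)) = r" if "r \<in> ?W" for r
      using mem[OF that] h(3) is_chart_inv[OF dA(3)] by simp
    have "open ((\<psi> \<circ> snd d) ` ?W)" unfolding img by (rule V)
    note is_chartI[OF opW this c1 c2 inv]
    then show "is_chart (pts P) ?d" "\<And>y. y \<in> V \<Longrightarrow> chart_inv ?d y = chart_inv d (\<theta> y)" unfolding img by blast+
  qed
  have "smooth_on (overlap ?d m) (transition ?d m) \<and> (\<forall>x\<in>overlap ?d m. inj (frechet_derivative (transition ?d m) (at x)))"
    if m: "m \<in> A" for m
  proof -
    have op: "open (overlap ?d m)" by (rule open_overlap[OF chart' chart[OF m] pts_P])
    have op': "open (overlap d m)" by (rule open_overlap[OF dA(3) chart[OF m] pts_P])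
    have ov: "y \<in> V \<and> \<theta> y \<in> overlap d m \<and> transition d m (\<theta> y) = transition ?d m y" if y: "y \<in> overlap ?d m" for y
    proof -
      obtain r where r: "r \<in> ?W" "r \<in> fst m" "y = \<psi> (snd d r)" using y by (auto simp: overlap_def)
      note rm = mem[OF r(1)]
      have "\<theta> y = snd d r" "y \<in> V" using r h(3) rm \<psi>V by auto
      then show ?thesis using r rm inv'[of y] by (auto simp: overlap_def transition_def)
    qed
    have sm: "smooth_on (overlap d m) (transition d m)" using dA(6) m by (simp add: smooth_param_def)
    have "smooth_on (overlap ?d m) (\<lambda>y. transition d m (\<theta> y))"
      by (rule smooth_on_compose[OF op op' _ smooth_on_subset[OF \<theta>] sm]) (use ov in auto)
    then have "smooth_on (overlap ?d m) (transition ?d m)"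
      by (rule smooth_on_cong[OF op]) (use ov in auto)
    moreover have "inj (frechet_derivative (transition ?d m) (at y))" if y: "y \<in> overlap ?d m" for y
    proof -
      note o = ov[OF y]
      have "(transition d m \<circ> \<theta> has_derivative frechet_derivative (transition d m) (at (\<theta> y)) \<circ> \<theta>' y) (at y)"
        using o smooth_on_has_derivative[OF sm] by (intro diff_chain_at D\<theta>) auto
      then have "(transition ?d m has_derivative frechet_derivative (transition d m) (at (\<theta> y)) \<circ> \<theta>' y) (at y)"
        by (rule has_derivative_transform_within_open[OF _ op y]) (use ov in auto)
      then have "frechet_derivative (transition ?d m) (at y) = frechet_derivative (transition d m) (at (\<theta> y)) \<circ> \<theta>' y"
        by (rule frechet_derivative_at[symmetric])
      moreover have "inj (\<theta>' y)" using bij_imp_bij_inv[OF bij] \<theta>' o by (simp add: bij_def)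
      moreover have "inj (frechet_derivative (transition d m) (at (\<theta> y)))"
        using dA(1) atlas_P m o by blast
      ultimately show ?thesis by (simp add: inj_compose)
    qed
    ultimately show ?thesis by blast
  qed
  then have dP: "?d \<in> atlas P" using atlas_P chart' by blast
  have p_W: "p \<in> ?W" using dA(2) U(3) by (simp add: x0_def)
  then have d'P: "?d \<in> charts_at (atlas P) p" using dP by (simp add: charts_at_def)
  define L' where "L' = {v. l v = 0}"
  \<comment> \<open>Presents the kernel of l as a hyperplane with nonzero normal vector, from which
    its dimension is read off.\<close>
  have "l v = adjoint ?J \<nu> \<bullet> v" for v
    using adjoint_works[OF linJ, of v \<nu>] by (simp add: l_def inner_commute)
  then have L'_eq: "L' = {v. adjoint ?J \<nu> \<bullet> v = 0}" and "adjoint ?J \<nu> \<noteq> 0"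
    using w by (auto simp: L'_def)
  have slice': "slice_chart P ?d L' (pts P \<inter> S)"
    unfolding slice_chart_def
  proof (intro conjI dP)
    show "subspace L'" unfolding L'_eq by (rule subspace_hyperplane)
    have "(\<psi> \<circ> snd d) r \<in> L' \<longleftrightarrow> r \<in> S" if "r \<in> ?W" for r
    proof -
      note rm = mem[OF that]
      have "(\<psi> \<circ> snd d) r \<in> L' \<longleftrightarrow> \<nu> \<bullet> snd c r = 0"
        using transition_apply[OF dA(3) rm(2), of c] by (simp add: L'_def l\<psi> \<phi>_def inner_commute)
      then show ?thesis using slice_chart_mem[OF slice rm(3)] L by simp
    qed
    then show "snd ?d ` (fst ?d \<inter> (pts P \<inter> S)) = snd ?d ` fst ?d \<inter> L'"
      using mem(4) by auto
  qed
  \<comment> \<open>The derivative of \<psi> at \<open>x0\<close> is the identity, so passing to the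
    new chart does not alter coordinates of vectors at p, and tangency can be decided with the old
    ones.\<close>
  have wd: "w ?d = w d" if "w \<in> P.T p" for w
  proof -
    have "(transition d ?d has_derivative id) (at x0)"
    proof (rule has_derivative_transform_within_open[OF _ U(1,3)])
      show "(\<psi> has_derivative id) (at x0)" using smooth_on_has_derivative[OF \<psi> x0] D\<psi> by simp
      show "\<psi> x = transition d ?d x" if "x \<in> U" for x
        using that U(2) OU is_chart_inv_right[of x d] by (auto simp: transition_def)
    qed
    from frechet_derivative_at[OF this] have "jac d ?d p = id" by (simp add: jac_def x0_def)
    then show ?thesis using P.tangent_space_apply[OF that d d'P] by simp
  qed
  have "w ?d \<in> L' \<longleftrightarrow> incl p w \<in> tangent_of M S p" if "w \<in> P.T p" for w
    using incl_apply[OF that d chart_at_p] incl_tangent[OF p_P] wd[OF that] by (simp add: tangent_iff L L'_def l_def inner_commute)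
  then show thesis
    using that[OF slice'] p_W dim_hyperplane[OF \<open>adjoint ?J \<nu> \<noteq> 0\<close>] by (simp add: L'_eq)
qed

lemma transition_maps_slice:
  assumes d: "slice_chart P d L' (pts P \<inter> S)" and y: "y \<in> overlap d c" "y \<in> L'"
  shows "transition d c y \<in> L"
proof -
  have dA: "d \<in> atlas P" using d by (simp add: slice_chart_def)
  obtain r where r: "r \<in> fst d" "r \<in> fst c" "y = snd d r" using y by (auto simp: overlap_def)
  have "r \<in> S" using P.slice_chart_mem[OF d r(1)] y r by simp
  then show ?thesis using slice_chart_mem[OF slice r(2)] transition_apply[OF chart_P[OF dA] r(1), of c] r(3) by simp
qed

text \<open>Along \<open>S\<close> the inclusion maps one slice into the other, so its second derivative in a direction
  tangent to \<open>P \<inter> S\<close> is tangent to \<open>S\<close>, hence orthogonal to \<open>n\<close>.\<close>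

lemma koszul_section:
  assumes d: "slice_chart P d L' (pts P \<inter> S)" "p \<in> fst d"
    and v: "v \<in> P.T p" "v d \<in> L'" and w: "w \<in> P.T p" "incl p w = n"
  shows "koszul (metric_coords P d) (snd d p) (v d) (v d) (w d) = K (incl p v) (incl p v)"
proof -
  have dP: "d \<in> charts_at (atlas P) p" by (rule P.slice_chart_charts_at[OF d])
  note dA = atlas_PD[OF dP]
  let ?O = "overlap d c" let ?F = "transition d c" let ?x = "snd d p"
  let ?H = "frechet_derivative (\<lambda>y. frechet_derivative ?F (at y) (v d)) (at ?x) (v d)"
  have op: "open ?O" by (rule open_param_overlap[OF dA(6) chart_facts(1)])
  have x: "?x \<in> ?O" using dA p by (simp add: overlap_def)
  have F: "smooth_on ?O ?F" using dA(6) chart_facts(1) by (simp add: smooth_param_def)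
  have Fx: "?F ?x = snd c p" by (rule transition_apply[OF dA(3,2)])
  have L': "subspace L'" using d(1) by (simp add: slice_chart_def)
  have xL': "?x \<in> L'" using P.slice_chart_mem[OF d] p p_P by simp
  have line: "y + t *\<^sub>R v d \<in> L'" if "y \<in> L'" for y t
    by (intro subspace_add[OF L'] subspace_scale[OF L'] that v)
  have DL: "frechet_derivative ?F (at y) (v d) \<in> L" if y: "y \<in> ?O" "y \<in> L'" for y
    by (rule derivative_in_subspace[OF subspace_L smooth_on_has_derivative[OF F y(1)] op y(1)])
      (rule transition_maps_slice[OF d(1) _ line[OF y(2)]])
  have HL: "?H \<in> L"
    by (rule derivative_in_subspace[OF subspace_L smooth_on_has_derivative[OF smooth_on_frechet_derivative[OF F] x] op x])
      (rule DL[OF _ line[OF xL']])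
  have J: "frechet_derivative ?F (at ?x) (u d) = incl p u c" if "u \<in> P.T p" for u
    using incl_apply[OF that dP chart_at_p] by (simp add: jac_def)
  have "metric M p (vec_of A c p ?H) n = 0"
  proof -
    have t: "vec_of A c p ?H \<in> tangent_of M S p"
      by (rule constant_slice_field(2)[OF slice HL]) (use p in blast)
    then show ?thesis using n_orthogonal[OF t] g_linear(1)[OF n_tangent_space] tangent_iff by simp
  qed
  then have 0: "metric_coords M c (snd c p) ?H (n c) = 0"
    by (simp add: metric_coords_apply[OF chart_at_p] vec_of_tangent_eq[OF n_tangent_space chart_at_p])
  have "koszul (metric_coords P d) ?x (v d) (v d) (w d) =
      koszul (metric_coords M c) (?F ?x) (frechet_derivative ?F (at ?x) (v d)) (frechet_derivative ?F (at ?x) (v d)) (frechet_derivative ?F (at ?x) (w d))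
      + metric_coords M c (?F ?x) ?H (frechet_derivative ?F (at ?x) (w d))"
    by (rule koszul_pullback[OF op x transition_P_mem[OF dA(1)] F _ _ _ smooth_metric[OF chart_facts(1)]])
      (fact metric_coords_linear[OF chart_facts(1)] metric_coords_P_pullback[OF dA(1) chart_facts(1)])+
  then show ?thesis by (simp add: J v w Fx 0)
qed

text \<open>The vectors of \<alpha>, regarded as tangent to P, form an orthonormal basis of the
  tangent space of the section. The trace formula inside P then applies, and
  \<open>koszul_section\<close> replaces each summand by the corresponding ambient one.\<close>

lemma mean_curvature_section:
  assumes \<alpha>: "finite \<alpha>" "\<alpha> \<subseteq> tangent_of M S p" "\<And>u v. u \<in> \<alpha> \<Longrightarrow> v \<in> \<alpha> \<Longrightarrow> metric M p u v = (if u = v then 1 else 0)"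
    and tan: "tangent_of M (pts P) p = span (insert n \<alpha>)"
  defines "S' \<equiv> pts P \<inter> S" and "n' \<equiv> as_tangent P M p n"
  shows "hypersurface_near P S' p" "normal_of P S' p = span {n'}"
    "mean_curvature P S' p n' = (\<Sum>v\<in>\<alpha>. K v v) / real (card \<alpha>)"
proof -
  obtain d L' where d: "slice_chart P d L' S'" "p \<in> fst d" "dim L' = DIM('b) - 1"
    and L': "\<And>w. w \<in> P.T p \<Longrightarrow> w d \<in> L' \<longleftrightarrow> incl p w \<in> tangent_of M S p"
    using section_slice_chart unfolding S'_def by blast
  have pS': "p \<in> S'" using p p_P by (simp add: S'_def)
  have dP: "d \<in> charts_at (atlas P) p" by (rule P.slice_chart_charts_at[OF d(1,2)])
  have tanP: "tangent_of P S' p = {w \<in> P.T p. incl p w \<in> tangent_of M S p}"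
    using P.tangent_of_slice[OF d(1,2) pS'] L' by blast
  note n' = as_tangent[OF p_P n_P, folded n'_def]
  interpret H: hypersurface_point P d L' S' p n'
  proof
    show "n' \<in> normal_of P S' p"
      using n' n_orthogonal by (auto simp: normal_of_def tanP metric_P)
    show "metric P p n' n' = 1" using n' n_unit by (simp add: metric_P)
  qed (use d pS' in auto)
  show "normal_of P S' p = span {n'}" by (rule H.normal_of_eq)
  \<comment> \<open>The domain of the slice chart serves as the neighbourhood: transversality is
    known at p, and further away P and S may meet in other ways.\<close>
  show "hypersurface_near P S' p"
    unfolding hypersurface_near_def
  proof (intro exI[of _ "fst d"] conjI)
    show "openin (top_of_set (pts P)) (fst d)" using H.chart_facts(3) by (simp add: is_chart_def)
    show "p \<in> S' \<inter> fst d" using pS' d by simp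
    have "snd d ` (fst d \<inter> (S' \<inter> fst d)) = snd d ` fst d \<inter> L'"
      using d(1) by (simp add: slice_chart_def Int_absorb2 Int_commute Int_left_commute Int_assoc)
    then have "\<exists>c\<in>charts_at (atlas P) r. \<exists>L. subspace L \<and> dim L = DIM('b) - 1 \<and> snd c ` (fst c \<inter> (S' \<inter> fst d)) = snd c ` fst c \<inter> L"
      if "r \<in> S' \<inter> fst d" for r
      using P.slice_chart_charts_at[OF d(1), of r] that H.subspace_L d(3)
      by (intro bexI[of _ d] exI[of _ L']) auto
    then show "submanifold P (DIM('b) - 1) (S' \<inter> fst d)"
      unfolding submanifold_def S'_def by blast
  qed
  let ?as = "as_tangent P M p"
  have \<alpha>P: "v \<in> tangent_of M (pts P) p" if "v \<in> \<alpha>" for v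
    unfolding tan using that by (simp add: span_base)
  have as: "?as v \<in> P.T p" "incl p (?as v) = v" if "v \<in> \<alpha>" for v
    using as_tangent[OF p_P \<alpha>P[OF that]] by simp_all
  have as_tan: "?as v \<in> tangent_of P S' p" if "v \<in> \<alpha>" for v
    using as[OF that] that \<alpha>(2) by (auto simp: tanP)
  have inj: "inj_on ?as \<alpha>" by (rule inj_on_inverseI[of _ "incl p"]) (rule as(2))
  have E: "orthonormal_basis (metric P p) (tangent_of P S' p) (?as ` \<alpha>)"
    unfolding orthonormal_basis_def
  proof (intro conjI ballI)
    show "finite (?as ` \<alpha>)" using \<alpha>(1) by simp
    show "metric P p e f = (if e = f then 1 else 0)" if "e \<in> ?as ` \<alpha>" "f \<in> ?as ` \<alpha>" for e f
      using that as(2) \<alpha>(3) inj by (auto simp: metric_P inj_on_def)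
    show "span (?as ` \<alpha>) = tangent_of P S' p"
    proof
      show le: "span (?as ` \<alpha>) \<subseteq> tangent_of P S' p"
        by (rule span_minimal[OF _ H.subspace_tangent]) (use as_tan in blast)
      show "tangent_of P S' p \<subseteq> span (?as ` \<alpha>)"
      proof
        fix t assume "t \<in> tangent_of P S' p"
        then have t: "t \<in> P.T p" "incl p t \<in> tangent_of M S p" by (auto simp: tanP)
        have "incl p t \<in> incl p ` P.T p" using t(1) by blast
        then have "incl p t \<in> span (insert n \<alpha>)" using incl_image[OF p_P] tan by simp
        \<comment> \<open>A tangent vector of the section is k n plus a combination of \<alpha>.
          Since all but k n is tangent to S, so is k n; pairing with n gives k = 0.\<close>
        then obtain k where k: "incl p t - k *\<^sub>R n \<in> span \<alpha>" by (auto simp: span_breakdown_eq)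
        have "span \<alpha> \<subseteq> tangent_of M S p" by (rule span_minimal[OF \<alpha>(2) subspace_tangent])
        then have "incl p t - (incl p t - k *\<^sub>R n) \<in> tangent_of M S p"
          by (rule subspace_diff[OF subspace_tangent t(2) subsetD[OF _ k]])
        then have "metric M p n (k *\<^sub>R n) = 0" using n_orthogonal by simp
        then have "k = 0" using g_linear(5)[OF n_tangent_space n_tangent_space, of k] n_unit by simp
        then have "incl p t \<in> span \<alpha>" using k by simp
        also have "\<alpha> = incl p ` ?as ` \<alpha>" using as(2) by (force simp: image_image)
        also have "span \<dots> = incl p ` span (?as ` \<alpha>)" by (rule linear_span_image[OF linear_incl[OF p_P]])
        finally obtain t' where t': "t' \<in> span (?as ` \<alpha>)" "incl p t = incl p t'" by (elim imageE)
        then have "t' \<in> P.T p" using le tanP by blast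
        then have "t = t'" by (rule inj_incl[OF p_P t(1) _ t'(2)])
        then show "t \<in> span (?as ` \<alpha>)" using t' by simp
      qed
    qed
  qed
  have "mean_curvature P S' p n' = (\<Sum>e\<in>?as ` \<alpha>. H.K e e) / real (card (?as ` \<alpha>))"
    by (rule H.mean_curvature_eq[OF E])
  also have "\<dots> = (\<Sum>v\<in>\<alpha>. H.K (?as v) (?as v)) / real (card \<alpha>)"
    using inj by (simp add: card_image sum.reindex)
  also have "(\<Sum>v\<in>\<alpha>. H.K (?as v) (?as v)) = (\<Sum>v\<in>\<alpha>. K v v)"
  proof (rule sum.cong[OF refl])
    fix v assume v: "v \<in> \<alpha>"
    have "?as v d \<in> L'" using L'[OF as(1)[OF v]] as_tan[OF v] tanP by simp
    from koszul_section[OF d(1)[unfolded S'_def] d(2) as(1)[OF v] this n']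
    show "H.K (?as v) (?as v) = K v v" using as(2)[OF v] by simp
  qed
  finally show "mean_curvature P S' p n' = (\<Sum>v\<in>\<alpha>. K v v) / real (card \<alpha>)" .
qed

end

text \<open>Double counting of the pairs of a subset and an element of it: each v lies in (card B -
  1 choose s - 1) subsets, and s times the number of subsets is card B times that count.\<close>

lemma average_over_subsets:
  fixes f :: "'a \<Rightarrow> real"
  assumes B: "finite B" and s: "0 < s" "s \<le> card B"
  shows "(\<Sum>\<alpha> | \<alpha> \<subseteq> B \<and> card \<alpha> = s. (\<Sum>v\<in>\<alpha>. f v) / real s) / real (card {\<alpha>. \<alpha> \<subseteq> B \<and> card \<alpha> = s})
       = (\<Sum>v\<in>B. f v) / real (card B)"
proof -
  let ?A = "{\<alpha>. \<alpha> \<subseteq> B \<and> card \<alpha> = s}"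
  \<comment> \<open>k and m are the predecessors of s and \<open>card B\<close>: a subset containing
    v is v together with k of the m other elements.\<close>
  obtain k where k: "s = Suc k" using s(1) by (cases s) auto
  obtain m where m: "card B = Suc m" using s by (cases "card B") auto
  have finA: "finite ?A" using B by simp
  have cnt: "card {\<alpha> \<in> ?A. v \<in> \<alpha>} = m choose k" if v: "v \<in> B" for v
  proof -
    have "{\<alpha> \<in> ?A. v \<in> \<alpha>} = insert v ` {\<beta>. \<beta> \<subseteq> B - {v} \<and> card \<beta> = k}"
    proof (intro equalityI subsetI)
      fix \<alpha> assume \<alpha>: "\<alpha> \<in> {\<alpha> \<in> ?A. v \<in> \<alpha>}"
      then have "finite \<alpha>" using B finite_subset by blast
      then have "\<alpha> - {v} \<in> {\<beta>. \<beta> \<subseteq> B - {v} \<and> card \<beta> = k}" using \<alpha> k by auto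
      moreover have "\<alpha> = insert v (\<alpha> - {v})" using \<alpha> by blast
      ultimately show "\<alpha> \<in> insert v ` {\<beta>. \<beta> \<subseteq> B - {v} \<and> card \<beta> = k}" by blast
    next
      fix \<alpha> assume "\<alpha> \<in> insert v ` {\<beta>. \<beta> \<subseteq> B - {v} \<and> card \<beta> = k}"
      then obtain \<beta> where \<beta>: "\<alpha> = insert v \<beta>" "\<beta> \<subseteq> B - {v}" "card \<beta> = k" by blast
      then have "finite \<beta>" using B finite_subset by blast
      then show "\<alpha> \<in> {\<alpha> \<in> ?A. v \<in> \<alpha>}" using \<beta> v k by (auto simp: card_insert_if)
    qed
    moreover have "inj_on (insert v) {\<beta>. \<beta> \<subseteq> B - {v} \<and> card \<beta> = k}" by (rule inj_onI) blast
    ultimately have "card {\<alpha> \<in> ?A. v \<in> \<alpha>} = card {\<beta>. \<beta> \<subseteq> B - {v} \<and> card \<beta> = k}" by (simp add: card_image)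
    also have "\<dots> = m choose k" using n_subsets[of "B - {v}" k] B v m by simp
    finally show ?thesis .
  qed
  have "(\<Sum>\<alpha>\<in>?A. \<Sum>v\<in>\<alpha>. f v) = (\<Sum>\<alpha>\<in>?A. \<Sum>v\<in>B. if v \<in> \<alpha> then f v else 0)"
    by (rule sum.cong[OF refl]) (use B in \<open>auto simp: sum.inter_restrict[symmetric] Int_absorb1\<close>)
  also have "\<dots> = (\<Sum>v\<in>B. \<Sum>\<alpha>\<in>?A. if v \<in> \<alpha> then f v else 0)" by (rule sum.swap)
  also have "\<dots> = (\<Sum>v\<in>B. real (m choose k) * f v)"
    by (rule sum.cong[OF refl]) (simp add: sum.inter_filter[OF finA, symmetric] cnt[simplified])
  finally have S: "(\<Sum>\<alpha>\<in>?A. \<Sum>v\<in>\<alpha>. f v) = real (m choose k) * (\<Sum>v\<in>B. f v)" by (simp add: sum_distrib_left)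
  have C: "card ?A = Suc m choose Suc k" using n_subsets[OF B, of s] m k by simp
  have "Suc k * (Suc m choose Suc k) = Suc m * (m choose k)" using Suc_times_binomial_eq[of m k] by (simp only: mult.commute)
  then have "s * card ?A = card B * (m choose k)"
    unfolding C unfolding k m .
  then have *: "real s * real (card ?A) = real (card B) * real (m choose k)"
    by (simp only: of_nat_mult[symmetric])
  have pos: "real (m choose k) > 0" "real (card B) > 0" using s k m by auto
  have "(\<Sum>\<alpha>\<in>?A. (\<Sum>v\<in>\<alpha>. f v) / real s) / real (card ?A) = real (m choose k) * (\<Sum>v\<in>B. f v) / (real s * real (card ?A))"
    by (simp add: S flip: sum_divide_distrib)
  also have "\<dots> = (\<Sum>v\<in>B. f v) / real (card B)"
    unfolding * using pos by simp
  finally show ?thesis .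
qed

section \<open>From the pointwise formulas at q to the average over all subsets\<close>

lemma riemannian_manifold_atlas: "riemannian_manifold M \<Longrightarrow> riemannian_atlas M"
  unfolding riemannian_manifold_def smooth_structure_def compatible_def by unfold_locales auto

theorem corollary5:
  fixes M :: "('p::{t2_space,second_countable_topology}, 'a::euclidean_space) riemannian"
    and \<Sigma> :: "'p set" and q :: 'p
    and N :: "('p, 'a) tvec" and B :: "('p, 'a) tvec set"
    and P :: "('p, 'a) tvec set \<Rightarrow> ('p, 'b::euclidean_space) riemannian"
    and m s :: nat
  assumes "riemannian_manifold M" and "DIM('a) = m + 1" and "m + 1 \<ge> 3"
    and "submanifold M m \<Sigma>" and "q \<in> \<Sigma>"
    and "N \<in> normal_of M \<Sigma> q" and "metric M q N N = 1"
    and "orthonormal_basis (metric M q) (tangent_of M \<Sigma> q) B"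
    and "0 < s" and "s \<le> m - 1" and "DIM('b) = s + 1"
    and "\<And>\<alpha>. \<alpha> \<subseteq> B \<Longrightarrow> card \<alpha> = s \<Longrightarrow>
           riemannian_submanifold (P \<alpha>) M \<and> q \<in> pts (P \<alpha>) \<and> totally_geodesic_at (P \<alpha>) M q \<and>
           tangent_of M (pts (P \<alpha>)) q = span (insert N \<alpha>)"
  shows "(\<forall>\<alpha>. \<alpha> \<subseteq> B \<and> card \<alpha> = s \<longrightarrow>
            hypersurface_near (P \<alpha>) (pts (P \<alpha>) \<inter> \<Sigma>) q \<and>
            normal_of (P \<alpha>) (pts (P \<alpha>) \<inter> \<Sigma>) q = span {as_tangent (P \<alpha>) M q N}) \<and>
         mean_curvature M \<Sigma> q N =
           (\<Sum>\<alpha> | \<alpha> \<subseteq> B \<and> card \<alpha> = s.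
              mean_curvature (P \<alpha>) (pts (P \<alpha>) \<inter> \<Sigma>) q (as_tangent (P \<alpha>) M q N))
           / real (card {\<alpha>. \<alpha> \<subseteq> B \<and> card \<alpha> = s})"
proof -
  interpret riemannian_atlas M using riemannian_manifold_atlas assms(1) .
  obtain c L where c: "slice_chart M c L \<Sigma>" "q \<in> fst c" "dim L = DIM('a) - 1"
  proof -
    have "\<exists>c\<in>charts_at A q. \<exists>L. subspace L \<and> dim L = m \<and> snd c ` (fst c \<inter> \<Sigma>) = snd c ` fst c \<inter> L"
      using assms(4,5) unfolding submanifold_def by blast
    then show thesis using that assms(2) charts_atD unfolding slice_chart_def by (metis add_diff_cancel_right')
  qed
  interpret H: hypersurface_point M c L \<Sigma> q N
    by unfold_locales (use c assms(5-7) in auto)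
  \<comment> \<open>The slice chart of \<Sigma> is fixed before \<alpha>, so one and the same
    function is summed for all subsets.\<close>
  let ?f = "\<lambda>v. H.K v v"
  have fin: "finite B" and on: "\<And>u v. u \<in> B \<Longrightarrow> v \<in> B \<Longrightarrow> metric M q u v = (if u = v then 1 else 0)"
    and "span B = tangent_of M \<Sigma> q"
    using assms(8) by (auto simp: orthonormal_basis_def)
  then have tan: "B \<subseteq> tangent_of M \<Sigma> q" using span_superset by blast
  have card_B: "card B = m" using H.card_orthonormal_basis[OF assms(8)] c(3) assms(2) by simp
  have sec: "hypersurface_near (P \<alpha>) (pts (P \<alpha>) \<inter> \<Sigma>) q"
    "normal_of (P \<alpha>) (pts (P \<alpha>) \<inter> \<Sigma>) q = span {as_tangent (P \<alpha>) M q N}"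
    "mean_curvature (P \<alpha>) (pts (P \<alpha>) \<inter> \<Sigma>) q (as_tangent (P \<alpha>) M q N) = (\<Sum>v\<in>\<alpha>. ?f v) / real s"
    if \<alpha>: "\<alpha> \<subseteq> B" "card \<alpha> = s" for \<alpha>
  proof -
    note P = assms(12)[OF \<alpha>]
    \<comment> \<open>N lies in the prescribed tangent space
      \<open>span (insert N \<alpha>)\<close>, which is the transversality that the locale
      requires.\<close>
    interpret S: normal_section M "P \<alpha>" c L \<Sigma> q N
      by unfold_locales (use P in \<open>auto simp: span_base\<close>)
    have "finite \<alpha>" "\<alpha> \<subseteq> tangent_of M \<Sigma> q" using \<alpha> fin tan finite_subset by blast+
    moreover have "metric M q u v = (if u = v then 1 else 0)" if "u \<in> \<alpha>" "v \<in> \<alpha>" for u v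
      using on that \<alpha>(1) by blast
    ultimately have *: "finite \<alpha>" "\<alpha> \<subseteq> tangent_of M \<Sigma> q"
      "\<And>u v. u \<in> \<alpha> \<Longrightarrow> v \<in> \<alpha> \<Longrightarrow> metric M q u v = (if u = v then 1 else 0)"
      "tangent_of M (pts (P \<alpha>)) q = span (insert N \<alpha>)"
      using P by blast+
    show "hypersurface_near (P \<alpha>) (pts (P \<alpha>) \<inter> \<Sigma>) q" by (rule S.mean_curvature_section(1)[OF *])
    show "normal_of (P \<alpha>) (pts (P \<alpha>) \<inter> \<Sigma>) q = span {as_tangent (P \<alpha>) M q N}"
      by (rule S.mean_curvature_section(2)[OF *])
    show "mean_curvature (P \<alpha>) (pts (P \<alpha>) \<inter> \<Sigma>) q (as_tangent (P \<alpha>) M q N) = (\<Sum>v\<in>\<alpha>. ?f v) / real s"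
      using S.mean_curvature_section(3)[OF *] \<alpha>(2) by simp
  qed
  have "mean_curvature M \<Sigma> q N = (\<Sum>v\<in>B. ?f v) / real (card B)" by (rule H.mean_curvature_eq[OF assms(8)])
  also have "\<dots> = (\<Sum>\<alpha> | \<alpha> \<subseteq> B \<and> card \<alpha> = s. (\<Sum>v\<in>\<alpha>. ?f v) / real s) / real (card {\<alpha>. \<alpha> \<subseteq> B \<and> card \<alpha> = s})"
    by (rule average_over_subsets[symmetric]) (use fin assms(9,10) card_B in auto)
  also have "(\<Sum>\<alpha> | \<alpha> \<subseteq> B \<and> card \<alpha> = s. (\<Sum>v\<in>\<alpha>. ?f v) / real s) =
      (\<Sum>\<alpha> | \<alpha> \<subseteq> B \<and> card \<alpha> = s. mean_curvature (P \<alpha>) (pts (P \<alpha>) \<inter> \<Sigma>) q (as_tangent (P \<alpha>) M q N))"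
    by (rule sum.cong[OF refl]) (simp add: sec(3))
  finally show ?thesis using sec(1,2) by blast
qed

end
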